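(* For every integer $n\ge 0$, the map $\widetilde\Phi:\mathfrak{M}_n\to\mathrm{SYT}_{\le3}(n)$ is bijective, and its restriction to $\mathfrak{R}_n$ provides a bijection between $\mathfrak{R}_n$ and $\mathrm{SYT}^{\equiv}_{\le 3}(n)$.
   Context: Permutations and paths. For a permutation $\pi=\pi_1\cdots\pi_n$ of $[n]=\{1,\dots,n\}$, an entry $\pi_i$ is a left-to-right (LR) maximum if $\pi_i>\pi_j$ for all $j<i$; $\mathrm{LR}(\pi)$ is the set of LR maxima (as values). $\mathfrak{M}_n$ is the set of $321$-avoiding permutations $\pi$ of $[n]$ such that every LR maximum $\pi_i$ is a descent ($i<n$ and $\pi_i>\pi_{i+1}$) or a fixed point ($\pi_i=i$). $\mathfrak{R}_n$ is the set of fixed-point-free permutations in $\mathfrak{M}_n$. A Motzkin path of length $n$ is a lattice path from $(0,0)$ to $(n,0)$ with steps $\mathsf{U}=(1,1)$, $\mathsf{H}=(1,0)$, $\mathsf{D}=(1,-1)$ never going below the $x$-axis, identified with its word of steps; a Riordan path is a Motzkin path with no $\mathsf{H}$-step on the $x$-axis. $\mathcal{M}_n$ and $\mathcal{R}_n$ denote the sets of Motzkin and Riordan paths of length $n$. The bijection $\alpha:\mathfrak{M}_n\to\mathcal{M}_n$ (which maps $\mathfrak{R}_n$ onto $\mathcal{R}_n$). For $\pi\in\mathfrak{M}_n$ let $D(\pi)=\{\pi_i:\pi_i\in\mathrm{LR}(\pi),\ \pi_i\ne i\}$ and $U(\pi)=\{\pi_{i+1}:\pi_i\in D(\pi)\}$.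 Then $\alpha(\pi)=w_1\cdots w_n$ with $w_v=\mathsf{D}$ if $v\in D(\pi)$, $w_v=\mathsf{U}$ if $v\in U(\pi)$, and $w_v=\mathsf{H}$ otherwise. The map $\hat\gamma$. Each $w\in\mathcal{M}_n\setminus\mathcal{R}_n$ is uniquely $w=w_0\,\mathsf{H}\,w_1$ where the displayed $\mathsf{H}$ is the first $\mathsf{H}$-step on the $x$-axis. Define $\gamma:\mathcal{M}_n\setminus\mathcal{R}_n\to\mathcal{R}_{n+1}$ by $\gamma(w_0\,\mathsf{H}\,w_1)=w_0\,\mathsf{U}\,w_1\,\mathsf{D}$, and $\hat\gamma=\alpha^{-1}\circ\gamma\circ\alpha:\mathfrak{M}_n\setminus\mathfrak{R}_n\to\mathfrak{R}_{n+1}$ (inner $\alpha$ on $\mathfrak{M}_n$, outer $\alpha^{-1}$ on $\mathcal{M}_{n+1}$). Tableaux. $\mathrm{SYT}_{\le3}(n)$ is the set of standard Young tableaux with $n$ cells and at most three rows, of shape $(\lambda_1,\lambda_2,\lambda_3)$ with $\lambda_1\ge\lambda_2\ge\lambda_3\ge0$. $\mathrm{SYT}^{\equiv}_{\le 3}(n)$ is the subset with $\lambda_1\equiv\lambda_2\equiv\lambda_3\pmod 2$ (empty rows included and counted as even). The map $\varrho:\mathrm{SYT}^{\equiv}_{\le 3}(n+1)\to\mathrm{SYT}_{\le3}(n)\setminus\mathrm{SYT}^{\equiv}_{\le 3}(n)$ removes the entry $n+1$. The map $\Phi:\mathfrak{R}_N\to\mathrm{SYT}^{\equiv}_{\le 3}(N)$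 (for every $N$). Let $\pi\in\mathfrak{R}_N$ have LR maxima $m_1<\cdots<m_k=N$. For $1\le j\le k-1$ let $a_j$ be the largest entry of $\pi$ located strictly between $m_j$ and $m_{j+1}$, and let $a_k=\pi_N$. Let $b_1<\cdots<b_{N-2k}$ be the elements of $\{1,\dots,N\}$ that are not among the $m_j$ and $a_j$. Let $\theta(\pi)=m_1\,a_1\,m_2\,a_2\cdots m_k\,a_k\,b_1\cdots b_{N-2k}$ and let $P(\theta(\pi))$ be its Robinson–Schensted insertion tableau (row insertion), which has at most three rows. On tableaux with $N$ cells of shape $(\lambda_1,\lambda_2,\lambda_3)$ consider the moves: (M1) (applied when $\lambda_3>0$ and $\lambda_3\not\equiv N\pmod 2$) Let $y$ be the last entry of row 3 and $x$ the largest entry of row 2 with $x<y$; remove $y$ from row 3, replace $x$ by $y$ in row 2, and append $x$ to the end of row 1. (M2) (applied when $\lambda_2>0$ and $\lambda_2\not\equiv N\pmod 2$) Move the last entry of row 2 to the end of row 1. A nonempty row of length $\not\equiv N\pmod 2$ is called defective. $\Psi(T)$ is obtained by applying (M1) if row 3 is defective, and then (M2) if the resulting row 2 is defective. Set $\Phi(\pi)=P(\theta(\pi))$ if its three row lengths have equal parity, and $\Phi(\pi)=\Psi(P(\theta(\pi)))$ otherwise. The map $\widetilde\Phi$. For $\pi\in\mathfrak{M}_n$, $\widetilde\Phi(\pi)=\Phi(\pi)$ if $\pi\in\mathfrak{R}_n$, and $\widetilde\Phi(\pi)=(\varrho\circ\Phi\circ\hat\gamma)(\pi)$ if $\pi\in\mathfrak{M}_n\setminus\mathfrak{R}_n$.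 *)

theory Defs
  imports "HOL-Combinatorics.Multiset_Permutations"
begin

text \<open>
  A permutation \<open>\<pi>\<^sub>1\<dots>\<pi>\<^sub>n\<close> of \<open>{1..n}\<close> is the list of its values.  List positions
  count from 0, so \<open>\<pi> ! i\<close> is the entry \<open>\<pi>\<^sub>i\<^sub>+\<^sub>1\<close> and a fixed point reads \<open>\<pi> ! i = Suc i\<close>.
\<close>

definition LR_max_at :: "nat list \<Rightarrow> nat \<Rightarrow> bool" where
  "LR_max_at \<pi> i \<longleftrightarrow> i < length \<pi> \<and> (\<forall>j<i. \<pi> ! j < \<pi> ! i)"

definition descent_at :: "nat list \<Rightarrow> nat \<Rightarrow> bool" where
  "descent_at \<pi> i \<longleftrightarrow> Suc i < length \<pi> \<and> \<pi> ! i > \<pi> ! Suc i"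

definition fixed_point_at :: "nat list \<Rightarrow> nat \<Rightarrow> bool" where
  "fixed_point_at \<pi> i \<longleftrightarrow> i < length \<pi> \<and> \<pi> ! i = Suc i"

definition avoids_321 :: "nat list \<Rightarrow> bool" where
  "avoids_321 \<pi> \<longleftrightarrow>
     \<not> (\<exists>i j k. i < j \<and> j < k \<and> k < length \<pi> \<and> \<pi> ! i > \<pi> ! j \<and> \<pi> ! j > \<pi> ! k)"

definition Motzkin_perms :: "nat \<Rightarrow> nat list set" where
  "Motzkin_perms n = {\<pi> \<in> permutations_of_set {1..n}. avoids_321 \<pi> \<and>
     (\<forall>i. LR_max_at \<pi> i \<longrightarrow> descent_at \<pi> i \<or> fixed_point_at \<pi> i)}"

definition Riordan_perms :: "nat \<Rightarrow> nat list set" where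
  "Riordan_perms n = {\<pi> \<in> Motzkin_perms n. \<forall>i. \<not> fixed_point_at \<pi> i}"

datatype step = U | H | D

fun rise :: "step \<Rightarrow> int" where
  "rise U = 1"
| "rise H = 0"
| "rise D = - 1"

definition height :: "step list \<Rightarrow> int" where
  "height w = (\<Sum>s\<leftarrow>w. rise s)"

definition Motzkin_paths :: "nat \<Rightarrow> step list set" where
  "Motzkin_paths n =
     {w. length w = n \<and> height w = 0 \<and> (\<forall>k\<le>n. height (take k w) \<ge> 0)}"

definition flat_on_axis_at :: "step list \<Rightarrow> nat \<Rightarrow> bool" where
  "flat_on_axis_at w i \<longleftrightarrow> i < length w \<and> w ! i = H \<and> height (take i w) = 0"

definition Riordan_paths :: "nat \<Rightarrow> step list set" where
  "Riordan_paths n = {w \<in> Motzkin_paths n. \<forall>i. \<not> flat_on_axis_at w i}"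

definition D_set :: "nat list \<Rightarrow> nat set" where
  "D_set \<pi> = {\<pi> ! i | i. LR_max_at \<pi> i \<and> \<not> fixed_point_at \<pi> i}"

definition U_set :: "nat list \<Rightarrow> nat set" where
  "U_set \<pi> = {\<pi> ! Suc i | i. Suc i < length \<pi> \<and> \<pi> ! i \<in> D_set \<pi>}"

definition alpha :: "nat list \<Rightarrow> step list" where
  "alpha \<pi> = map (\<lambda>v. if v \<in> D_set \<pi> then D else if v \<in> U_set \<pi> then U else H)
                 [1..<Suc (length \<pi>)]"

text \<open>\<open>w\<^sub>0 H w\<^sub>1\<close>, with the displayed \<open>H\<close> at the first \<open>H\<close>-step on the axis, becomes \<open>w\<^sub>0 U w\<^sub>1 D\<close>.
  Meant only for paths having such a step.\<close>

definition gamma :: "step list \<Rightarrow> step list" where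
  "gamma w = (let i = (LEAST i. flat_on_axis_at w i)
              in take i w @ [U] @ drop (Suc i) w @ [D])"

text \<open>\<open>alpha\<close> maps \<open>Motzkin_perms m\<close> bijectively onto \<open>Motzkin_paths m\<close> for every \<open>m\<close>; the inverse used
  here is the one for \<open>m = n + 1\<close>.\<close>

definition gamma_hat :: "nat \<Rightarrow> nat list \<Rightarrow> nat list" where
  "gamma_hat n \<pi> = inv_into (Motzkin_perms (Suc n)) alpha (gamma (alpha \<pi>))"

text \<open>A tableau is the list of its nonempty rows from top to bottom.  Rows are numbered from 0,
  and rows that are absent count as empty: \<open>row T 0\<close>, \<open>row T 1\<close>, \<open>row T 2\<close> have lengths
  \<open>\<lambda>\<^sub>1\<close>, \<open>\<lambda>\<^sub>2\<close>, \<open>\<lambda>\<^sub>3\<close>.\<close>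

definition row :: "nat list list \<Rightarrow> nat \<Rightarrow> nat list" where
  "row T i = (if i < length T then T ! i else [])"

definition standard_tableaux :: "nat \<Rightarrow> nat list list set" where
  "standard_tableaux n = {T.
     [] \<notin> set T \<and>
     (\<forall>i. Suc i < length T \<longrightarrow> length (T ! Suc i) \<le> length (T ! i)) \<and>
     concat T \<in> permutations_of_set {1..n} \<and>
     (\<forall>r\<in>set T. sorted_wrt (<) r) \<and>
     (\<forall>i j. Suc i < length T \<and> j < length (T ! Suc i) \<longrightarrow> T ! i ! j < T ! Suc i ! j)}"

definition SYT3 :: "nat \<Rightarrow> nat list list set" where
  "SYT3 n = {T \<in> standard_tableaux n. length T \<le> 3}"

definition equal_parity :: "nat list list \<Rightarrow> bool" where
  "equal_parity T \<longleftrightarrow>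
     length (row T 0) mod 2 = length (row T 1) mod 2 \<and>
     length (row T 1) mod 2 = length (row T 2) mod 2"

definition SYT3_eq :: "nat \<Rightarrow> nat list list set" where
  "SYT3_eq n = {T \<in> SYT3 n. equal_parity T}"

definition tableau_of_rows :: "nat list \<Rightarrow> nat list \<Rightarrow> nat list \<Rightarrow> nat list list" where
  "tableau_of_rows r1 r2 r3 = filter (\<lambda>r. r \<noteq> []) [r1, r2, r3]"

definition rho :: "nat \<Rightarrow> nat list list \<Rightarrow> nat list list" where
  "rho n T = filter (\<lambda>r. r \<noteq> []) (map (removeAll (Suc n)) T)"

text \<open>The second component is the entry bumped out of the row, if any.\<close>

fun row_insert :: "nat \<Rightarrow> nat list \<Rightarrow> nat list \<times> nat option" where
  "row_insert x [] = ([x], None)"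
| "row_insert x (y # ys) =
     (if x < y then (x # ys, Some y)
      else (let (zs, b) = row_insert x ys in (y # zs, b)))"

fun tableau_insert :: "nat \<Rightarrow> nat list list \<Rightarrow> nat list list" where
  "tableau_insert x [] = [[x]]"
| "tableau_insert x (r # rs) =
     (case row_insert x r of
        (r', None) \<Rightarrow> r' # rs
      | (r', Some y) \<Rightarrow> r' # tableau_insert y rs)"

definition insertion_tableau :: "nat list \<Rightarrow> nat list list" where
  "insertion_tableau w = fold tableau_insert w []"

text \<open>\<open>LR_positions \<pi> ! j\<close> is the position of \<open>m\<^sub>j\<^sub>+\<^sub>1\<close>, since left-to-right maxima increase
  from left to right; \<open>between_max \<pi> j\<close> is \<open>a\<^sub>j\<^sub>+\<^sub>1\<close>.\<close>

definition LR_positions :: "nat list \<Rightarrow> nat list" where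
  "LR_positions \<pi> = filter (LR_max_at \<pi>) [0..<length \<pi>]"

definition between_max :: "nat list \<Rightarrow> nat \<Rightarrow> nat" where
  "between_max \<pi> j =
     (let ps = LR_positions \<pi>
      in if Suc j < length ps then Max ((!) \<pi> ` {ps ! j<..<ps ! Suc j}) else last \<pi>)"

definition theta :: "nat list \<Rightarrow> nat list" where
  "theta \<pi> =
     (let ma = concat (map (\<lambda>j. [\<pi> ! (LR_positions \<pi> ! j), between_max \<pi> j])
                           [0..<length (LR_positions \<pi>)])
      in ma @ sorted_list_of_set ({1..length \<pi>} - set ma))"

definition cells :: "nat list list \<Rightarrow> nat" where
  "cells T = length (concat T)"

definition defective :: "nat list list \<Rightarrow> nat \<Rightarrow> bool" where
  "defective T i \<longleftrightarrow> row T i \<noteq> [] \<and> length (row T i) mod 2 \<noteq> cells T mod 2"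

text \<open>In a standard tableau whose third row is nonempty, the maximum below is over a nonempty set:
  it contains the entry directly above \<open>y\<close>.\<close>

definition M1 :: "nat list list \<Rightarrow> nat list list" where
  "M1 T = (let y = last (row T 2);
               x = Max {z \<in> set (row T 1). z < y}
           in tableau_of_rows (row T 0 @ [x])
                              (map (\<lambda>z. if z = x then y else z) (row T 1))
                              (butlast (row T 2)))"

definition M2 :: "nat list list \<Rightarrow> nat list list" where
  "M2 T = tableau_of_rows (row T 0 @ [last (row T 1)]) (butlast (row T 1)) (row T 2)"

definition Psi :: "nat list list \<Rightarrow> nat list list" where
  "Psi T = (let T' = (if defective T 2 then M1 T else T)
            in if defective T' 1 then M2 T' else T')"

definition Phi :: "nat list \<Rightarrow> nat list list" where
  "Phi \<pi> = (let T = insertion_tableau (theta \<pi>) in if equal_parity T then T else Psi T)"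

definition Phi_tilde :: "nat \<Rightarrow> nat list \<Rightarrow> nat list list" where
  "Phi_tilde n \<pi> =
     (if \<pi> \<in> Riordan_perms n then Phi \<pi> else (rho n \<circ> Phi \<circ> gamma_hat n) \<pi>)"

end

theory Submission
  imports Defs
begin

text \<open>
A tableau with at most three rows is treated as the triple of the entry sets of its rows.  It is
standard exactly when each row \<^emph>\<open>dominates\<close> the next one: below every bound, the upper row has at
least as many entries as the lower one (\<open>bij_betw_tab\<close>).  Row insertion and the two moves then
exchange or transfer single entries between sets.

\<^bold>\<open>Permutations.\<close>  In a permutation from \<open>Riordan_perms n\<close> the left-to-right maxima, called
tops, increase, the other entries increase as well, and every top is followed by a nonempty block of
other entries.  The permutation is therefore determined by the set \<open>T\<close> of its tops \<open>m\<^sub>j\<close> and the set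
\<open>A\<close> of the last entries \<open>a\<^sub>j\<close> of its blocks.  The pairs that occur are those with \<open>|A| = |T|\<close>, \<open>A\<close>
dominating \<open>T\<close>, and every remaining entry \<open>b\<close> smaller than some element of \<open>A\<close>
(\<open>bij_betw_riordan_state\<close>).

\<^bold>\<open>Insertion.\<close>  Inserting \<open>m\<^sub>1 a\<^sub>1 \<dots> m\<^sub>k a\<^sub>k\<close> produces the rectangle with rows \<open>A\<close> and \<open>T\<close>.  The
remaining entries come in increasing order, so they add a horizontal strip to a \<open>2 \<times> k\<close> rectangle
and the second row keeps its length \<open>k\<close>.  Concretely, each \<open>b\<close> replaces the least larger entry \<open>c\<close> of
row 1, \<open>c\<close> replaces the least larger entry \<open>d\<close> of row 2, and \<open>d\<close> ends row 3; as soon as some \<open>b\<close>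
exceeds the whole first row, it and all later ones are appended there.  Such steps are deterministic
in both directions.  The condition that every \<open>b\<close> lies below an element of \<open>A\<close> is carried along by an
invariant, and turns into a condition on the result: either the first two rows are equally long, or
the entry \<open>x\<close> that M1 would raise into row 1 exceeds the first row (\<open>bij_betw_bumping\<close>).

\<^bold>\<open>Moves.\<close>  On these tableaux M1 is applied exactly when \<open>\<lambda>\<^sub>1 - \<lambda>\<^sub>2\<close> is odd, and it leads to tableaux
with \<open>\<lambda>\<^sub>1 - \<lambda>\<^sub>2\<close> even in which row 2 has an entry exceeding row 1.  Conversely, in such a tableau with
\<open>\<lambda>\<^sub>1 > \<lambda>\<^sub>2\<close>, let \<open>p\<close> be the last entry of row 1 and \<open>y\<close> the least entry of row 2 above \<open>p\<close>: if row 3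
has an entry above \<open>y\<close>, the tableau was left alone, and otherwise it came from M1.  M2 makes the
last entry of row 1 exceed row 2, and it was applied exactly when this holds in the result.  So both
moves together give a bijection onto the tableaux with rows of equal parity (\<open>bij_betw_fix_rows\<close>), and
\<open>Phi\<close> is a bijection (\<open>bij_betw_Phi\<close>).

\<^bold>\<open>Gluing.\<close>  The permutations with a fixed point are handled by going up from \<open>n\<close> to \<open>n + 1\<close> and back
down: \<open>alpha\<close> is a bijection matching fixed points with flat steps on the axis (\<open>bij_betw_alpha\<close>,
\<open>alpha_Riordan_iff\<close>), \<open>gamma\<close> is inverted at the last return to the axis before the end
(\<open>bij_betw_gamma\<close>), and \<open>rho\<close> is inverted by adding \<open>n + 1\<close> to the one row whose parity differs
from the other two (\<open>bij_betw_rho\<close>).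
\<close>

lemma bij_betw_onto:
  assumes "inj_on f A" "\<And>x. x \<in> A \<Longrightarrow> f x \<in> B" "\<And>y. y \<in> B \<Longrightarrow> y \<in> f ` A"
  shows "bij_betw f A B"
  using assms unfolding bij_betw_def by blast

section \<open>Counting entries below a bound\<close>

definition below :: "nat set \<Rightarrow> nat \<Rightarrow> nat" where
  "below S v = card {z \<in> S. z < v}"

text \<open>This is the ballot condition for two rows.  Unlike the comparison of columns it refers to no
positions, so exchanging one entry of a row changes it only between the two values exchanged.\<close>

definition dominates :: "nat set \<Rightarrow> nat set \<Rightarrow> bool" where
  "dominates S T \<longleftrightarrow> (\<forall>v. below T v \<le> below S v)"

text \<open>No element of \<open>S\<close> lies strictly between \<open>u\<close> and \<open>w\<close>.  The end points need not be in \<open>S\<close>: if \<open>w\<close> is,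
then \<open>w\<close> is the entry that \<open>u\<close> bumps out of the row \<open>S\<close>; if \<open>u\<close> is, then \<open>u\<close> is the entry that
reverse bumping by \<open>w\<close> removes.  As bumping replaces \<open>w\<close> by \<open>u\<close>, the same gap serves for both.\<close>

definition gap :: "nat set \<Rightarrow> nat \<Rightarrow> nat \<Rightarrow> bool" where
  "gap S u w \<longleftrightarrow> u < w \<and> (\<forall>z\<in>S. z \<le> u \<or> w \<le> z)"

lemma below_empty [simp]: "below {} v = 0"
  by (simp add: below_def)

lemma below_insert:
  assumes "finite S" "x \<notin> S"
  shows "below (insert x S) v = below S v + (if x < v then 1 else 0)"
proof -
  have "{z \<in> insert x S. z < v} = (if x < v then insert x {z \<in> S. z < v} else {z \<in> S. z < v})"
    by auto
  then show ?thesis using assms by (simp add: below_def)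
qed

lemma below_remove:
  assumes "finite S" "x \<in> S"
  shows "below S v = below (S - {x}) v + (if x < v then 1 else 0)"
  using below_insert[of "S - {x}" x v] assms by (simp add: insert_absorb)

lemma below_gap: "gap S u w \<Longrightarrow> u < v \<Longrightarrow> v \<le> w \<Longrightarrow> below S v = below S w"
  unfolding below_def gap_def by (rule arg_cong[of _ _ card]) force

lemma below_mono: "finite S \<Longrightarrow> v \<le> w \<Longrightarrow> below S v \<le> below S w"
  unfolding below_def by (rule card_mono) auto

lemma below_Suc: "finite S \<Longrightarrow> below S (Suc v) = below S v + (if v \<in> S then 1 else 0)"
proof -
  assume fin: "finite S"
  have "{z \<in> S. z < Suc v} = (if v \<in> S then insert v {z \<in> S. z < v} else {z \<in> S. z < v})"
    by (auto simp: less_Suc_eq)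
  then show ?thesis using fin by (simp add: below_def)
qed

lemma below_le_card: "finite S \<Longrightarrow> below S v \<le> card S"
  unfolding below_def by (rule card_mono) auto

lemma below_eq_card: "(\<And>z. z \<in> S \<Longrightarrow> z < v) \<Longrightarrow> below S v = card S"
  unfolding below_def by (rule arg_cong[of _ _ card]) auto

lemma below_less: "finite S \<Longrightarrow> c \<in> S \<Longrightarrow> c < v \<Longrightarrow> below S c < below S v"
  unfolding below_def by (rule psubset_card_mono) auto

lemma dominates_card:
  assumes "finite S" "finite T" "dominates S T"
  shows "card T \<le> card S"
proof -
  obtain v where v: "\<And>z. z \<in> T \<Longrightarrow> z < v"
    using assms(2) unfolding finite_nat_set_iff_bounded by blast
  have "card T = below T v" using v by (simp add: below_eq_card)
  also have "\<dots> \<le> below S v" using assms(3) by (simp add: dominates_def)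
  also have "\<dots> \<le> card S" using assms(1) by (rule below_le_card)
  finally show ?thesis .
qed

lemma below_set_sorted:
  assumes "sorted_wrt (<) r"
  shows "below (set r) v = card {j. j < length r \<and> r ! j < v}"
proof -
  have "{z \<in> set r. z < v} = (!) r ` {j. j < length r \<and> r ! j < v}"
    by (auto simp: in_set_conv_nth)
  moreover have "inj_on ((!) r) {j. j < length r \<and> r ! j < v}"
    using assms by (auto simp: inj_on_def strict_sorted_iff nth_eq_iff_index_eq)
  ultimately show ?thesis by (simp add: below_def card_image)
qed

lemma below_nth_sorted:
  assumes "sorted_wrt (<) r" "j < length r"
  shows "below (set r) (r ! j) = j"
proof -
  have "{i. i < length r \<and> r ! i < r ! j} = {..<j}"
  proof (intro equalityI subsetI)
    fix i assume "i \<in> {i. i < length r \<and> r ! i < r ! j}"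
    then show "i \<in> {..<j}"
      using assms sorted_wrt_nth_less[OF assms(1), of j i] by (cases i j rule: linorder_cases) auto
  next
    fix i assume "i \<in> {..<j}"
    then show "i \<in> {i. i < length r \<and> r ! i < r ! j}"
      using assms sorted_wrt_nth_less[OF assms(1), of i j] by auto
  qed
  then show ?thesis by (simp add: below_set_sorted[OF assms(1)])
qed

text \<open>Entry \<open>j\<close> of a sorted row has exactly \<open>j\<close> entries below it.  So comparing the counts just above the
entry \<open>s ! j\<close> says that the other row has at least \<open>j + 1\<close> entries up to there, which is the comparison
in column \<open>j\<close>.\<close>

lemma dominates_iff_columns:
  assumes r: "sorted_wrt (<) r" and s: "sorted_wrt (<) s" and disj: "set r \<inter> set s = {}"
  shows "dominates (set r) (set s) \<longleftrightarrow> length s \<le> length r \<and> (\<forall>j<length s. r ! j < s ! j)"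
proof
  assume dom: "dominates (set r) (set s)"
  have col: "j < length r \<and> r ! j < s ! j" if j: "j < length s" for j
  proof -
    \<comment> \<open>The bound is one more than the entry, so that the entry itself is counted.\<close>
    let ?v = "Suc (s ! j)"
    have "Suc j = below (set s) ?v"
      using below_nth_sorted[OF s j] j by (simp add: below_Suc)
    also have "\<dots> \<le> below (set r) ?v" using dom by (simp add: dominates_def)
    finally have le: "Suc j \<le> card {i. i < length r \<and> r ! i < ?v}"
      by (simp add: below_set_sorted[OF r])
    have "j < length r \<and> r ! j \<le> s ! j"
    proof (rule ccontr)
      assume no: "\<not> ?thesis"
      have "{i. i < length r \<and> r ! i < ?v} \<subseteq> {..<j}"
      proof
        fix i assume i: "i \<in> {i. i < length r \<and> r ! i < ?v}"
        show "i \<in> {..<j}"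
        proof (rule ccontr)
          assume "i \<notin> {..<j}"
          then have ji: "j \<le> i" "j < length r" using i by auto
          then have "r ! j \<le> r ! i" using sorted_wrt_nth_less[OF r, of j i] i
            by (cases "i = j") auto
          then show False using no ji i by auto
        qed
      qed
      from card_mono[OF _ this] le show False by simp
    qed
    moreover have "r ! j \<noteq> s ! j" if "j < length r"
      using disj that j by (auto dest: nth_mem)
    ultimately show ?thesis by (metis le_neq_implies_less)
  qed
  then show "length s \<le> length r \<and> (\<forall>j<length s. r ! j < s ! j)"
    by (meson not_le order_less_irrefl)
next
  assume A: "length s \<le> length r \<and> (\<forall>j<length s. r ! j < s ! j)"
  show "dominates (set r) (set s)"
    unfolding dominates_def below_set_sorted[OF r] below_set_sorted[OF s]
  proof
    fix v
    have "{j. j < length s \<and> s ! j < v} \<subseteq> {j. j < length r \<and> r ! j < v}"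
      using A by fastforce
    then show "card {j. j < length s \<and> s ! j < v} \<le> card {j. j < length r \<and> r ! j < v}"
      by (intro card_mono) auto
  qed
qed

section \<open>Standard tableaux as triples of sets\<close>

type_synonym filling = "nat set \<times> nat set \<times> nat set"

text \<open>The triples of row sets of the standard tableaux with at most three rows.  Later rows cannot be
longer than earlier ones, since dominance also compares the cardinalities.\<close>

definition std :: "nat \<Rightarrow> filling set" where
  "std n = {(S1, S2, S3). S1 \<union> S2 \<union> S3 = {1..n} \<and> S1 \<inter> S2 = {} \<and> S1 \<inter> S3 = {} \<and> S2 \<inter> S3 = {} \<and>
     dominates S1 S2 \<and> dominates S2 S3}"

fun tab :: "filling \<Rightarrow> nat list list" where
  "tab (S1, S2, S3) =
     tableau_of_rows (sorted_list_of_set S1) (sorted_list_of_set S2) (sorted_list_of_set S3)"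

lemma std_finite:
  assumes "(S1, S2, S3) \<in> std n"
  shows "finite S1" "finite S2" "finite S3"
proof -
  have "finite (S1 \<union> S2 \<union> S3)" using assms by (simp add: std_def)
  then show "finite S1" "finite S2" "finite S3" by auto
qed

lemma std_card:
  assumes "(S1, S2, S3) \<in> std n"
  shows "card S2 \<le> card S1" "card S3 \<le> card S2" "card S1 + card S2 + card S3 = n"
proof -
  note fin = std_finite[OF assms]
  have d: "dominates S1 S2" "dominates S2 S3" "S1 \<union> S2 \<union> S3 = {1..n}"
    and dj: "S1 \<inter> S2 = {}" "(S1 \<union> S2) \<inter> S3 = {}"
    using assms by (auto simp: std_def)
  show "card S2 \<le> card S1" by (rule dominates_card[OF fin(1,2) d(1)])
  show "card S3 \<le> card S2" by (rule dominates_card[OF fin(2,3) d(2)])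
  have "card (S1 \<union> S2 \<union> S3) = card S1 + card S2 + card S3"
    using fin dj by (metis card_Un_disjoint finite_UnI)
  then show "card S1 + card S2 + card S3 = n" using d by simp
qed

text \<open>Only tableaux whose empty rows come last survive the deletion of empty rows without a shift of
the row numbers.\<close>

lemma row_tableau_of_rows:
  assumes "r1 = [] \<longrightarrow> r2 = []" "r2 = [] \<longrightarrow> r3 = []"
  shows "row (tableau_of_rows r1 r2 r3) 0 = r1" "row (tableau_of_rows r1 r2 r3) (Suc 0) = r2"
    "row (tableau_of_rows r1 r2 r3) 2 = r3"
proof -
  consider "r1 = []" "r2 = []" "r3 = []" | "r1 \<noteq> []" "r2 = []" "r3 = []"
    | "r1 \<noteq> []" "r2 \<noteq> []"
    using assms by blast
  then have "row (tableau_of_rows r1 r2 r3) 0 = r1 \<and> row (tableau_of_rows r1 r2 r3) (Suc 0) = r2 \<and>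
      row (tableau_of_rows r1 r2 r3) 2 = r3"
    by cases (simp_all add: tableau_of_rows_def row_def)
  then show "row (tableau_of_rows r1 r2 r3) 0 = r1" "row (tableau_of_rows r1 r2 r3) (Suc 0) = r2"
    "row (tableau_of_rows r1 r2 r3) 2 = r3"
    by blast+
qed

lemma row_tab:
  assumes "(S1, S2, S3) \<in> std n"
  shows "row (tab (S1, S2, S3)) 0 = sorted_list_of_set S1"
    "row (tab (S1, S2, S3)) (Suc 0) = sorted_list_of_set S2"
    "row (tab (S1, S2, S3)) 2 = sorted_list_of_set S3"
proof -
  have "sorted_list_of_set S1 = [] \<longrightarrow> sorted_list_of_set S2 = []"
    "sorted_list_of_set S2 = [] \<longrightarrow> sorted_list_of_set S3 = []"
    using std_card[OF assms] std_finite[OF assms] by auto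
  from row_tableau_of_rows[OF this]
  show "row (tab (S1, S2, S3)) 0 = sorted_list_of_set S1"
    "row (tab (S1, S2, S3)) (Suc 0) = sorted_list_of_set S2"
    "row (tab (S1, S2, S3)) 2 = sorted_list_of_set S3"
    by simp_all
qed

lemma tableau_of_rows_row:
  assumes "[] \<notin> set T" "length T \<le> 3"
  shows "tableau_of_rows (row T 0) (row T (Suc 0)) (row T 2) = T"
proof -
  have "length T = 0 \<or> length T = 1 \<or> length T = 2 \<or> length T = 3"
    using assms(2) by linarith
  then have "T = [] \<or> (\<exists>a. T = [a]) \<or> (\<exists>a b. T = [a,b]) \<or> (\<exists>a b c. T = [a,b,c])"
    by (auto simp: length_Suc_conv numeral_2_eq_2 numeral_3_eq_3)
  then show ?thesis using assms(1)
    by (elim disjE exE) (auto simp: tableau_of_rows_def row_def)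
qed

lemma standard_tableau_of_rows:
  assumes e: "r1 = [] \<longrightarrow> r2 = []" "r2 = [] \<longrightarrow> r3 = []"
  shows "tableau_of_rows r1 r2 r3 \<in> SYT3 n \<longleftrightarrow>
    r1 @ r2 @ r3 \<in> permutations_of_set {1..n} \<and>
    sorted_wrt (<) r1 \<and> sorted_wrt (<) r2 \<and> sorted_wrt (<) r3 \<and>
    length r2 \<le> length r1 \<and> length r3 \<le> length r2 \<and>
    (\<forall>j<length r2. r1 ! j < r2 ! j) \<and> (\<forall>j<length r3. r2 ! j < r3 ! j)"
proof -
  have all2: "(\<forall>i. Suc i < Suc (Suc 0) \<longrightarrow> P i) \<longleftrightarrow> P 0" for P
    by auto
  have all3: "(\<forall>i. i < Suc (Suc 0) \<longrightarrow> P i) \<longleftrightarrow> P 0 \<and> P (Suc 0)" for P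
    by (auto simp: less_Suc_eq)
  have cur: "(\<forall>i j. A i \<and> B i j \<longrightarrow> C i j) \<longleftrightarrow> (\<forall>i. A i \<longrightarrow> (\<forall>j. B i j \<longrightarrow> C i j))"
    for A B and C :: "nat \<Rightarrow> nat \<Rightarrow> bool" by blast
  consider "r1 = []" "r2 = []" "r3 = []" | "r1 \<noteq> []" "r2 = []" "r3 = []"
    | "r1 \<noteq> []" "r2 \<noteq> []" "r3 = []" | "r1 \<noteq> []" "r2 \<noteq> []" "r3 \<noteq> []"
    using e by blast
  then show ?thesis
  proof cases
    case 1 then show ?thesis
      by (simp add: SYT3_def standard_tableaux_def tableau_of_rows_def)
  next
    case 2 then show ?thesis
      by (simp add: SYT3_def standard_tableaux_def tableau_of_rows_def)
  next
    case 3 then show ?thesis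
      by (simp add: SYT3_def standard_tableaux_def tableau_of_rows_def cur all2)
        (rule iffI; elim conjE; intro conjI; assumption)
  next
    case 4 then show ?thesis
      by (simp add: SYT3_def standard_tableaux_def tableau_of_rows_def cur all3)
        (rule iffI; elim conjE; intro conjI; assumption)
  qed
qed

lemma SYT3_rowsD:
  assumes "T \<in> SYT3 n"
  shows "row T 0 = [] \<longrightarrow> row T (Suc 0) = []" "row T (Suc 0) = [] \<longrightarrow> row T 2 = []"
    "tableau_of_rows (row T 0) (row T (Suc 0)) (row T 2) = T"
proof -
  have T: "[] \<notin> set T" "length T \<le> 3" using assms by (auto simp: SYT3_def standard_tableaux_def)
  show "tableau_of_rows (row T 0) (row T (Suc 0)) (row T 2) = T" by (rule tableau_of_rows_row[OF T])
  have "row T i = [] \<longleftrightarrow> \<not> i < length T" for i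
  proof (cases "i < length T")
    case True
    then have "T ! i \<in> set T" by simp
    then have "T ! i \<noteq> []" using T(1) by metis
    then show ?thesis using True by (simp add: row_def)
  qed (simp add: row_def)
  then show "row T 0 = [] \<longrightarrow> row T (Suc 0) = []" "row T (Suc 0) = [] \<longrightarrow> row T 2 = []"
    by presburger+
qed

lemma sorted_rows_partition:
  fixes r1 r2 r3 :: "nat list"
  assumes "sorted_wrt (<) r1" "sorted_wrt (<) r2" "sorted_wrt (<) r3"
  shows "r1 @ r2 @ r3 \<in> permutations_of_set A \<longleftrightarrow>
    set r1 \<union> set r2 \<union> set r3 = A \<and> set r1 \<inter> set r2 = {} \<and> set r1 \<inter> set r3 = {} \<and> set r2 \<inter> set r3 = {}"
proof -
  have "distinct r1" "distinct r2" "distinct r3" using assms unfolding strict_sorted_iff by blast+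
  then show ?thesis by (auto simp: permutations_of_set_def)
qed

lemma standard_rows_iff_std:
  assumes s: "sorted_wrt (<) r1" "sorted_wrt (<) r2" "sorted_wrt (<) r3"
    and e: "r1 = [] \<longrightarrow> r2 = []" "r2 = [] \<longrightarrow> r3 = []"
  shows "tableau_of_rows r1 r2 r3 \<in> SYT3 n \<longleftrightarrow> (set r1, set r2, set r3) \<in> std n"
proof (cases "set r1 \<inter> set r2 = {} \<and> set r2 \<inter> set r3 = {}")
  case True
  then have "dominates (set r1) (set r2) \<longleftrightarrow> length r2 \<le> length r1 \<and> (\<forall>j<length r2. r1 ! j < r2 ! j)"
    "dominates (set r2) (set r3) \<longleftrightarrow> length r3 \<le> length r2 \<and> (\<forall>j<length r3. r2 ! j < r3 ! j)"
    using dominates_iff_columns[OF s(1,2)] dominates_iff_columns[OF s(2,3)] by blast+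
  then show ?thesis
    unfolding standard_tableau_of_rows[OF e] sorted_rows_partition[OF s] std_def mem_Collect_eq prod.case
    using s by blast
next
  case False
  then show ?thesis
    unfolding standard_tableau_of_rows[OF e] sorted_rows_partition[OF s] std_def mem_Collect_eq prod.case
    by blast
qed

lemma tab_in_SYT3:
  assumes "(S1, S2, S3) \<in> std n"
  shows "tab (S1, S2, S3) \<in> SYT3 n"
proof -
  note fin = std_finite[OF assms] and c = std_card[OF assms]
  have e: "sorted_list_of_set S1 = [] \<longrightarrow> sorted_list_of_set S2 = []"
    "sorted_list_of_set S2 = [] \<longrightarrow> sorted_list_of_set S3 = []"
    using c fin by auto
  have s: "sorted_wrt (<) (sorted_list_of_set S)" for S :: "nat set" by simp
  show ?thesis
    using standard_rows_iff_std[OF s s s e, of n] fin assms by simp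
qed

lemma bij_betw_tab: "bij_betw tab (std n) (SYT3 n)"
proof (rule bij_betw_byWitness[where f' = "\<lambda>T. (set (row T 0), set (row T (Suc 0)), set (row T 2))"])
  show "\<forall>S\<in>std n. (set (row (tab S) 0), set (row (tab S) (Suc 0)), set (row (tab S) 2)) = S"
  proof
    fix S assume S: "S \<in> std n"
    obtain S1 S2 S3 where eq: "S = (S1, S2, S3)" by (rule prod_cases3)
    note S' = S[unfolded eq]
    show "(set (row (tab S) 0), set (row (tab S) (Suc 0)), set (row (tab S) 2)) = S"
      unfolding eq row_tab[OF S'] using std_finite[OF S'] by simp
  qed
  have sorted: "sorted_wrt (<) (row T 0)" "sorted_wrt (<) (row T (Suc 0))" "sorted_wrt (<) (row T 2)"
    if "T \<in> SYT3 n" for T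
    using that standard_tableau_of_rows[OF SYT3_rowsD(1,2)[OF that], of n] unfolding SYT3_rowsD(3)[OF that]
    by blast+
  show "\<forall>T\<in>SYT3 n. tab (set (row T 0), set (row T (Suc 0)), set (row T 2)) = T"
  proof
    fix T assume T: "T \<in> SYT3 n"
    have "sorted_list_of_set (set r) = r" if "sorted_wrt (<) r" for r :: "nat list"
      using that unfolding strict_sorted_iff by (simp add: sorted_list_of_set.idem_if_sorted_distinct)
    then show "tab (set (row T 0), set (row T (Suc 0)), set (row T 2)) = T"
      using SYT3_rowsD(3)[OF T] sorted[OF T] by simp
  qed
  show "tab ` std n \<subseteq> SYT3 n"
  proof
    fix T assume "T \<in> tab ` std n"
    then obtain S1 S2 S3 where T: "T = tab (S1, S2, S3)" and S: "(S1, S2, S3) \<in> std n" by fast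
    show "T \<in> SYT3 n" unfolding T by (rule tab_in_SYT3[OF S])
  qed
  show "(\<lambda>T. (set (row T 0), set (row T (Suc 0)), set (row T 2))) ` SYT3 n \<subseteq> std n"
  proof safe
    fix T assume T: "T \<in> SYT3 n"
    show "(set (row T 0), set (row T (Suc 0)), set (row T 2)) \<in> std n"
      using T unfolding standard_rows_iff_std[OF sorted[OF T] SYT3_rowsD(1,2)[OF T], symmetric] SYT3_rowsD(3)[OF T] .
  qed
qed

section \<open>Bumping an entry through a rectangle\<close>

text \<open>Three rows together with the set of entries that are still to be inserted.\<close>

type_synonym state = "nat set \<times> nat set \<times> nat set \<times> nat set"

definition greatest :: "nat set \<Rightarrow> nat \<Rightarrow> bool" where
  "greatest S m \<longleftrightarrow> m \<in> S \<and> (\<forall>z\<in>S. z \<le> m)"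

text \<open>If the third row is not empty, its last entry \<open>d\<close> got there in the latest insertion step, when \<open>b\<close>
bumped \<open>c\<close> from row 1 and \<open>c\<close> bumped \<open>d\<close> from row 2.  These are the values that reverse bumping recovers.\<close>

definition last_bumps :: "filling \<Rightarrow> nat \<Rightarrow> nat \<Rightarrow> nat \<Rightarrow> bool" where
  "last_bumps = (\<lambda>(S1, S2, S3) b c d.
     greatest S3 d \<and> c \<in> S2 \<and> gap S2 c d \<and> b \<in> S1 \<and> gap S1 b c)"

text \<open>The last condition records that entries are inserted in increasing order: the entry inserted last
is smaller than all entries to come.\<close>

definition states :: "nat \<Rightarrow> state set" where
  "states n = {(S1, S2, S3, Q). S1 \<union> S2 \<union> S3 \<union> Q = {1..n} \<and>
     S1 \<inter> S2 = {} \<and> S1 \<inter> S3 = {} \<and> S2 \<inter> S3 = {} \<and> (S1 \<union> S2 \<union> S3) \<inter> Q = {} \<and>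
     card S1 = card S2 \<and> dominates S1 S2 \<and> dominates S2 S3 \<and>
     (\<forall>b c d. last_bumps (S1, S2, S3) b c d \<longrightarrow> (\<forall>q\<in>Q. b < q))}"

definition bump :: "nat \<Rightarrow> nat \<Rightarrow> nat \<Rightarrow> state \<Rightarrow> state \<Rightarrow> bool" where
  "bump b c d = (\<lambda>(S1, S2, S3, Q) (S1', S2', S3', Q').
     b \<in> Q \<and> (\<forall>q\<in>Q. b \<le> q) \<and> c \<in> S1 \<and> gap S1 b c \<and> d \<in> S2 \<and> gap S2 c d \<and>
     S1' = insert b (S1 - {c}) \<and> S2' = insert c (S2 - {d}) \<and> S3' = insert d S3 \<and> Q' = Q - {b})"

definition step_to :: "state \<Rightarrow> state \<Rightarrow> bool" where
  "step_to s t \<longleftrightarrow> (\<exists>b c d. bump b c d s t)"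

lemma gap_unique_up:
  assumes "gap S u w" "gap S u w'" "w \<in> S" "w' \<in> S"
  shows "w = w'"
proof -
  have "w' \<le> u \<or> w \<le> w'" "w \<le> u \<or> w' \<le> w" "u < w" "u < w'"
    using assms unfolding gap_def by blast+
  then show ?thesis by linarith
qed

lemma gap_unique_down:
  assumes "gap S u w" "gap S u' w" "u \<in> S" "u' \<in> S"
  shows "u = u'"
proof -
  have "u' \<le> u \<or> w \<le> u'" "u \<le> u' \<or> w \<le> u" "u < w" "u' < w"
    using assms unfolding gap_def by blast+
  then show ?thesis by linarith
qed

lemma greatest_unique: "greatest S u \<Longrightarrow> greatest S u' \<Longrightarrow> u = u'"
  unfolding greatest_def by (meson antisym)

lemma card_exchange:
  assumes "finite S" "c \<in> S" "b \<notin> S"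
  shows "card (insert b (S - {c})) = card S"
proof -
  have "card (insert b (S - {c})) = Suc (card (S - {c}))" using assms by simp
  then show ?thesis using card_Suc_Diff1[OF assms(1,2)] by simp
qed

lemma last_bumps_unique:
  assumes "last_bumps S b c d" "last_bumps S b' c' d'"
  shows "b = b' \<and> c = c' \<and> d = d'"
proof -
  obtain S1 S2 S3 where S: "S = (S1, S2, S3)" by (rule prod_cases3)
  have "d = d'" using assms unfolding S last_bumps_def prod.case by (blast intro: greatest_unique)
  moreover from this have "c = c'"
    using assms unfolding S last_bumps_def prod.case by (blast intro: gap_unique_down)
  moreover from this have "b = b'"
    using assms unfolding S last_bumps_def prod.case by (blast intro: gap_unique_down)
  ultimately show ?thesis by simp
qed

lemma ex_greatest: "finite S \<Longrightarrow> S \<noteq> {} \<Longrightarrow> \<exists>m. greatest S m"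
  unfolding greatest_def using Max_in Max_ge by blast

lemma ex_gap_up:
  assumes "z \<in> S" "u < z"
  shows "\<exists>w\<in>S. gap S u w"
proof -
  let ?w = "LEAST w. w \<in> S \<and> u < w"
  have "?w \<in> S \<and> u < ?w" by (rule LeastI[of _ z]) (use assms in simp)
  moreover have "z \<le> u \<or> ?w \<le> z" if "z \<in> S" for z
    using Least_le[of "\<lambda>w. w \<in> S \<and> u < w" z] that by linarith
  ultimately show ?thesis unfolding gap_def by blast
qed

lemma ex_gap_down:
  assumes "z \<in> S" "z < w" "finite S"
  shows "\<exists>u\<in>S. gap S u w"
proof -
  obtain u where u: "greatest {x \<in> S. x < w} u"
    using ex_greatest[of "{x \<in> S. x < w}"] assms by auto
  then have "u \<in> S" "gap S u w" by (auto simp: greatest_def gap_def)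
  then show ?thesis by blast
qed

lemma states_finite:
  assumes "(S1, S2, S3, Q) \<in> states n"
  shows "finite S1" "finite S2" "finite S3" "finite Q"
proof -
  have "finite (S1 \<union> S2 \<union> S3 \<union> Q)" using assms by (simp add: states_def)
  then show "finite S1" "finite S2" "finite S3" "finite Q" by auto
qed

lemma statesI:
  assumes "S1 \<union> S2 \<union> S3 \<union> Q = {1..n}" "S1 \<inter> S2 = {}" "S1 \<inter> S3 = {}" "S2 \<inter> S3 = {}"
    "(S1 \<union> S2 \<union> S3) \<inter> Q = {}" "card S1 = card S2" "dominates S1 S2" "dominates S2 S3"
    "\<And>b c d. last_bumps (S1, S2, S3) b c d \<Longrightarrow> \<forall>q\<in>Q. b < q"
  shows "(S1, S2, S3, Q) \<in> states n"
  unfolding states_def mem_Collect_eq prod.case using assms by blast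

lemma states_last_bumps:
  assumes "(S1, S2, S3, Q) \<in> states n" "last_bumps (S1, S2, S3) b c d"
  shows "\<forall>q\<in>Q. b < q"
proof -
  have "\<forall>b c d. last_bumps (S1, S2, S3) b c d \<longrightarrow> (\<forall>q\<in>Q. b < q)"
    using assms(1) unfolding states_def by simp
  then show ?thesis using assms(2) by blast
qed

text \<open>In a rectangle, what is bumped out of the upper row always bumps something out of the lower one: if
\<open>c\<close> exceeded all of \<open>T\<close>, then \<open>S\<close> would need \<open>card T\<close> entries below \<open>c\<close> in addition to \<open>c\<close>,
which is more than it has.\<close>

lemma dominates_ex_above:
  assumes fin: "finite S" "finite T" and dom: "dominates S T" and eq: "card S \<le> card T"
    and c: "c \<in> S" "c \<notin> T"
  shows "\<exists>d\<in>T. c < d"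
proof (rule ccontr)
  assume "\<not> ?thesis"
  then have "below T c = card T" using c by (intro below_eq_card) (metis linorder_neqE_nat)
  moreover have "below T c \<le> below S c" using dom by (simp add: dominates_def)
  moreover have "below S c < card S"
    using below_less[of S c "Suc c"] below_le_card[of S "Suc c"] c fin by simp
  ultimately show False using eq by simp
qed

text \<open>Reverse bumping never gets stuck either: an entry of the lower row has a smaller one above it.\<close>

lemma dominates_ex_below:
  assumes fin: "finite S" "finite T" and dom: "dominates S T" and d: "d \<in> T" "d \<notin> S"
  shows "\<exists>c\<in>S. c < d"
proof -
  have "below T d < below T (Suc d)" using d fin by (simp add: below_Suc)
  also have "\<dots> \<le> below S (Suc d)" using dom by (simp add: dominates_def)
  finally have "below S (Suc d) \<noteq> 0" by simp
  then have "{z \<in> S. z < Suc d} \<noteq> {}" unfolding below_def by (metis card.empty)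
  then show ?thesis using d by (auto simp: less_Suc_eq)
qed

lemma below_exchange:
  assumes "finite S" "c \<in> S" "b \<notin> S" "b < c"
  shows "below (insert b (S - {c})) v = below S v + (if b < v \<and> v \<le> c then 1 else 0)"
  using below_remove[OF assms(1,2), of v] below_insert[of "S - {c}" b v] assms by auto

text \<open>Only the bounds between \<open>c\<close> and \<open>d\<close> are critical, where the lower row gains an entry.  There the lower
row counts what it counted at \<open>c\<close>, while the upper row already counts \<open>c\<close> in addition.\<close>

lemma bump_upper_dominates:
  assumes fin: "finite S1" "finite S2" and dom: "dominates S1 S2"
    and c: "c \<in> S1" "b \<notin> S1" "gap S1 b c" and d: "d \<in> S2" "c \<notin> S2" "gap S2 c d"
  shows "dominates (insert b (S1 - {c})) (insert c (S2 - {d}))"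
proof -
  have bc: "b < c" and cd: "c < d" using c d by (auto simp: gap_def)
  have 1: "below S2 v \<le> below S1 v" for v using dom by (simp add: dominates_def)
  note B = below_exchange[OF fin(1) c(1,2) bc] below_exchange[OF fin(2) d(1,2) cd]
  show ?thesis
    unfolding dominates_def B
  proof
    fix v
    have "below S2 v + 1 \<le> below S1 v" if "c < v" "v \<le> d"
    proof -
      have "below S2 v = below S2 (Suc c)"
        using below_gap[OF d(3), of v] below_gap[OF d(3), of "Suc c"] that by simp
      also have "\<dots> = below S2 c" using fin d by (simp add: below_Suc)
      also have "\<dots> \<le> below S1 c" by (rule 1)
      also have "\<dots> < below S1 v" using below_less[OF fin(1) c(1)] that by simp
      finally show ?thesis by simp
    qed
    then show "below S2 v + (if c < v \<and> v \<le> d then 1 else 0) \<le> below S1 v + (if b < v \<and> v \<le> c then 1 else 0)"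
      using 1[of v] by auto
  qed
qed

text \<open>Beyond \<open>d\<close> the third row counts all of its entries.  It had as many below \<open>d\<close>, where the second row
did not yet count \<open>d\<close>.\<close>

lemma bump_lower_dominates:
  assumes fin: "finite S2" "finite S3" and dom: "dominates S2 S3"
    and d: "d \<in> S2" "c \<notin> S2" "gap S2 c d"
    and S3: "d \<notin> S3" "\<And>z. z \<in> S3 \<Longrightarrow> z < d"
  shows "dominates (insert c (S2 - {d})) (insert d S3)"
proof -
  have cd: "c < d" using d by (auto simp: gap_def)
  have 2: "below S3 v \<le> below S2 v" for v using dom by (simp add: dominates_def)
  note B = below_exchange[OF fin(1) d(1,2) cd] below_insert[OF fin(2) S3(1)]
  show ?thesis
    unfolding dominates_def B
  proof
    fix v
    have "below S3 v + 1 \<le> below S2 v" if "d < v"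
    proof -
      have "below S3 v = card S3" using S3 that by (intro below_eq_card) force
      also have "\<dots> = below S3 d" using S3 by (simp add: below_eq_card)
      also have "\<dots> \<le> below S2 d" by (rule 2)
      also have "\<dots> < below S2 v" using below_less[OF fin(1) d(1) that] .
      finally show ?thesis by simp
    qed
    then show "below S3 v + (if d < v then 1 else 0) \<le> below S2 v + (if c < v \<and> v \<le> d then 1 else 0)"
      using 2[of v] by auto
  qed
qed

text \<open>The critical bounds are those between \<open>b\<close> and \<open>c\<close>, where the upper row loses an entry.  Since the upper
row is constant there and the lower row gains \<open>c\<close> just beyond, there was one entry to spare.\<close>

lemma unbump_upper_dominates:
  assumes fin: "finite S1" "finite S2" and dom: "dominates S1 S2"
    and b: "b \<in> S1" "c \<notin> S1" "gap S1 b c" and c: "c \<in> S2" "d \<notin> S2" "gap S2 c d"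
  shows "dominates (insert c (S1 - {b})) (insert d (S2 - {c}))"
proof -
  have bc: "b < c" and cd: "c < d" using b c by (auto simp: gap_def)
  have 1: "below S2 v \<le> below S1 v" for v using dom by (simp add: dominates_def)
  have B1: "below (insert c (S1 - {b})) v + (if b < v \<and> v \<le> c then 1 else 0) = below S1 v" for v
    using below_remove[OF fin(1) b(1), of v] below_insert[of "S1 - {b}" c v] b fin bc by auto
  have B2: "below (insert d (S2 - {c})) v + (if c < v \<and> v \<le> d then 1 else 0) = below S2 v" for v
    using below_remove[OF fin(2) c(1), of v] below_insert[of "S2 - {c}" d v] c fin cd by auto
  show ?thesis
    unfolding dominates_def
  proof
    fix v
    have "below S2 v + 1 \<le> below S1 v" if "b < v" "v \<le> c"
    proof -
      have "below S2 v \<le> below S2 c" using that fin by (simp add: below_mono)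
      also have "\<dots> < below S2 (Suc c)" using fin c by (simp add: below_Suc)
      also have "\<dots> \<le> below S1 (Suc c)" by (rule 1)
      also have "\<dots> = below S1 c" using fin b by (simp add: below_Suc)
      also have "\<dots> = below S1 v" by (rule below_gap[OF b(3) that, symmetric])
      finally show ?thesis by simp
    qed
    then show "below (insert d (S2 - {c})) v \<le> below (insert c (S1 - {b})) v"
      using 1[of v] B1[of v] B2[of v] bc by (auto split: if_splits)
  qed
qed

lemma unbump_lower_dominates:
  assumes fin: "finite S2" "finite S3" and dom: "dominates S2 S3"
    and c: "c \<in> S2" "d \<notin> S2" "gap S2 c d" and S3: "greatest S3 d"
  shows "dominates (insert d (S2 - {c})) (S3 - {d})"
proof -
  have cd: "c < d" using c by (auto simp: gap_def)
  have d3: "d \<in> S3" using S3 by (simp add: greatest_def)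
  have 2: "below S3 v \<le> below S2 v" for v using dom by (simp add: dominates_def)
  have B2: "below (insert d (S2 - {c})) v + (if c < v \<and> v \<le> d then 1 else 0) = below S2 v" for v
    using below_remove[OF fin(1) c(1), of v] below_insert[of "S2 - {c}" d v] c fin cd by auto
  have B3: "below (S3 - {d}) v + (if d < v then 1 else 0) = below S3 v" for v
    using below_remove[OF fin(2) d3, of v] by simp
  show ?thesis
    unfolding dominates_def
  proof
    fix v
    have "below S3 v + 1 \<le> below S2 v" if "c < v" "v \<le> d"
    proof -
      have "below S3 v \<le> below S3 d" using that fin by (simp add: below_mono)
      also have "\<dots> < below S3 (Suc d)" using fin d3 by (simp add: below_Suc)
      also have "\<dots> \<le> below S2 (Suc d)" by (rule 2)
      also have "\<dots> = below S2 d" using fin c by (simp add: below_Suc)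
      also have "\<dots> = below S2 v" by (rule below_gap[OF c(3) that, symmetric])
      finally show ?thesis by simp
    qed
    then show "below (S3 - {d}) v \<le> below (insert d (S2 - {c})) v"
      using 2[of v] B2[of v] B3[of v] cd by (auto split: if_splits)
  qed
qed

text \<open>The row bumping lemma: a later, larger entry takes a route strictly to the right.  If \<open>b\<close> exceeds the
entry \<open>b0\<close> inserted before, then the bumped entries satisfy \<open>c0 < c\<close> and \<open>d0 < d\<close>, because no entry of
row 1 lies between \<open>b0\<close> and \<open>c0\<close> and none of row 2 lies between \<open>c0\<close> and \<open>d0\<close>.\<close>

lemma bump_end_above:
  assumes st: "(S1, S2, S3, Q) \<in> states n" and bump: "bump b c d (S1, S2, S3, Q) t"
    and S3: "z \<in> S3"
  shows "\<exists>b0 c0 d0. last_bumps (S1, S2, S3) b0 c0 d0 \<and> c0 < c \<and> z \<le> d0 \<and> d0 < d"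
proof -
  note fin = states_finite[OF st]
  have dom: "dominates S1 S2" "dominates S2 S3" and disj: "S1 \<inter> S2 = {}" "S2 \<inter> S3 = {}"
    using st by (auto simp: states_def)
  note inv = states_last_bumps[OF st]
  have bmp: "b \<in> Q" "c \<in> S1" "gap S1 b c" "d \<in> S2" "gap S2 c d"
    using bump by (cases t; auto simp: bump_def)+
  obtain d0 where d0: "greatest S3 d0" using ex_greatest fin S3 by blast
  have "d0 \<in> S3" using d0 by (simp add: greatest_def)
  then obtain u where "u \<in> S2" "u < d0"
    using dominates_ex_below[OF fin(2,3) dom(2)] disj by blast
  then obtain c0 where c0: "c0 \<in> S2" "gap S2 c0 d0" using ex_gap_down fin by blast
  obtain u where "u \<in> S1" "u < c0"
    using dominates_ex_below[OF fin(1,2) dom(1) c0(1)] c0 disj by blast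
  then obtain b0 where b0: "b0 \<in> S1" "gap S1 b0 c0" using ex_gap_down fin by blast
  have lb: "last_bumps (S1, S2, S3) b0 c0 d0"
    using d0 c0 b0 by (simp add: last_bumps_def)
  then have "b0 < b" using inv bmp by blast
  then have "\<not> c < c0" using b0 bmp by (auto simp: gap_def)
  moreover have "c \<noteq> c0" using bmp c0 disj by auto
  ultimately have cc: "c0 < c" by simp
  moreover have "c < d" using bmp by (simp add: gap_def)
  moreover have "d \<noteq> d0" using bmp \<open>d0 \<in> S3\<close> disj by auto
  ultimately have "d0 < d" using bmp c0 by (auto simp: gap_def)
  then show ?thesis using lb cc d0 S3 by (auto simp: greatest_def)
qed

text \<open>The values \<open>b\<close>, \<open>c\<close>, \<open>d\<close> of a step can be read off from the state reached, and this makes the step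
reversible.\<close>

lemma bump_in_states:
  assumes st: "(S1, S2, S3, Q) \<in> states n" and bump: "bump b c d (S1, S2, S3, Q) (S1', S2', S3', Q')"
  shows "(S1', S2', S3', Q') \<in> states n" "last_bumps (S1', S2', S3') b c d"
proof -
  note fin = states_finite[OF st]
  have dom: "dominates S1 S2" "dominates S2 S3" and card: "card S1 = card S2"
    and part: "S1 \<union> S2 \<union> S3 \<union> Q = {1..n}" "S1 \<inter> S2 = {}" "S1 \<inter> S3 = {}" "S2 \<inter> S3 = {}"
      "(S1 \<union> S2 \<union> S3) \<inter> Q = {}"
    using st by (auto simp: states_def)
  have bmp: "b \<in> Q" "\<And>q. q \<in> Q \<Longrightarrow> b \<le> q" "c \<in> S1" "gap S1 b c" "d \<in> S2" "gap S2 c d"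
    and eqs: "S1' = insert b (S1 - {c})" "S2' = insert c (S2 - {d})" "S3' = insert d S3" "Q' = Q - {b}"
    using bump by (auto simp: bump_def)
  have nin: "b \<notin> S1" "c \<notin> S2" "d \<notin> S3" using bmp part by auto
  have less: "z < d" if "z \<in> S3" for z
    using bump_end_above[OF st bump that] by auto
  have dom': "dominates S1' S2'" "dominates S2' S3'"
    using bump_upper_dominates[OF fin(1,2) dom(1) bmp(3) nin(1) bmp(4,5) nin(2) bmp(6)]
      bump_lower_dominates[OF fin(2,3) dom(2) bmp(5) nin(2) bmp(6) nin(3) less]
    by (simp_all add: eqs)
  have bcd: "b < c" "c < d" using bmp by (auto simp: gap_def)
  have lb: "last_bumps (S1', S2', S3') b c d"
  proof -
    have "greatest S3' d" using less by (auto simp: greatest_def eqs intro: less_imp_le)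
    moreover have "gap S2' c d" using bmp(6) by (auto simp: gap_def eqs)
    moreover have "gap S1' b c" using bmp(4) by (auto simp: gap_def eqs)
    ultimately show ?thesis by (simp add: last_bumps_def eqs)
  qed
  then show "last_bumps (S1', S2', S3') b c d" .
  have card': "card S1' = card S1" "card S2' = card S2"
    unfolding eqs using card_exchange[OF fin(1) bmp(3) nin(1)] card_exchange[OF fin(2) bmp(5) nin(2)] by simp_all
  have bQ: "\<forall>q\<in>Q'. b < q" using bmp(2) eqs by (auto simp: le_less)
  have inv: "\<forall>q\<in>Q'. b' < q" if "last_bumps (S1', S2', S3') b' c' d'" for b' c' d'
  proof -
    have "b' = b" using last_bumps_unique[OF that lb] by simp
    then show ?thesis using bQ by simp
  qed
  have part': "S1' \<union> S2' \<union> S3' \<union> Q' = {1..n}"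
    using part(1) bmp by (auto simp: eqs)
  have disj': "S1' \<inter> S2' = {}" "S1' \<inter> S3' = {}" "S2' \<inter> S3' = {}" "(S1' \<union> S2' \<union> S3') \<inter> Q' = {}"
    using part bmp nin bcd by (auto simp: eqs)
  show "(S1', S2', S3', Q') \<in> states n"
    by (rule statesI[OF part' disj' _ dom' inv]) (simp add: card card')
qed

lemma ex_bump:
  assumes st: "(S1, S2, S3, Q) \<in> states n" and q: "q \<in> Q" "z \<in> S1" "q < z"
  shows "\<exists>t. step_to (S1, S2, S3, Q) t"
proof -
  note fin = states_finite[OF st]
  have dom: "dominates S1 S2" and card: "card S1 = card S2" and disj: "S1 \<inter> S2 = {}"
    using st by (auto simp: states_def)
  define b where "b = Min Q"
  have b: "b \<in> Q" "\<And>x. x \<in> Q \<Longrightarrow> b \<le> x" unfolding b_def using q fin by (auto intro: Min_in)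
  then have "b < z" using q by force
  then obtain c where c: "c \<in> S1" "gap S1 b c" using ex_gap_up q by blast
  obtain x where "x \<in> S2" "c < x"
    using dominates_ex_above[OF fin(1,2) dom] card c disj by auto
  then obtain d where d: "d \<in> S2" "gap S2 c d" using ex_gap_up by blast
  show ?thesis unfolding step_to_def
    by (rule exI[of _ "(insert b (S1 - {c}), insert c (S2 - {d}), insert d S3, Q - {b})"])
      (use b c d in \<open>auto simp: bump_def\<close>)
qed

lemma bump_forward_unique:
  assumes "bump b c d s t" "bump b' c' d' s t'"
  shows "t = t'"
proof -
  obtain S1 S2 S3 Q where s: "s = (S1, S2, S3, Q)" by (rule prod_cases4)
  obtain T1 T2 T3 R where t: "t = (T1, T2, T3, R)" by (rule prod_cases4)
  obtain T1' T2' T3' R' where t': "t' = (T1', T2', T3', R')" by (rule prod_cases4)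
  note A = assms[unfolded s t t' bump_def prod.case]
  have b: "b = b'" using A by (meson antisym)
  then have c: "c = c'" using A gap_unique_up by blast
  then have "d = d'" using A gap_unique_up by blast
  with b c show ?thesis using A unfolding t t' by simp
qed

lemma step_to_forward_unique: "step_to s t \<Longrightarrow> step_to s t' \<Longrightarrow> t = t'"
  unfolding step_to_def using bump_forward_unique by blast

lemma step_to_backward_unique:
  assumes "s \<in> states n" "s' \<in> states n" "step_to s t" "step_to s' t"
  shows "s = s'"
proof -
  obtain S1 S2 S3 Q where s1: "s = (S1, S2, S3, Q)" by (rule prod_cases4)
  obtain T1 T2 T3 R where s2: "s' = (T1, T2, T3, R)" by (rule prod_cases4)
  obtain S1' S2' S3' Q' where s3: "t = (S1', S2', S3', Q')" by (rule prod_cases4)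
  note s = s1 s2 s3
  obtain b c d b' c' d' where bb: "bump b c d s t" "bump b' c' d' s' t"
    using assms by (auto simp: step_to_def)
  have lb: "last_bumps (S1', S2', S3') b c d" "last_bumps (S1', S2', S3') b' c' d'"
    using bump_in_states(2)[OF assms(1)[unfolded s1] bb(1)[unfolded s1 s3]]
      bump_in_states(2)[OF assms(2)[unfolded s2] bb(2)[unfolded s2 s3]] .
  have bb': "bump b c d s' t" using bb(2) last_bumps_unique[OF lb] by simp
  have disj: "b \<notin> S1 \<and> c \<notin> S2 \<and> d \<notin> S3" if "(S1, S2, S3, Q) \<in> states n" "bump b c d (S1, S2, S3, Q) t" for S1 S2 S3 Q
    using that by (cases t) (auto simp: states_def bump_def)
  have undo: "S1 = insert c (S1' - {b}) \<and> S2 = insert d (S2' - {c}) \<and> S3 = S3' - {d} \<and> Q = insert b Q'"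
    if "(S1, S2, S3, Q) \<in> states n" "bump b c d (S1, S2, S3, Q) t" for S1 S2 S3 Q
    using disj[OF that] that s(3) by (auto simp: bump_def)
  note u1 = undo[OF assms(1)[unfolded s1] bb(1)[unfolded s1]]
    and u2 = undo[OF assms(2)[unfolded s2] bb'[unfolded s2]]
  show ?thesis unfolding s1 s2 using u1 u2 by simp
qed

text \<open>Reverse bumping.  The entries pushed out in consecutive reverse steps decrease, so the order in
which entries were inserted is restored correctly.\<close>

lemma ex_unbump:
  assumes st: "(S1, S2, S3, Q) \<in> states n" and ne: "S3 \<noteq> {}"
  shows "\<exists>s\<in>states n. step_to s (S1, S2, S3, Q)"
proof -
  note fin = states_finite[OF st]
  have dom: "dominates S1 S2" "dominates S2 S3" and card: "card S1 = card S2"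
    and part: "S1 \<union> S2 \<union> S3 \<union> Q = {1..n}" "S1 \<inter> S2 = {}" "S1 \<inter> S3 = {}" "S2 \<inter> S3 = {}"
      "(S1 \<union> S2 \<union> S3) \<inter> Q = {}"
    using st by (auto simp: states_def)
  note inv = states_last_bumps[OF st]
  obtain d where d: "greatest S3 d" using ex_greatest fin ne by blast
  then have d3: "d \<in> S3" by (simp add: greatest_def)
  obtain u where "u \<in> S2" "u < d"
    using dominates_ex_below[OF fin(2,3) dom(2) d3] d3 part by blast
  then obtain c where c: "c \<in> S2" "gap S2 c d" using ex_gap_down fin by blast
  obtain u where "u \<in> S1" "u < c"
    using dominates_ex_below[OF fin(1,2) dom(1) c(1)] c part by blast
  then obtain b where b: "b \<in> S1" "gap S1 b c" using ex_gap_down fin by blast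
  have bQ: "\<forall>q\<in>Q. b < q" using inv[of b c d] d c b by (simp add: last_bumps_def)
  have nin: "c \<notin> S1" "d \<notin> S2" using c d3 part by auto
  have bcd: "b < c" "c < d" using b c by (auto simp: gap_def)
  let ?S1 = "insert c (S1 - {b})" and ?S2 = "insert d (S2 - {c})" and ?S3 = "S3 - {d}" and ?Q = "insert b Q"
  have dom': "dominates ?S1 ?S2" "dominates ?S2 ?S3"
    using unbump_upper_dominates[OF fin(1,2) dom(1) b(1) nin(1) b(2) c(1) nin(2) c(2)]
      unbump_lower_dominates[OF fin(2,3) dom(2) c(1) nin(2) c(2) d] by auto
  have card': "card ?S1 = card ?S2"
    using card_exchange[OF fin(1) b(1) nin(1)] card_exchange[OF fin(2) c(1) nin(2)] card by simp
  have inv': "\<forall>q\<in>?Q. b' < q" if lb: "last_bumps (?S1, ?S2, ?S3) b' c' d'" for b' c' d'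
  proof -
    have d': "d' \<in> S3" "d' < d" using lb d by (auto simp: last_bumps_def greatest_def le_less)
    have "c' \<noteq> d" "c' < d'" using lb d' by (auto simp: last_bumps_def gap_def)
    then have "c' \<in> S2" "c' \<noteq> c" using lb by (auto simp: last_bumps_def)
    then have "c' < c" using c \<open>c' < d'\<close> d' by (force simp: gap_def)
    moreover have "b' < c'" using lb by (simp add: last_bumps_def gap_def)
    ultimately have "b' \<in> S1" "b' \<noteq> b" "b' < c" using lb by (auto simp: last_bumps_def)
    then have "b' < b" using b by (force simp: gap_def)
    then show ?thesis using bQ by auto
  qed
  have part': "?S1 \<union> ?S2 \<union> ?S3 \<union> ?Q = {1..n}" using part(1) b c d3 by blast
  have disj': "?S1 \<inter> ?S2 = {}" "?S1 \<inter> ?S3 = {}" "?S2 \<inter> ?S3 = {}" "(?S1 \<union> ?S2 \<union> ?S3) \<inter> ?Q = {}"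
    using part bcd b c d3 by auto
  have "(?S1, ?S2, ?S3, ?Q) \<in> states n"
    by (rule statesI[OF part' disj' card' dom' inv'])
  moreover have "bump b c d (?S1, ?S2, ?S3, ?Q) (S1, S2, S3, Q)"
  proof -
    have "b \<notin> Q" using bQ by blast
    moreover have "gap ?S1 b c" "gap ?S2 c d" using b(2) c(2) by (auto simp: gap_def)
    moreover have "S1 = insert b (?S1 - {c})" "S2 = insert c (?S2 - {d})" "S3 = insert d ?S3"
      using b(1) c(1) d3 nin bcd by auto
    ultimately show ?thesis
      unfolding bump_def prod.case using bQ by (auto intro: less_imp_le)
  qed
  ultimately show ?thesis by (auto simp: step_to_def)
qed

section \<open>The two moves\<close>

lemma stdD:
  assumes "(S1, S2, S3) \<in> std n"
  shows "S1 \<union> S2 \<union> S3 = {1..n}" "S1 \<inter> S2 = {}" "S1 \<inter> S3 = {}" "S2 \<inter> S3 = {}"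
    "dominates S1 S2" "dominates S2 S3"
  using assms unfolding std_def mem_Collect_eq prod.case by blast+

lemma stdI:
  assumes "S1 \<union> S2 \<union> S3 = {1..n}" "S1 \<inter> S2 = {}" "S1 \<inter> S3 = {}" "S2 \<inter> S3 = {}"
    "dominates S1 S2" "dominates S2 S3"
  shows "(S1, S2, S3) \<in> std n"
  using assms unfolding std_def mem_Collect_eq prod.case by blast

fun raise3 :: "filling \<Rightarrow> filling" where
  "raise3 (S1, S2, S3) =
     (let y = Max S3; x = Max {z \<in> S2. z < y} in (insert x S1, insert y (S2 - {x}), S3 - {y}))"

fun raise2 :: "filling \<Rightarrow> filling" where
  "raise2 (S1, S2, S3) = (insert (Max S2) S1, S2 - {Max S2}, S3)"

text \<open>M1 with the criterion in the form it takes on the tableaux that occur: for \<open>n\<close> cells, a third row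
is of the wrong parity if and only if \<open>\<lambda>\<^sub>1 + \<lambda>\<^sub>2\<close> is odd.\<close>

fun fix_row3 :: "filling \<Rightarrow> filling" where
  "fix_row3 (S1, S2, S3) = (if odd (card S1 + card S2) then raise3 (S1, S2, S3) else (S1, S2, S3))"

text \<open>M2, to be applied when \<open>\<lambda>\<^sub>1 + \<lambda>\<^sub>2\<close> is even.  Then \<open>\<lambda>\<^sub>3\<close> has the parity of the number of cells, and the
second row is of the wrong parity if and only if \<open>\<lambda>\<^sub>2 + \<lambda>\<^sub>3\<close> is odd.\<close>

fun fix_row2 :: "filling \<Rightarrow> filling" where
  "fix_row2 (S1, S2, S3) = (if odd (card S2 + card S3) then raise2 (S1, S2, S3) else (S1, S2, S3))"

text \<open>The fillings that the insertion produces.  Here \<open>y\<close> is the last entry of row 3, and \<open>x\<close> is the entry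
that M1 raises into row 1.\<close>

definition bumped_fillings :: "nat \<Rightarrow> filling set" where
  "bumped_fillings n = {(S1, S2, S3). (S1, S2, S3) \<in> std n \<and>
     (card S1 = card S2 \<or> (\<exists>x y. greatest S3 y \<and> x \<in> S2 \<and> gap S2 x y \<and> (\<forall>z\<in>S1. z < x)))}"

definition semi_even_fillings :: "nat \<Rightarrow> filling set" where
  "semi_even_fillings n = {(S1, S2, S3). (S1, S2, S3) \<in> std n \<and>
     even (card S1 + card S2) \<and> (\<forall>z\<in>S1. \<exists>w\<in>S2. z < w)}"

definition even_fillings :: "nat \<Rightarrow> filling set" where
  "even_fillings n = {(S1, S2, S3). (S1, S2, S3) \<in> std n \<and>
     even (card S1 + card S2) \<and> even (card S2 + card S3)}"

lemma Max_greatest: "finite S \<Longrightarrow> greatest S m \<Longrightarrow> Max S = m"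
  by (auto simp: greatest_def intro: Max_eqI)

lemma Max_gap: "finite S \<Longrightarrow> x \<in> S \<Longrightarrow> gap S x y \<Longrightarrow> Max {z \<in> S. z < y} = x"
  by (rule Max_eqI) (auto simp: gap_def)

lemma raise3_eq:
  assumes "finite S2" "finite S3" "greatest S3 y" "x \<in> S2" "gap S2 x y"
  shows "raise3 (S1, S2, S3) = (insert x S1, insert y (S2 - {x}), S3 - {y})"
  using Max_greatest[OF assms(2,3)] Max_gap[OF assms(1,4,5)] by (simp add: Let_def)

lemma odd_bumped_filling:
  assumes "(S1, S2, S3) \<in> bumped_fillings n" "odd (card S1 + card S2)"
  obtains x y where "greatest S3 y" "x \<in> S2" "gap S2 x y" "\<forall>z\<in>S1. z < x"
    "fix_row3 (S1, S2, S3) = (insert x S1, insert y (S2 - {x}), S3 - {y})"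
proof -
  have std: "(S1, S2, S3) \<in> std n" using assms(1) by (simp add: bumped_fillings_def)
  have "card S1 \<noteq> card S2" using assms(2) by auto
  then obtain x y where xy: "greatest S3 y" "x \<in> S2" "gap S2 x y" "\<forall>z\<in>S1. z < x"
    using assms(1) unfolding bumped_fillings_def mem_Collect_eq prod.case by blast
  have "fix_row3 (S1, S2, S3) = (insert x S1, insert y (S2 - {x}), S3 - {y})"
    using raise3_eq[OF std_finite(2,3)[OF std] xy(1-3), of S1] assms(2) by (simp del: raise3.simps)
  with xy show thesis by (rule that)
qed

lemma dominates_trans: "dominates A B \<Longrightarrow> dominates B C \<Longrightarrow> dominates A C"
  unfolding dominates_def using le_trans by blast

lemma dominates_superset: "finite A \<Longrightarrow> B \<subseteq> A \<Longrightarrow> dominates A B"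
  unfolding dominates_def below_def by (auto intro!: card_mono)

text \<open>After M1 the entry \<open>y\<close> of row 2 exceeds everything in row 1.  Without M1 this role is played
by \<open>x\<close>, or, when both rows are equally long, by the last entry of row 2.\<close>

lemma fix_row3_in:
  assumes X: "(S1, S2, S3) \<in> bumped_fillings n"
  shows "fix_row3 (S1, S2, S3) \<in> semi_even_fillings n"
proof -
  have std: "(S1, S2, S3) \<in> std n" using X by (simp add: bumped_fillings_def)
  note fin = std_finite[OF std] and D = stdD[OF std]
  show ?thesis
  proof (cases "odd (card S1 + card S2)")
    case True
    obtain x y where xy: "greatest S3 y" "x \<in> S2" "gap S2 x y" "\<forall>z\<in>S1. z < x"
      and eq: "fix_row3 (S1, S2, S3) = (insert x S1, insert y (S2 - {x}), S3 - {y})"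
      by (rule odd_bumped_filling[OF X True])
    have y3: "y \<in> S3" using xy by (simp add: greatest_def)
    have x_y: "x < y" using xy by (simp add: gap_def)
    have nin: "x \<notin> S1" "y \<notin> S2" "y \<notin> S1" using xy(2) y3 D by auto
    have "dominates (insert x S1) S1" by (rule dominates_superset) (use fin in auto)
    moreover have "dominates S2 (insert y (S2 - {x}))"
      unfolding dominates_def
    proof
      fix v
      show "below (insert y (S2 - {x})) v \<le> below S2 v"
        using below_remove[OF fin(2) xy(2), of v] below_insert[of "S2 - {x}" y v] fin nin x_y by simp
    qed
    ultimately have dom1: "dominates (insert x S1) (insert y (S2 - {x}))"
      using D(5) dominates_trans by blast
    have dom2: "dominates (insert y (S2 - {x})) (S3 - {y})"
      by (rule unbump_lower_dominates[OF fin(2,3) D(6) xy(2) nin(2) xy(3,1)])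
    have part: "insert x S1 \<union> insert y (S2 - {x}) \<union> (S3 - {y}) = {1..n}"
      using D(1) xy(2) y3 by blast
    have "(insert x S1, insert y (S2 - {x}), S3 - {y}) \<in> std n"
      by (rule stdI[OF part _ _ _ dom1 dom2]) (use D xy(2) y3 nin x_y in auto)
    moreover have "card (insert x S1) = Suc (card S1)" "card (insert y (S2 - {x})) = card S2"
      using nin fin card_exchange[OF fin(2) xy(2) nin(2)] by auto
    moreover have "\<forall>z\<in>insert x S1. \<exists>w\<in>insert y (S2 - {x}). z < w"
      using xy x_y by force
    ultimately show ?thesis using True unfolding eq semi_even_fillings_def by simp
  next
    case False
    have "\<forall>z\<in>S1. \<exists>w\<in>S2. z < w"
    proof (cases "card S1 = card S2")
      case True
      then show ?thesis using dominates_ex_above[OF fin(1,2) D(5)] D(2) by auto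
    next
      case False
      then show ?thesis using X unfolding bumped_fillings_def mem_Collect_eq prod.case by blast
    qed
    then show ?thesis using False std by (simp add: semi_even_fillings_def)
  qed
qed

text \<open>A result of M1 cannot be a bumped filling again.  Row 1 is now longer than row 2, and \<open>x\<close> is its last entry, so the entry
\<open>x'\<close> that could be raised next would lie between \<open>x\<close> and \<open>y\<close>, where row 2 has nothing.\<close>

lemma fix_row3_no_mix:
  assumes X: "(S1, S2, S3) \<in> bumped_fillings n" and ev: "even (card S1 + card S2)"
    and X': "(R1, R2, R3) \<in> bumped_fillings n" and od: "odd (card R1 + card R2)"
  shows "fix_row3 (R1, R2, R3) \<noteq> (S1, S2, S3)"
proof
  assume eq': "fix_row3 (R1, R2, R3) = (S1, S2, S3)"
  have std: "(R1, R2, R3) \<in> std n" using X' by (simp add: bumped_fillings_def)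
  note fin = std_finite[OF std] and D = stdD[OF std]
  obtain x y where xy: "greatest R3 y" "x \<in> R2" "gap R2 x y" "\<forall>z\<in>R1. z < x"
    and eq: "fix_row3 (R1, R2, R3) = (insert x R1, insert y (R2 - {x}), R3 - {y})"
    by (rule odd_bumped_filling[OF X' od])
  have y3: "y \<in> R3" using xy by (simp add: greatest_def)
  have nin: "x \<notin> R1" "y \<notin> R2" using xy(2) y3 D by auto
  have S: "S1 = insert x R1" "S2 = insert y (R2 - {x})" "S3 = R3 - {y}" using eq eq' by auto
  have "card S1 = Suc (card R1)" "card S2 = card R2"
    using nin fin card_exchange[OF fin(2) xy(2) nin(2)] unfolding S by auto
  then have "card S1 \<noteq> card S2" using std_card(1)[OF std] by simp
  then obtain x' y' where xy': "greatest S3 y'" "x' \<in> S2" "gap S2 x' y'" "\<forall>z\<in>S1. z < x'"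
    using X unfolding bumped_fillings_def mem_Collect_eq prod.case by blast
  have "y' < y" using xy' xy unfolding S greatest_def by (auto simp: le_less)
  moreover have "x' < y'" using xy' by (simp add: gap_def)
  ultimately have "x' \<in> R2" "x' < y" using xy' S by auto
  moreover have "x < x'" using xy' S by simp
  ultimately show False using xy(3) unfolding gap_def by force
qed

text \<open>The entries moved by M1 are visible afterwards: \<open>x\<close> is the last entry of row 1, and \<open>y\<close> is the least
entry of row 2 above it.\<close>

lemma inj_on_fix_row3: "inj_on fix_row3 (bumped_fillings n)"
proof (rule inj_onI)
  fix s t assume s: "s \<in> bumped_fillings n" and t: "t \<in> bumped_fillings n" and eq: "fix_row3 s = fix_row3 t"
  obtain S1 S2 S3 where S: "s = (S1, S2, S3)" by (rule prod_cases3)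
  obtain R1 R2 R3 where R: "t = (R1, R2, R3)" by (rule prod_cases3)
  note s = s[unfolded S] and t = t[unfolded R] and eq = eq[unfolded S R]
  consider "even (card S1 + card S2)" "even (card R1 + card R2)"
    | "even (card S1 + card S2)" "odd (card R1 + card R2)"
    | "odd (card S1 + card S2)" "even (card R1 + card R2)"
    | "odd (card S1 + card S2)" "odd (card R1 + card R2)" by blast
  then show "s = t"
  proof cases
    case 1
    then show ?thesis using eq S R by (simp del: raise3.simps)
  next
    case 2
    then have "fix_row3 (S1, S2, S3) = (S1, S2, S3)" by (simp del: raise3.simps)
    then show ?thesis using fix_row3_no_mix[OF s 2(1) t 2(2)] eq by metis
  next
    case 3
    then have "fix_row3 (R1, R2, R3) = (R1, R2, R3)" by (simp del: raise3.simps)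
    then show ?thesis using fix_row3_no_mix[OF t 3(2) s 3(1)] eq by metis
  next
    case 4
    have std: "(S1, S2, S3) \<in> std n" "(R1, R2, R3) \<in> std n"
      using s t by (auto simp: bumped_fillings_def)
    obtain x y where xy: "greatest S3 y" "x \<in> S2" "gap S2 x y" "\<forall>z\<in>S1. z < x"
      and e1: "fix_row3 (S1, S2, S3) = (insert x S1, insert y (S2 - {x}), S3 - {y})"
      by (rule odd_bumped_filling[OF s 4(1)])
    obtain x' y' where xy': "greatest R3 y'" "x' \<in> R2" "gap R2 x' y'" "\<forall>z\<in>R1. z < x'"
      and e2: "fix_row3 (R1, R2, R3) = (insert x' R1, insert y' (R2 - {x'}), R3 - {y'})"
      by (rule odd_bumped_filling[OF t 4(2)])
    have E: "insert x S1 = insert x' R1" "insert y (S2 - {x}) = insert y' (R2 - {x'})" "S3 - {y} = R3 - {y'}"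
      using eq unfolding e1 e2 by auto
    have "greatest (insert x S1) x" "greatest (insert x' R1) x'"
      using xy(4) xy'(4) by (auto simp: greatest_def less_imp_le)
    then have x: "x = x'" using greatest_unique E(1) by metis
    have "gap (insert y (S2 - {x})) x y" "gap (insert y' (R2 - {x'})) x' y'"
      using xy(3) xy'(3) by (auto simp: gap_def)
    then have g: "gap (insert y (S2 - {x})) x y" "gap (insert y (S2 - {x})) x y'" using E(2) x by simp_all
    have "y' \<in> insert y (S2 - {x})" unfolding E(2) by simp
    then have y: "y = y'" using gap_unique_up[OF g] by simp
    have "y \<in> S3" "y' \<in> R3" using xy xy' by (auto simp: greatest_def)
    then have nin: "x \<notin> S1" "y \<notin> S2" "x' \<notin> R1" "y' \<notin> R2"
      using xy(2) xy'(2) stdD[OF std(1)] stdD[OF std(2)] by auto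
    have "S1 = R1" using E(1) nin x by (simp add: insert_ident)
    moreover have "S2 - {x} = R2 - {x}" using E(2) nin x y by (simp add: insert_ident)
    then have "S2 = R2" using xy(2) xy'(2) x by (metis insert_Diff)
    moreover have "S3 = R3" using E(3) y \<open>y \<in> S3\<close> \<open>y' \<in> R3\<close> by (metis insert_Diff)
    ultimately show ?thesis using S R by simp
  qed
qed

text \<open>If both rows are equally long, nothing was moved.  Otherwise let \<open>p\<close> be the last entry of row 1 and
\<open>y\<close> the least entry of row 2 above it.  If row 3 reaches beyond \<open>y\<close>, then the entry to be raised is at
least \<open>y\<close> and the filling is itself a bumped one.  If row 3 stays below \<open>y\<close>, then M1 can be undone by
returning \<open>p\<close> to row 2 and \<open>y\<close> to row 3.\<close>

lemma fix_row3_surj: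
  assumes T: "(T1, T2, T3) \<in> semi_even_fillings n"
  shows "(T1, T2, T3) \<in> fix_row3 ` bumped_fillings n"
proof -
  have std: "(T1, T2, T3) \<in> std n" and ev: "even (card T1 + card T2)" and above: "\<forall>z\<in>T1. \<exists>w\<in>T2. z < w"
    using T by (auto simp: semi_even_fillings_def)
  note fin = std_finite[OF std] and D = stdD[OF std]
  have fixed: ?thesis if "(T1, T2, T3) \<in> bumped_fillings n"
    by (rule image_eqI[OF _ that]) (use ev in \<open>simp del: raise3.simps\<close>)
  show ?thesis
  proof (cases "card T1 = card T2")
    case True
    then show ?thesis using fixed std by (simp add: bumped_fillings_def)
  next
    case False
    then have c: "card T2 < card T1" using std_card(1)[OF std] by simp
    then have "T1 \<noteq> {}" by auto
    then obtain p where p: "greatest T1 p" using ex_greatest fin by blast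
    then have pT: "p \<in> T1" by (simp add: greatest_def)
    obtain w where "w \<in> T2" "p < w" using above pT by blast
    then obtain y where y: "y \<in> T2" "gap T2 p y" using ex_gap_up by blast
    have py: "p < y" using y by (simp add: gap_def)
    show ?thesis
    proof (cases "\<exists>z\<in>T3. y < z")
      case True
      then obtain z where z: "z \<in> T3" "y < z" by blast
      then obtain g where g: "greatest T3 g" using ex_greatest fin by blast
      then have yg: "y < g" using z by (force simp: greatest_def)
      then obtain x where x: "x \<in> T2" "gap T2 x g" using ex_gap_down[OF y(1)] fin by blast
      have "y \<le> x" using x(2) y(1) yg unfolding gap_def by force
      then have "\<forall>z\<in>T1. z < x" using p py unfolding greatest_def by force
      then show ?thesis using fixed std g x unfolding bumped_fillings_def by blast
    next
      case False
      have T3y: "z < y" if "z \<in> T3" for z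
        using False that y(1) D(4) by (metis disjoint_iff linorder_neqE_nat)
      have nin: "p \<notin> T2" "y \<notin> T3" "p \<notin> T3" "y \<notin> T1" using pT y D by auto
      let ?S1 = "T1 - {p}" and ?S2 = "insert p (T2 - {y})" and ?S3 = "insert y T3"
      have dom2: "dominates ?S2 ?S3"
        by (rule bump_lower_dominates[OF fin(2,3) D(6) y(1) nin(1) y(2) nin(2) T3y])
      have B1: "below T1 v = below ?S1 v + (if p < v then 1 else 0)" for v
        by (rule below_remove[OF fin(1) pT])
      have B2: "below ?S2 v = below T2 v + (if p < v \<and> v \<le> y then 1 else 0)" for v
        by (rule below_exchange[OF fin(2) y(1) nin(1) py])
      have dom1: "dominates ?S1 ?S2"
        unfolding dominates_def
      proof
        fix v
        have le: "below T2 v \<le> below T1 v" using D(5) by (simp add: dominates_def)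
        show "below ?S2 v \<le> below ?S1 v"
        proof (cases "p < v")
          case True
          then have full: "below T1 v = card T1"
            using p by (intro below_eq_card) (auto simp: greatest_def)
          have "below T2 v < card T2" if "v \<le> y"
          proof -
            have "below T2 v \<le> below T2 y" using that fin by (simp add: below_mono)
            also have "\<dots> < below T2 (Suc y)" using fin y by (simp add: below_Suc)
            also have "\<dots> \<le> card T2" using fin by (simp add: below_le_card)
            finally show ?thesis .
          qed
          moreover have "below T2 v \<le> card T2" using fin by (simp add: below_le_card)
          ultimately show ?thesis using B1[of v] B2[of v] full c True by (auto split: if_splits)
        next
          case False
          then show ?thesis using B1[of v] B2[of v] le by simp
        qed
      qed
      have part: "?S1 \<union> ?S2 \<union> ?S3 = {1..n}" using D(1) pT y(1) by blast
      have std': "(?S1, ?S2, ?S3) \<in> std n"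
        by (rule stdI[OF part _ _ _ dom1 dom2]) (use D y pT nin py in auto)
      have xy: "greatest ?S3 y" "p \<in> ?S2" "gap ?S2 p y" "\<forall>z\<in>?S1. z < p"
        using T3y y(2) p by (auto simp: greatest_def gap_def less_imp_le le_less)
      then have X: "(?S1, ?S2, ?S3) \<in> bumped_fillings n"
        using std' unfolding bumped_fillings_def by blast
      have cs: "card ?S2 = card T2" by (rule card_exchange[OF fin(2) y(1) nin(1)])
      have "Suc (card ?S1) = card T1" using card_Suc_Diff1[OF fin(1) pT] .
      then have "odd (card ?S1 + card ?S2)" using ev cs by presburger
      moreover have "raise3 (?S1, ?S2, ?S3) = (insert p ?S1, insert y (?S2 - {p}), ?S3 - {y})"
        by (rule raise3_eq[OF _ _ xy(1-3)]) (use fin in auto)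
      ultimately have "fix_row3 (?S1, ?S2, ?S3) = (insert p ?S1, insert y (?S2 - {p}), ?S3 - {y})"
        by (simp only: fix_row3.simps simp_thms if_True)
      also have "\<dots> = (T1, T2, T3)" using pT y(1) nin by auto
      finally show ?thesis using X by (metis image_eqI)
    qed
  qed
qed

lemma bij_betw_fix_row3: "bij_betw fix_row3 (bumped_fillings n) (semi_even_fillings n)"
proof (rule bij_betw_onto[OF inj_on_fix_row3])
  fix s assume "s \<in> (bumped_fillings n)"
  then show "fix_row3 s \<in> (semi_even_fillings n)" using fix_row3_in by (metis prod_cases3)
next
  fix t assume "t \<in> (semi_even_fillings n)"
  then show "t \<in> fix_row3 ` (bumped_fillings n)" using fix_row3_surj by (metis prod_cases3)
qed

lemma odd_semi_even_filling:
  assumes "(S1, S2, S3) \<in> semi_even_fillings n" "odd (card S2 + card S3)"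
  obtains m where "greatest S2 m" "\<forall>z\<in>S1. z < m" "fix_row2 (S1, S2, S3) = (insert m S1, S2 - {m}, S3)"
proof -
  have std: "(S1, S2, S3) \<in> std n" and ab: "\<forall>z\<in>S1. \<exists>w\<in>S2. z < w"
    using assms(1) by (auto simp: semi_even_fillings_def)
  have "S2 \<noteq> {}" using assms(2) std_card(2)[OF std] by auto
  then obtain m where m: "greatest S2 m" using ex_greatest std_finite[OF std] by blast
  have "\<forall>z\<in>S1. z < m" using ab m unfolding greatest_def by force
  moreover have "fix_row2 (S1, S2, S3) = (insert m S1, S2 - {m}, S3)"
    using assms(2) Max_greatest[OF std_finite(2)[OF std] m] by simp
  ultimately show thesis using m that by blast
qed

text \<open>When M2 applies, the length of the second row differs from that of the third one by an odd number, so the second row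
can spare its last entry.\<close>

lemma fix_row2_in:
  assumes Y: "(S1, S2, S3) \<in> semi_even_fillings n"
  shows "fix_row2 (S1, S2, S3) \<in> even_fillings n"
proof -
  have std: "(S1, S2, S3) \<in> std n" and ev: "even (card S1 + card S2)"
    using Y by (auto simp: semi_even_fillings_def)
  note fin = std_finite[OF std] and D = stdD[OF std] and C = std_card[OF std]
  show ?thesis
  proof (cases "odd (card S2 + card S3)")
    case True
    obtain m where m: "greatest S2 m" "\<forall>z\<in>S1. z < m" and eq: "fix_row2 (S1, S2, S3) = (insert m S1, S2 - {m}, S3)"
      by (rule odd_semi_even_filling[OF Y True])
    have m2: "m \<in> S2" using m by (simp add: greatest_def)
    then have nin: "m \<notin> S1" "m \<notin> S3" using D by auto
    have "dominates (insert m S1) S1" "dominates S2 (S2 - {m})"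
      using fin by (auto intro: dominates_superset)
    then have dom1: "dominates (insert m S1) (S2 - {m})" using D(5) dominates_trans by blast
    have dom2: "dominates (S2 - {m}) S3"
      unfolding dominates_def
    proof
      fix v
      have le: "below S3 v \<le> below S2 v" using D(6) by (simp add: dominates_def)
      show "below S3 v \<le> below (S2 - {m}) v"
      proof (cases "m < v")
        case True
        then have "below S2 v = card S2"
          using m by (intro below_eq_card) (auto simp: greatest_def)
        moreover have "below S3 v \<le> card S3" using fin by (simp add: below_le_card)
        moreover have "card S3 < card S2" using C(2) \<open>odd (card S2 + card S3)\<close> by (auto simp: le_less)
        ultimately show ?thesis using below_remove[OF fin(2) m2, of v] True by simp
      next
        case False
        then show ?thesis using below_remove[OF fin(2) m2, of v] le by simp
      qed
    qed
    have part: "insert m S1 \<union> (S2 - {m}) \<union> S3 = {1..n}" using D(1) m2 by blast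
    have "(insert m S1, S2 - {m}, S3) \<in> std n"
      by (rule stdI[OF part _ _ _ dom1 dom2]) (use D m2 nin in auto)
    moreover have "card (insert m S1) = Suc (card S1)" "Suc (card (S2 - {m})) = card S2"
      using nin fin card_Suc_Diff1[OF fin(2) m2] by auto
    then have "even (card (insert m S1) + card (S2 - {m}))" "even (card (S2 - {m}) + card S3)"
      using True ev by presburger+
    ultimately show ?thesis unfolding eq even_fillings_def by simp
  next
    case False
    then show ?thesis using std ev by (simp add: even_fillings_def)
  qed
qed

lemma fix_row2_no_mix:
  assumes Y: "(S1, S2, S3) \<in> semi_even_fillings n"
    and Y': "(R1, R2, R3) \<in> semi_even_fillings n" and od: "odd (card R2 + card R3)"
  shows "fix_row2 (R1, R2, R3) \<noteq> (S1, S2, S3)"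
proof
  assume eq': "fix_row2 (R1, R2, R3) = (S1, S2, S3)"
  obtain m where m: "greatest R2 m" "\<forall>z\<in>R1. z < m" and eq: "fix_row2 (R1, R2, R3) = (insert m R1, R2 - {m}, R3)"
    by (rule odd_semi_even_filling[OF Y' od])
  have "m \<in> S1" "S2 = R2 - {m}" using eq eq' by auto
  then obtain w where "w \<in> S2" "m < w" using Y by (auto simp: semi_even_fillings_def)
  then show False using m \<open>S2 = R2 - {m}\<close> by (auto simp: greatest_def)
qed

text \<open>Before M2 row 2 has an entry above row 1, and afterwards the entry moved exceeds both rows.  So the
results with and without M2 differ, and the entry moved is the last one of row 1.\<close>

lemma inj_on_fix_row2: "inj_on fix_row2 (semi_even_fillings n)"
proof (rule inj_onI)
  fix s t assume s: "s \<in> semi_even_fillings n" and t: "t \<in> semi_even_fillings n" and eq: "fix_row2 s = fix_row2 t"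
  obtain S1 S2 S3 where S: "s = (S1, S2, S3)" by (rule prod_cases3)
  obtain R1 R2 R3 where R: "t = (R1, R2, R3)" by (rule prod_cases3)
  note s = s[unfolded S] and t = t[unfolded R] and eq = eq[unfolded S R]
  consider "even (card S2 + card S3)" "even (card R2 + card R3)"
    | "even (card S2 + card S3)" "odd (card R2 + card R3)"
    | "odd (card S2 + card S3)" "even (card R2 + card R3)"
    | "odd (card S2 + card S3)" "odd (card R2 + card R3)" by blast
  then show "s = t"
  proof cases
    case 1
    then show ?thesis using eq S R by simp
  next
    case 2
    then have "fix_row2 (S1, S2, S3) = (S1, S2, S3)" by simp
    then show ?thesis using fix_row2_no_mix[OF s t 2(2)] eq by metis
  next
    case 3
    then have "fix_row2 (R1, R2, R3) = (R1, R2, R3)" by simp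
    then show ?thesis using fix_row2_no_mix[OF t s 3(1)] eq by metis
  next
    case 4
    have std: "(S1, S2, S3) \<in> std n" "(R1, R2, R3) \<in> std n"
      using s t by (auto simp: semi_even_fillings_def)
    obtain m where m: "greatest S2 m" "\<forall>z\<in>S1. z < m" and e1: "fix_row2 (S1, S2, S3) = (insert m S1, S2 - {m}, S3)"
      by (rule odd_semi_even_filling[OF s 4(1)])
    obtain m' where m': "greatest R2 m'" "\<forall>z\<in>R1. z < m'" and e2: "fix_row2 (R1, R2, R3) = (insert m' R1, R2 - {m'}, R3)"
      by (rule odd_semi_even_filling[OF t 4(2)])
    have E: "insert m S1 = insert m' R1" "S2 - {m} = R2 - {m'}" "S3 = R3"
      using eq unfolding e1 e2 by auto
    have "greatest (insert m S1) m" "greatest (insert m' R1) m'"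
      using m(2) m'(2) by (auto simp: greatest_def less_imp_le)
    then have mm: "m = m'" using greatest_unique E(1) by metis
    have in2: "m \<in> S2" "m' \<in> R2" using m m' by (auto simp: greatest_def)
    have nin: "m \<notin> S1" "m' \<notin> R1" using m(2) m'(2) by auto
    have "S1 = R1" using E(1) nin mm by (simp add: insert_ident)
    moreover have "S2 = R2" using E(2) in2 mm by (metis insert_Diff)
    ultimately show ?thesis using S R E(3) by simp
  qed
qed

text \<open>If the last entry \<open>p\<close> of row 1 exceeds row 2, then the rows are not equally long, so by parity they
differ by at least 2, and \<open>p\<close> can be returned to row 2.\<close>

lemma fix_row2_surj:
  assumes T: "(T1, T2, T3) \<in> even_fillings n"
  shows "(T1, T2, T3) \<in> fix_row2 ` semi_even_fillings n"
proof -
  have std: "(T1, T2, T3) \<in> std n" and ev: "even (card T1 + card T2)" "even (card T2 + card T3)"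
    using T by (auto simp: even_fillings_def)
  note fin = std_finite[OF std] and D = stdD[OF std] and C = std_card[OF std]
  show ?thesis
  proof (cases "\<forall>z\<in>T1. \<exists>w\<in>T2. z < w")
    case True
    then have "(T1, T2, T3) \<in> semi_even_fillings n" using std ev by (simp add: semi_even_fillings_def)
    then show ?thesis using ev by (intro image_eqI[of _ _ "(T1, T2, T3)"]) simp_all
  next
    case False
    then obtain z where z: "z \<in> T1" "\<forall>w\<in>T2. \<not> z < w" by blast
    obtain p where p: "greatest T1 p" using ex_greatest fin z by blast
    then have pT: "p \<in> T1" and zp: "z \<le> p" using z by (auto simp: greatest_def)
    have nin: "p \<notin> T2" "p \<notin> T3" using pT D by auto
    have T2p: "w < p" if "w \<in> T2" for w
      using z(2) zp that nin by (metis le_neq_implies_less le_trans not_le)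
    have zT: "z \<notin> T2" using z(1) D(2) by auto
    have "card T1 \<noteq> card T2"
      using dominates_ex_above[OF fin(1,2) D(5) _ z(1) zT] z(2) by auto
    then have "card T2 < card T1" using C(1) by simp
    then have c: "card T2 + 2 \<le> card T1" using ev(1) by presburger
    let ?S1 = "T1 - {p}" and ?S2 = "insert p T2"
    have B1: "below T1 v = below ?S1 v + (if p < v then 1 else 0)" for v
      by (rule below_remove[OF fin(1) pT])
    have B2: "below ?S2 v = below T2 v + (if p < v then 1 else 0)" for v
      by (rule below_insert[OF fin(2) nin(1)])
    have dom1: "dominates ?S1 ?S2"
      unfolding dominates_def
    proof
      fix v
      have le: "below T2 v \<le> below T1 v" using D(5) by (simp add: dominates_def)
      show "below ?S2 v \<le> below ?S1 v"
      proof (cases "p < v")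
        case True
        then have full: "below T1 v = card T1"
          using p by (intro below_eq_card) (auto simp: greatest_def)
        moreover have "below T2 v \<le> card T2" using fin by (simp add: below_le_card)
        ultimately show ?thesis using B1[of v] B2[of v] c True by simp
      next
        case False
        then show ?thesis using B1[of v] B2[of v] le by simp
      qed
    qed
    have "dominates ?S2 T2" using fin by (auto intro: dominates_superset)
    then have dom2: "dominates ?S2 T3" using D(6) dominates_trans by blast
    have part: "?S1 \<union> ?S2 \<union> T3 = {1..n}" using D(1) pT by blast
    have std': "(?S1, ?S2, T3) \<in> std n"
      by (rule stdI[OF part _ _ _ dom1 dom2]) (use D pT nin in auto)
    have cs: "Suc (card ?S1) = card T1" "card ?S2 = Suc (card T2)"
      using card_Suc_Diff1[OF fin(1) pT] fin nin by auto
    then have par: "even (card ?S1 + card ?S2)" "odd (card ?S2 + card T3)" using ev by presburger+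
    have "\<forall>z\<in>?S1. z < p" using p by (auto simp: greatest_def le_less)
    then have Y: "(?S1, ?S2, T3) \<in> semi_even_fillings n"
      using std' par unfolding semi_even_fillings_def by blast
    have "greatest ?S2 p" using T2p by (auto simp: greatest_def less_imp_le)
    then have "Max ?S2 = p" using fin by (intro Max_greatest) auto
    then have "fix_row2 (?S1, ?S2, T3) = (insert p ?S1, ?S2 - {p}, T3)"
      using par by (simp only: fix_row2.simps simp_thms if_True raise2.simps)
    also have "\<dots> = (T1, T2, T3)" using pT nin by auto
    finally show ?thesis using Y by (metis image_eqI)
  qed
qed

lemma bij_betw_fix_row2: "bij_betw fix_row2 (semi_even_fillings n) (even_fillings n)"
proof (rule bij_betw_onto[OF inj_on_fix_row2])
  fix s assume "s \<in> (semi_even_fillings n)"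
  then show "fix_row2 s \<in> (even_fillings n)" using fix_row2_in by (metis prod_cases3)
next
  fix t assume "t \<in> (even_fillings n)"
  then show "t \<in> fix_row2 ` (semi_even_fillings n)" using fix_row2_surj by (metis prod_cases3)
qed

lemma bij_betw_fix_rows: "bij_betw (fix_row2 \<circ> fix_row3) (bumped_fillings n) (even_fillings n)"
  using bij_betw_fix_row3 bij_betw_fix_row2 by (rule bij_betw_trans)

section \<open>Inserting all remaining entries\<close>

text \<open>The state after the insertion of \<open>m\<^sub>1 a\<^sub>1 m\<^sub>2 a\<^sub>2 \<dots>\<close>: the set \<open>A\<close> of the \<open>a\<^sub>j\<close> above the set \<open>M\<close> of the \<open>m\<^sub>j\<close>,
and the entries \<open>b\<close> still to come, none of which exceeds all of \<open>A\<close>.\<close>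

definition initial_states :: "nat \<Rightarrow> state set" where
  "initial_states n = {(A, M, S3, B). (A, M, S3, B) \<in> states n \<and> S3 = {} \<and> (\<forall>b\<in>B. \<exists>a\<in>A. b < a)}"

text \<open>No remaining entry can bump any more.  The last condition is what becomes of the one that every
\<open>b\<close> initially has a larger element of \<open>A\<close>.\<close>

definition final_states :: "nat \<Rightarrow> state set" where
  "final_states n = {(S1, S2, S3, Q). (S1, S2, S3, Q) \<in> states n \<and> (\<forall>z\<in>S1. \<forall>q\<in>Q. z < q) \<and>
     (Q = {} \<or> (\<exists>b c d. last_bumps (S1, S2, S3) b c d \<and> (\<forall>q\<in>Q. q < c)))}"

text \<open>The invariant that links the two end conditions: a remaining entry is exceeded by an entry of row 1,
or by the entry \<open>c\<close> that left row 1 last.  Without a third row the second alternative is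
void; at the end the first one is.\<close>

definition coverable :: "state \<Rightarrow> bool" where
  "coverable = (\<lambda>(S1, S2, S3, Q). \<forall>q\<in>Q. (\<exists>z\<in>S1. q < z) \<or> (\<exists>b c d. last_bumps (S1, S2, S3) b c d \<and> q < c))"

text \<open>In a step \<open>c\<close> leaves row 1 and becomes the entry of the second alternative, where it replaces
a smaller one.\<close>

lemma coverable_step:
  assumes st: "s \<in> states n" and step: "step_to s t"
  shows "coverable t \<longleftrightarrow> coverable s"
proof -
  obtain S1 S2 S3 Q where s: "s = (S1, S2, S3, Q)" by (rule prod_cases4)
  obtain T1 T2 T3 R where t: "t = (T1, T2, T3, R)" by (rule prod_cases4)
  obtain b c d where b: "bump b c d (S1, S2, S3, Q) (T1, T2, T3, R)"
    using step unfolding s t step_to_def by blast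
  note st = st[unfolded s]
  have B: "b \<in> Q" "\<And>q. q \<in> Q \<Longrightarrow> b \<le> q" "c \<in> S1" "gap S1 b c"
    and E: "T1 = insert b (S1 - {c})" "T2 = insert c (S2 - {d})" "T3 = insert d S3" "R = Q - {b}"
    using b by (auto simp: bump_def)
  have bc: "b < c" using B by (simp add: gap_def)
  have lb: "last_bumps (T1, T2, T3) b c d" using bump_in_states(2)[OF st b] .
  have cov_t: "coverable (T1, T2, T3, R) \<longleftrightarrow> (\<forall>q\<in>R. (\<exists>z\<in>T1. q < z) \<or> q < c)"
    unfolding coverable_def prod.case using lb last_bumps_unique[OF lb] by metis
  have c0: "c0 < c" if "last_bumps (S1, S2, S3) b0 c0 d0" for b0 c0 d0
  proof -
    have "d0 \<in> S3" using that by (simp add: last_bumps_def greatest_def)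
    then obtain b1 c1 d1 where "last_bumps (S1, S2, S3) b1 c1 d1" "c1 < c"
      using bump_end_above[OF st b] by blast
    then show ?thesis using last_bumps_unique[OF that] by simp
  qed
  show ?thesis
    unfolding s t cov_t
  proof
    assume A: "\<forall>q\<in>R. (\<exists>z\<in>T1. q < z) \<or> q < c"
    have "\<exists>z\<in>S1. q < z" if q: "q \<in> Q" for q
    proof (cases "q = b")
      case True
      then show ?thesis using B(3) bc by blast
    next
      case False
      then have qR: "q \<in> R" "b < q" using q B(2)[OF q] E by auto
      then show ?thesis using A B(3) E(1) by fastforce
    qed
    then show "coverable (S1, S2, S3, Q)" unfolding coverable_def by blast
  next
    assume A: "coverable (S1, S2, S3, Q)"
    have "(\<exists>z\<in>T1. q < z) \<or> q < c" if q: "q \<in> R" for q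
    proof -
      have "(\<exists>z\<in>S1. q < z) \<or> (\<exists>b c d. last_bumps (S1, S2, S3) b c d \<and> q < c)"
        using A q E(4) unfolding coverable_def by blast
      then show ?thesis using c0 E(1) by (metis Diff_iff insertI2 less_trans singletonD)
    qed
    then show "\<forall>q\<in>R. (\<exists>z\<in>T1. q < z) \<or> q < c" by blast
  qed
qed

lemma initial_states_iff:
  assumes st: "(S1, S2, S3, Q) \<in> states n"
  shows "(S1, S2, S3, Q) \<in> initial_states n \<longleftrightarrow> S3 = {} \<and> coverable (S1, S2, S3, Q)"
proof -
  have no: "\<not> last_bumps (S1, S2, {}) b c d" for b c d by (simp add: last_bumps_def greatest_def)
  show ?thesis
    using st no unfolding initial_states_def coverable_def mem_Collect_eq prod.case by blast
qed

lemma final_states_iff: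
  assumes st: "(S1, S2, S3, Q) \<in> states n"
  shows "(S1, S2, S3, Q) \<in> final_states n \<longleftrightarrow> (\<nexists>t. step_to (S1, S2, S3, Q) t) \<and> coverable (S1, S2, S3, Q)"
proof -
  have disj: "z \<noteq> q" if "z \<in> S1" "q \<in> Q" for z q
    using st that by (auto simp: states_def)
  have stop: "(\<nexists>t. step_to (S1, S2, S3, Q) t) \<longleftrightarrow> (\<forall>z\<in>S1. \<forall>q\<in>Q. z < q)"
  proof
    assume "\<nexists>t. step_to (S1, S2, S3, Q) t"
    then have "\<not> q < z" if "z \<in> S1" "q \<in> Q" for z q using ex_bump[OF st] that by blast
    then show "\<forall>z\<in>S1. \<forall>q\<in>Q. z < q" using disj by (metis linorder_neqE_nat)
  next
    assume A: "\<forall>z\<in>S1. \<forall>q\<in>Q. z < q"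
    show "\<nexists>t. step_to (S1, S2, S3, Q) t"
    proof
      assume "\<exists>t. step_to (S1, S2, S3, Q) t"
      then obtain t b c d where "bump b c d (S1, S2, S3, Q) t" unfolding step_to_def by blast
      then have "b \<in> Q" "c \<in> S1" "b < c" by (cases t; auto simp: bump_def gap_def)+
      then show False using A by force
    qed
  qed
  have "(Q = {} \<or> (\<exists>b c d. last_bumps (S1, S2, S3) b c d \<and> (\<forall>q\<in>Q. q < c))) \<longleftrightarrow> coverable (S1, S2, S3, Q)"
    if A: "\<forall>z\<in>S1. \<forall>q\<in>Q. z < q"
  proof
    assume "coverable (S1, S2, S3, Q)"
    then have C: "\<exists>b c d. last_bumps (S1, S2, S3) b c d \<and> q < c" if "q \<in> Q" for q
      using A that unfolding coverable_def by force
    show "Q = {} \<or> (\<exists>b c d. last_bumps (S1, S2, S3) b c d \<and> (\<forall>q\<in>Q. q < c))"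
    proof (cases "Q = {}")
      case False
      then obtain b c d where lb: "last_bumps (S1, S2, S3) b c d" using C by blast
      have "q < c" if "q \<in> Q" for q using C[OF that] last_bumps_unique[OF lb] by metis
      then show ?thesis using lb by blast
    qed simp
  qed (auto simp: coverable_def)
  then show ?thesis
    unfolding final_states_def mem_Collect_eq prod.case stop using st by blast
qed

lemma step_to_measure:
  assumes st: "(S1, S2, S3, Q) \<in> states n" and "step_to (S1, S2, S3, Q) (T1, T2, T3, R)"
  shows "card T3 = Suc (card S3)" "card Q = Suc (card R)"
proof -
  obtain b c d where b: "bump b c d (S1, S2, S3, Q) (T1, T2, T3, R)"
    using assms(2) unfolding step_to_def by blast
  have "d \<in> S2" "b \<in> Q" "T3 = insert d S3" "R = Q - {b}" using b by (auto simp: bump_def)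
  moreover from this have "d \<notin> S3" using st by (auto simp: states_def)
  ultimately show "card T3 = Suc (card S3)" "card Q = Suc (card R)"
    using states_finite[OF st] card_Suc_Diff1[of Q b] by auto
qed

lemma step_to_states:
  assumes "s \<in> states n" "step_to s t"
  shows "t \<in> states n"
proof -
  obtain S1 S2 S3 Q where s: "s = (S1, S2, S3, Q)" by (rule prod_cases4)
  obtain T1 T2 T3 R where t: "t = (T1, T2, T3, R)" by (rule prod_cases4)
  obtain b c d where "bump b c d (S1, S2, S3, Q) (T1, T2, T3, R)"
    using assms unfolding s t step_to_def by blast
  then show ?thesis using bump_in_states(1) assms(1) unfolding s t by blast
qed

lemma steps_to_final:
  assumes "s \<in> states n" "coverable s"
  shows "\<exists>t\<in>final_states n. step_to\<^sup>*\<^sup>* s t"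
  using assms
proof (induction "card (snd (snd (snd s)))" arbitrary: s rule: less_induct)
  case less
  obtain S1 S2 S3 Q where s: "s = (S1, S2, S3, Q)" by (rule prod_cases4)
  show ?case
  proof (cases "\<exists>t. step_to s t")
    case True
    then obtain t where t: "step_to s t" by blast
    obtain T1 T2 T3 R where t': "t = (T1, T2, T3, R)" by (rule prod_cases4)
    have "card Q = Suc (card R)"
      using step_to_measure(2) less.prems(1) t unfolding s t' by blast
    then have "card (snd (snd (snd t))) < card (snd (snd (snd s)))" by (simp add: s t')
    moreover have "t \<in> states n" using step_to_states[OF less.prems(1) t] .
    moreover have "coverable t" using coverable_step[OF less.prems(1) t] less.prems(2) by simp
    ultimately obtain f where "f \<in> final_states n" "step_to\<^sup>*\<^sup>* t f" using less.hyps by blast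
    then show ?thesis using t by (meson converse_rtranclp_into_rtranclp)
  next
    case False
    then have "s \<in> final_states n" using final_states_iff less.prems unfolding s by blast
    then show ?thesis by blast
  qed
qed

lemma steps_from_initial:
  assumes "t \<in> states n" "coverable t"
  shows "\<exists>s\<in>initial_states n. step_to\<^sup>*\<^sup>* s t"
  using assms
proof (induction "card (fst (snd (snd t)))" arbitrary: t rule: less_induct)
  case less
  obtain T1 T2 T3 R where t: "t = (T1, T2, T3, R)" by (rule prod_cases4)
  show ?case
  proof (cases "T3 = {}")
    case True
    then have "t \<in> initial_states n" using initial_states_iff less.prems unfolding t by blast
    then show ?thesis by blast
  next
    case False
    then obtain s where s: "s \<in> states n" "step_to s t"
      using ex_unbump less.prems(1) unfolding t by blast
    obtain S1 S2 S3 Q where s': "s = (S1, S2, S3, Q)" by (rule prod_cases4)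
    have "card T3 = Suc (card S3)"
      using step_to_measure(1) s unfolding s' t by blast
    then have "card (fst (snd (snd s))) < card (fst (snd (snd t)))" by (simp add: s' t)
    moreover have "coverable s" using coverable_step[OF s] less.prems(2) by simp
    ultimately obtain i where "i \<in> initial_states n" "step_to\<^sup>*\<^sup>* i s" using less.hyps s(1) by blast
    then show ?thesis using s(2) by (meson rtranclp.rtrancl_into_rtrancl)
  qed
qed

lemma steps_states: "step_to\<^sup>*\<^sup>* s t \<Longrightarrow> s \<in> states n \<Longrightarrow> t \<in> states n"
  by (induction rule: rtranclp_induct) (auto intro: step_to_states)

lemma initial_no_pred:
  assumes "t \<in> initial_states n" "s \<in> states n"
  shows "\<not> step_to s t"
proof
  assume st: "step_to s t"
  obtain S1 S2 S3 Q where s: "s = (S1, S2, S3, Q)" by (rule prod_cases4)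
  obtain T1 T2 T3 R where t: "t = (T1, T2, T3, R)" by (rule prod_cases4)
  have "card T3 = Suc (card S3)" using step_to_measure(1) assms(2) st unfolding s t by blast
  then show False using assms(1) by (auto simp: initial_states_def t)
qed

lemma initial_unique:
  assumes "step_to\<^sup>*\<^sup>* s t" "s \<in> initial_states n" "s' \<in> initial_states n" "step_to\<^sup>*\<^sup>* s' t"
  shows "s = s'"
proof -
  have sub: "initial_states n \<subseteq> states n" by (auto simp: initial_states_def)
  have last: "s' = z \<or> (\<exists>b\<in>states n. step_to\<^sup>*\<^sup>* s' b \<and> step_to b z)" if "step_to\<^sup>*\<^sup>* s' z" for z
    using that
  proof (cases rule: rtranclp.cases)
    case (rtrancl_into_rtrancl b)
    then show ?thesis using steps_states[of s' b n] assms(3) sub by blast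
  qed simp
  show ?thesis
    using assms(1,4)
  proof (induction rule: rtranclp_induct)
    case base
    then show ?case using last[OF base] initial_no_pred[OF assms(2)] by blast
  next
    case (step y z)
    have y: "y \<in> states n" using steps_states[OF step.hyps(1)] assms(2) sub by blast
    have "s' \<noteq> z" using initial_no_pred[OF assms(3) y] step.hyps(2) by blast
    then obtain b where b: "b \<in> states n" "step_to\<^sup>*\<^sup>* s' b" "step_to b z"
      using last[OF step.prems] by blast
    then have "b = y" using step_to_backward_unique[OF b(1) y b(3) step.hyps(2)] by simp
    then show ?case using step.IH b(2) by blast
  qed
qed

text \<open>The entries that no longer bump are appended to row 1.\<close>

fun final_filling :: "state \<Rightarrow> filling" where
  "final_filling (S1, S2, S3, Q) = (S1 \<union> Q, S2, S3)"

text \<open>Entries of the upper row beyond the length of the lower row do not influence dominance: as soon as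
one of them is counted, all of \<open>S1\<close> is.\<close>

lemma dominates_initial_segment:
  assumes fin: "finite S1" "finite Q" "finite S2" and lt: "\<forall>z\<in>S1. \<forall>q\<in>Q. z < q" and card: "card S1 = card S2"
  shows "dominates (S1 \<union> Q) S2 \<longleftrightarrow> dominates S1 S2"
proof
  assume "dominates S1 S2"
  then show "dominates (S1 \<union> Q) S2"
    using dominates_superset[of "S1 \<union> Q" S1] fin dominates_trans by blast
next
  assume D: "dominates (S1 \<union> Q) S2"
  show "dominates S1 S2"
    unfolding dominates_def
  proof
    fix v
    show "below S2 v \<le> below S1 v"
    proof (cases "\<exists>q\<in>Q. q < v")
      case True
      then have "below S1 v = card S1" using lt by (intro below_eq_card) force
      then show ?thesis using below_le_card[OF fin(3), of v] card by simp
    next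
      case False
      then have "below (S1 \<union> Q) v = below S1 v"
        unfolding below_def by (intro arg_cong[of _ _ card]) auto
      then show ?thesis using D unfolding dominates_def by metis
    qed
  qed
qed

lemma final_filling_in:
  assumes "(S1, S2, S3, Q) \<in> final_states n"
  shows "final_filling (S1, S2, S3, Q) \<in> bumped_fillings n"
proof -
  have st: "(S1, S2, S3, Q) \<in> states n" and lt: "\<forall>z\<in>S1. \<forall>q\<in>Q. z < q"
    and end': "Q = {} \<or> (\<exists>b c d. last_bumps (S1, S2, S3) b c d \<and> (\<forall>q\<in>Q. q < c))"
    using assms by (auto simp: final_states_def)
  note fin = states_finite[OF st]
  have p: "S1 \<union> S2 \<union> S3 \<union> Q = {1..n}" "S1 \<inter> S2 = {}" "S1 \<inter> S3 = {}" "S2 \<inter> S3 = {}"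
      "(S1 \<union> S2 \<union> S3) \<inter> Q = {}" "card S1 = card S2" "dominates S1 S2" "dominates S2 S3"
    using st unfolding states_def mem_Collect_eq prod.case by blast+
  have dom: "dominates (S1 \<union> Q) S2"
    using dominates_initial_segment[OF fin(1,4,2) lt p(6)] p(7) by blast
  have part: "S1 \<union> Q \<union> S2 \<union> S3 = {1..n}" using p(1) by blast
  have std: "(S1 \<union> Q, S2, S3) \<in> std n"
    by (rule stdI[OF part _ _ _ dom p(8)]) (use p in auto)
  show ?thesis
  proof (cases "Q = {}")
    case True
    then show ?thesis using std p(6) by (simp add: bumped_fillings_def)
  next
    case False
    then obtain b c d where lb: "last_bumps (S1, S2, S3) b c d" "\<forall>q\<in>Q. q < c" using end' by blast
    then have "\<forall>z\<in>S1 \<union> Q. z < c" using lt False by (metis UnE ex_in_conv less_trans)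
    moreover have "greatest S3 d" "c \<in> S2" "gap S2 c d" using lb by (auto simp: last_bumps_def)
    ultimately show ?thesis using std unfolding bumped_fillings_def final_filling.simps by blast
  qed
qed

text \<open>Row 1 without the appended entries is its initial segment of the length of row 2.\<close>

lemma inj_on_final_filling: "inj_on final_filling (final_states n)"
proof (rule inj_onI)
  fix s t assume s: "s \<in> final_states n" and t: "t \<in> final_states n" and eq: "final_filling s = final_filling t"
  obtain S1 S2 S3 Q where S: "s = (S1, S2, S3, Q)" by (rule prod_cases4)
  obtain T1 T2 T3 R where T: "t = (T1, T2, T3, R)" by (rule prod_cases4)
  have E: "S1 \<union> Q = T1 \<union> R" "S2 = T2" "S3 = T3" using eq by (auto simp: S T)
  have st: "(S1, S2, S3, Q) \<in> states n" "(T1, T2, T3, R) \<in> states n"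
    and lt: "\<forall>z\<in>S1. \<forall>q\<in>Q. z < q" "\<forall>z\<in>T1. \<forall>q\<in>R. z < q"
    using s t by (auto simp: final_states_def S T)
  have p: "card S1 = card T1" "S1 \<inter> Q = {}" "T1 \<inter> R = {}" using st E(2) by (auto simp: states_def)
  have "S1 \<subseteq> T1 \<or> T1 \<subseteq> S1"
  proof (rule ccontr)
    assume "\<not> ?thesis"
    then obtain x y where "x \<in> S1" "x \<notin> T1" "y \<in> T1" "y \<notin> S1" by blast
    then have "x \<in> R" "y \<in> Q" using E(1) by auto
    then have "y < x" "x < y" using lt \<open>x \<in> S1\<close> \<open>y \<in> T1\<close> by auto
    then show False by simp
  qed
  then have "S1 = T1" using p(1) states_finite(1)[OF st(1)] states_finite(1)[OF st(2)]
    by (metis card_subset_eq)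
  then show "s = t" using E p S T by auto
qed

lemma final_filling_surj:
  assumes "(T1, S2, S3) \<in> bumped_fillings n"
  shows "(T1, S2, S3) \<in> final_filling ` final_states n"
proof -
  have std: "(T1, S2, S3) \<in> std n" using assms by (simp add: bumped_fillings_def)
  note fin = std_finite[OF std] and D = stdD[OF std]
  let ?r = "sorted_list_of_set T1"
  define S1 where "S1 = set (take (card S2) ?r)"
  define Q where "Q = set (drop (card S2) ?r)"
  have len: "length ?r = card T1" by simp
  have T1: "S1 \<union> Q = T1" unfolding S1_def Q_def using fin
    by (metis append_take_drop_id set_append set_sorted_list_of_set)
  have dist: "distinct ?r" and srt: "sorted_wrt (<) (take (card S2) ?r @ drop (card S2) ?r)" by simp_all
  have lt: "\<forall>z\<in>S1. \<forall>q\<in>Q. z < q" using srt unfolding S1_def Q_def sorted_wrt_append by blast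
  have "card S1 = length (take (card S2) ?r)" unfolding S1_def by (rule distinct_card) (simp add: dist)
  then have card: "card S1 = card S2" using std_card(1)[OF std] by simp
  have fin': "finite S1" "finite Q" using fin T1 by auto
  have dom: "dominates S1 S2"
    using dominates_initial_segment[OF fin' fin(2) lt card] D(5) T1 by simp
  have SQ: "S1 \<inter> Q = {}" using lt by fastforce
  have part: "S1 \<union> S2 \<union> S3 \<union> Q = {1..n}" using D(1) T1 by blast
  have st: "(S1, S2, S3, Q) \<in> states n"
  proof (rule statesI[OF part _ _ _ _ card dom D(6)])
    show "S1 \<inter> S2 = {}" "S1 \<inter> S3 = {}" "S2 \<inter> S3 = {}" "(S1 \<union> S2 \<union> S3) \<inter> Q = {}"
      using D T1 SQ by blast+
    show "\<forall>q\<in>Q. b < q" if "last_bumps (S1, S2, S3) b c d" for b c d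
      using that lt by (simp add: last_bumps_def)
  qed
  have "Q = {} \<or> (\<exists>b c d. last_bumps (S1, S2, S3) b c d \<and> (\<forall>q\<in>Q. q < c))"
  proof (cases "card T1 = card S2")
    case True
    then show ?thesis by (simp add: Q_def)
  next
    case False
    then obtain c d where cd: "greatest S3 d" "c \<in> S2" "gap S2 c d" "\<forall>z\<in>T1. z < c"
      using assms unfolding bumped_fillings_def mem_Collect_eq prod.case by blast
    obtain u where "u \<in> S1" "u < c"
      using dominates_ex_below[OF fin'(1) fin(2) dom cd(2)] D(2) cd(2) T1 by blast
    then obtain b where "b \<in> S1" "gap S1 b c" using ex_gap_down fin' by blast
    then have "last_bumps (S1, S2, S3) b c d" using cd by (simp add: last_bumps_def)
    then show ?thesis using cd(4) T1 by blast
  qed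
  then have "(S1, S2, S3, Q) \<in> final_states n" using st lt unfolding final_states_def by blast
  moreover have "final_filling (S1, S2, S3, Q) = (T1, S2, S3)" using T1 by simp
  ultimately show ?thesis by (metis image_eqI)
qed

text \<open>Since steps are deterministic, the choice is between equals.\<close>

definition insertion_result :: "nat \<Rightarrow> state \<Rightarrow> state" where
  "insertion_result n s = (SOME t. t \<in> final_states n \<and> step_to\<^sup>*\<^sup>* s t)"

lemma insertion_result:
  assumes "s \<in> initial_states n"
  shows "insertion_result n s \<in> final_states n" "step_to\<^sup>*\<^sup>* s (insertion_result n s)"
proof -
  obtain S1 S2 S3 Q where s: "s = (S1, S2, S3, Q)" by (rule prod_cases4)
  have st: "(S1, S2, S3, Q) \<in> states n" using assms by (auto simp: s initial_states_def)
  have "coverable s" using initial_states_iff[OF st] assms unfolding s by blast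
  then have "\<exists>t. t \<in> final_states n \<and> step_to\<^sup>*\<^sup>* s t" using steps_to_final st s by blast
  then have "insertion_result n s \<in> final_states n \<and> step_to\<^sup>*\<^sup>* s (insertion_result n s)"
    unfolding insertion_result_def by (rule someI_ex)
  then show "insertion_result n s \<in> final_states n" "step_to\<^sup>*\<^sup>* s (insertion_result n s)" by auto
qed

text \<open>Steps are deterministic and reversible, initial states have no predecessor and final states have no
successor.  So following the steps matches initial and final states.\<close>

lemma bij_betw_insertion_result: "bij_betw (insertion_result n) (initial_states n) (final_states n)"
  unfolding bij_betw_def
proof (intro conjI equalityI subsetI)
  show "inj_on (insertion_result n) (initial_states n)"
    by (rule inj_onI) (metis initial_unique insertion_result(2))
next
  fix t assume "t \<in> insertion_result n ` initial_states n"
  then show "t \<in> final_states n" using insertion_result(1) by blast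
next
  fix t assume t: "t \<in> final_states n"
  obtain T1 T2 T3 R where T: "t = (T1, T2, T3, R)" by (rule prod_cases4)
  have st: "(T1, T2, T3, R) \<in> states n" using t by (auto simp: T final_states_def)
  have fin: "(\<nexists>u. step_to t u) \<and> coverable t" using final_states_iff[OF st] t by (simp add: T)
  then obtain s where s: "s \<in> initial_states n" "step_to\<^sup>*\<^sup>* s t"
    using steps_from_initial st T by blast
  let ?f = "insertion_result n s"
  have f: "?f \<in> final_states n" "step_to\<^sup>*\<^sup>* s ?f" using insertion_result[OF s(1)] by auto
  obtain F1 F2 F3 G where F: "?f = (F1, F2, F3, G)" by (rule prod_cases4)
  have "(F1, F2, F3, G) \<in> states n" using f(1) unfolding F by (auto simp: final_states_def)
  then have nf: "\<nexists>u. step_to ?f u" using final_states_iff f(1) unfolding F by blast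
  have "step_to\<^sup>*\<^sup>* t ?f"
    using s(2) f(2)
  proof (induction rule: rtranclp_induct)
    case (step y z)
    then show ?case
      by (metis converse_rtranclpE nf step_to_forward_unique)
  qed
  then have "t = ?f" using fin by (metis converse_rtranclpE)
  then show "t \<in> insertion_result n ` initial_states n" using s(1) by blast
qed

lemma bij_betw_final_filling: "bij_betw final_filling (final_states n) (bumped_fillings n)"
proof (rule bij_betw_onto[OF inj_on_final_filling])
  fix s assume "s \<in> (final_states n)"
  then show "final_filling s \<in> (bumped_fillings n)" using final_filling_in by (metis prod_cases4)
next
  fix t assume "t \<in> (bumped_fillings n)"
  then show "t \<in> final_filling ` (final_states n)" using final_filling_surj by (metis prod_cases3)
qed

lemma bij_betw_bumping:
  "bij_betw (final_filling \<circ> insertion_result n) (initial_states n) (bumped_fillings n)"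
  using bij_betw_insertion_result bij_betw_final_filling by (rule bij_betw_trans)

section \<open>Row insertion on lists\<close>

lemma sorted_list_of_set_eqI:
  fixes r :: "nat list"
  assumes "sorted_wrt (<) r" "set r = S"
  shows "sorted_list_of_set S = r"
  using assms unfolding strict_sorted_iff by (auto simp: sorted_list_of_set.idem_if_sorted_distinct)

lemma sorted_list_of_set_snoc:
  fixes S :: "nat set"
  assumes "finite S" "\<And>z. z \<in> S \<Longrightarrow> z < x"
  shows "sorted_list_of_set (insert x S) = sorted_list_of_set S @ [x]"
  by (rule sorted_list_of_set_eqI) (use assms in \<open>auto simp: sorted_wrt_append\<close>)

lemma sorted_list_of_set_Cons:
  fixes S :: "nat set"
  assumes "finite S" "b \<in> S" "\<And>z. z \<in> S \<Longrightarrow> b \<le> z"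
  shows "sorted_list_of_set S = b # sorted_list_of_set (S - {b})"
  by (rule sorted_list_of_set_eqI) (use assms in \<open>auto simp: le_less\<close>)

lemma row_insert_append: "\<forall>z\<in>set r. z < x \<Longrightarrow> row_insert x r = (r @ [x], None)"
  by (induction r) auto

lemma row_insert_bump:
  assumes "sorted_wrt (<) r" "c \<in> set r" "gap (set r) x c" "x \<notin> set r"
  shows "\<exists>r'. row_insert x r = (r', Some c) \<and> sorted_wrt (<) r' \<and> set r' = insert x (set r - {c})"
  using assms
proof (induction r)
  case (Cons y ys)
  have y: "\<forall>z\<in>set ys. y < z" using Cons.prems(1) by simp
  have gy: "y \<le> x \<or> c \<le> y" and xc: "x < c" using Cons.prems(3) by (auto simp: gap_def)
  show ?case
  proof (cases "x < y")
    case True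
    then have "c \<le> y" using gy by simp
    then have cy: "c = y" using Cons.prems(2) y by auto
    have "y \<notin> set ys" using y by auto
    moreover have "sorted_wrt (<) (x # ys)" using Cons.prems(1) True by auto
    ultimately show ?thesis using True cy by auto
  next
    case False
    have "y \<noteq> x" using Cons.prems(4) by auto
    then have yx: "y < x" using False by simp
    then have cy: "c \<noteq> y" using xc by simp
    then have "c \<in> set ys" using Cons.prems(2) by simp
    moreover have "gap (set ys) x c" using Cons.prems(3) by (simp add: gap_def)
    ultimately obtain r' where r': "row_insert x ys = (r', Some c)" "sorted_wrt (<) r'"
      "set r' = insert x (set ys - {c})"
      using Cons.IH Cons.prems(1,4) by auto
    have "sorted_wrt (<) (y # r')" using r' y yx by auto
    moreover have "set (y # r') = insert x (set (y # ys) - {c})" using r'(3) cy by auto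
    ultimately show ?thesis using r'(1) False by auto
  qed
qed simp

lemma row_insert_sorted_list:
  assumes "finite S" "c \<in> S" "gap S x c" "x \<notin> S"
  shows "row_insert x (sorted_list_of_set S) = (sorted_list_of_set (insert x (S - {c})), Some c)"
proof -
  obtain r' where "row_insert x (sorted_list_of_set S) = (r', Some c)" "sorted_wrt (<) r'"
    "set r' = insert x (S - {c})"
    using row_insert_bump[of "sorted_list_of_set S" c x] assms by auto
  then show ?thesis using sorted_list_of_set_eqI by auto
qed

lemma sorted_list_of_set_Nil: "finite S \<Longrightarrow> sorted_list_of_set S = [] \<longleftrightarrow> S = {}"
  by simp

lemma tableau_insert_append:
  assumes "finite S1" "\<And>z. z \<in> S1 \<Longrightarrow> z < x" and e: "S1 = {} \<longrightarrow> S2 = {}" "S2 = {} \<longrightarrow> S3 = {}"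
  shows "tableau_insert x (tab (S1, S2, S3)) = tab (insert x S1, S2, S3)"
proof (cases "S1 = {}")
  case True
  then show ?thesis using e by (simp add: tableau_of_rows_def)
next
  case False
  then have "sorted_list_of_set S1 \<noteq> []" using assms(1) by simp
  moreover have "row_insert x (sorted_list_of_set S1) = (sorted_list_of_set S1 @ [x], None)"
    using assms by (intro row_insert_append) auto
  ultimately show ?thesis
    using sorted_list_of_set_snoc[OF assms(1,2)] by (simp add: tableau_of_rows_def)
qed

lemma tableau_insert_bump:
  assumes st: "(S1, S2, S3, Q) \<in> states n" and b: "bump b c d (S1, S2, S3, Q) (T1, T2, T3, R)"
  shows "tableau_insert b (tab (S1, S2, S3)) = tab (T1, T2, T3)"
proof -
  note fin = states_finite[OF st]
  have B: "b \<in> Q" "c \<in> S1" "gap S1 b c" "d \<in> S2" "gap S2 c d"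
    and E: "T1 = insert b (S1 - {c})" "T2 = insert c (S2 - {d})" "T3 = insert d S3"
    using b by (auto simp: bump_def)
  have nin: "b \<notin> S1" "c \<notin> S2" using B st by (auto simp: states_def)
  have less: "z < d" if "z \<in> S3" for z using bump_end_above[OF st b that] by auto
  have r1: "row_insert b (sorted_list_of_set S1) = (sorted_list_of_set T1, Some c)"
    using row_insert_sorted_list[OF fin(1) B(2,3) nin(1)] E by simp
  have r2: "row_insert c (sorted_list_of_set S2) = (sorted_list_of_set T2, Some d)"
    using row_insert_sorted_list[OF fin(2) B(4,5) nin(2)] E by simp
  have r3: "row_insert d (sorted_list_of_set S3) = (sorted_list_of_set T3, None)"
    using row_insert_append[of "sorted_list_of_set S3" d] less fin sorted_list_of_set_snoc[OF fin(3) less] E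
    by simp
  have ne: "sorted_list_of_set S1 \<noteq> []" "sorted_list_of_set S2 \<noteq> []"
    "sorted_list_of_set T1 \<noteq> []" "sorted_list_of_set T2 \<noteq> []" "sorted_list_of_set T3 \<noteq> []"
    using B fin unfolding E by (auto simp: sorted_list_of_set_Nil)
  show ?thesis
  proof (cases "sorted_list_of_set S3 = []")
    case True
    then have "sorted_list_of_set T3 = [d]" using r3 by simp
    then show ?thesis using True ne r1 r2 by (simp add: tableau_of_rows_def)
  next
    case False
    then show ?thesis using ne r1 r2 r3 by (simp add: tableau_of_rows_def)
  qed
qed

text \<open>The least remaining entry is inserted first, and its insertion is one step.\<close>

lemma fold_insert_step:
  assumes st: "(S1, S2, S3, Q) \<in> states n" and "step_to (S1, S2, S3, Q) (T1, T2, T3, R)"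
  shows "fold tableau_insert (sorted_list_of_set Q) (tab (S1, S2, S3)) =
    fold tableau_insert (sorted_list_of_set R) (tab (T1, T2, T3))"
proof -
  obtain b c d where b: "bump b c d (S1, S2, S3, Q) (T1, T2, T3, R)"
    using assms(2) unfolding step_to_def by blast
  then have "sorted_list_of_set Q = b # sorted_list_of_set R"
    using sorted_list_of_set_Cons[OF states_finite(4)[OF st], of b] by (auto simp: bump_def)
  then show ?thesis using tableau_insert_bump[OF st b] by (simp del: tab.simps)
qed

lemma fold_insert_steps:
  assumes "step_to\<^sup>*\<^sup>* s t" "s \<in> states n"
  shows "(case s of (S1, S2, S3, Q) \<Rightarrow> fold tableau_insert (sorted_list_of_set Q) (tab (S1, S2, S3))) =
    (case t of (T1, T2, T3, R) \<Rightarrow> fold tableau_insert (sorted_list_of_set R) (tab (T1, T2, T3)))"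
  using assms
proof (induction rule: rtranclp_induct)
  case (step y z)
  obtain Y1 Y2 Y3 P where y: "y = (Y1, Y2, Y3, P)" by (rule prod_cases4)
  obtain Z1 Z2 Z3 R where z: "z = (Z1, Z2, Z3, R)" by (rule prod_cases4)
  have "y \<in> states n" by (rule steps_states[OF step.hyps(1) step.prems])
  then have "fold tableau_insert (sorted_list_of_set P) (tab (Y1, Y2, Y3)) =
    fold tableau_insert (sorted_list_of_set R) (tab (Z1, Z2, Z3))"
    using step.hyps(2) unfolding y z by (rule fold_insert_step)
  then show ?case using step.IH step.prems unfolding y z prod.case by simp
qed simp

lemma fold_insert_append:
  assumes "sorted_wrt (<) qs" "finite S1" "\<forall>z\<in>S1. \<forall>q\<in>set qs. z < q" "S1 = {} \<longrightarrow> S2 = {}" "S2 = {} \<longrightarrow> S3 = {}"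
  shows "fold tableau_insert qs (tab (S1, S2, S3)) = tab (S1 \<union> set qs, S2, S3)"
  using assms
proof (induction qs arbitrary: S1)
  case (Cons q qs)
  have "tableau_insert q (tab (S1, S2, S3)) = tab (insert q S1, S2, S3)"
    using Cons.prems by (intro tableau_insert_append) auto
  moreover have "fold tableau_insert qs (tab (insert q S1, S2, S3)) = tab (insert q S1 \<union> set qs, S2, S3)"
    using Cons.prems by (intro Cons.IH) auto
  ultimately show ?case by (simp del: tab.simps)
qed simp

lemma states_empty:
  assumes "(S1, S2, S3, Q) \<in> states n"
  shows "S1 = {} \<longrightarrow> S2 = {}" "S2 = {} \<longrightarrow> S3 = {}"
proof -
  note fin = states_finite[OF assms]
  have "card S1 = card S2" "dominates S2 S3" using assms by (auto simp: states_def)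
  moreover from this have "card S3 \<le> card S2" using dominates_card fin by blast
  ultimately show "S1 = {} \<longrightarrow> S2 = {}" "S2 = {} \<longrightarrow> S3 = {}" using fin by auto
qed

lemma fold_insert_initial:
  assumes "(A, M, {}, B) \<in> initial_states n"
  shows "fold tableau_insert (sorted_list_of_set B) (tab (A, M, {})) =
    tab (final_filling (insertion_result n (A, M, {}, B)))"
proof -
  let ?t = "insertion_result n (A, M, {}, B)"
  obtain T1 T2 T3 R where t: "?t = (T1, T2, T3, R)" by (rule prod_cases4)
  have st: "(A, M, {}, B) \<in> states n" using assms by (simp add: initial_states_def)
  have f: "(T1, T2, T3, R) \<in> final_states n" using insertion_result(1)[OF assms] unfolding t .
  then have tst: "(T1, T2, T3, R) \<in> states n" and lt: "\<forall>z\<in>T1. \<forall>q\<in>R. z < q"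
    by (auto simp: final_states_def)
  have "fold tableau_insert (sorted_list_of_set B) (tab (A, M, {})) =
    fold tableau_insert (sorted_list_of_set R) (tab (T1, T2, T3))"
    using fold_insert_steps[OF insertion_result(2)[OF assms] st] unfolding t prod.case .
  also have "\<dots> = tab (T1 \<union> set (sorted_list_of_set R), T2, T3)"
    using states_finite[OF tst] lt states_empty[OF tst] by (intro fold_insert_append) auto
  finally show ?thesis using states_finite[OF tst] by (simp add: t)
qed

lemma row_insert_last:
  assumes "\<forall>u\<in>set xs. u < y" "y < z"
  shows "row_insert y (xs @ [z]) = (xs @ [y], Some z)"
  using assms by (induction xs) auto

definition interleave :: "nat list \<Rightarrow> nat list \<Rightarrow> nat list" where
  "interleave ms as = concat (map (\<lambda>j. [ms ! j, as ! j]) [0..<length ms])"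

text \<open>Each \<open>m\<^sub>j\<close> is appended to row 1 and immediately pushed down into row 2 by \<open>a\<^sub>j\<close>.\<close>

lemma insertion_interleave:
  assumes m: "sorted_wrt (<) ms" and a: "sorted_wrt (<) as" and len: "length as = length ms"
    and am: "\<And>j. j < length ms \<Longrightarrow> as ! j < ms ! j"
  shows "insertion_tableau (interleave ms as) = tableau_of_rows as ms []"
proof -
  have "fold tableau_insert (concat (map (\<lambda>j. [ms ! j, as ! j]) [0..<k])) [] = tableau_of_rows (take k as) (take k ms) []"
    if "k \<le> length ms" for k
    using that
  proof (induction k)
    case 0
    then show ?case by (simp add: tableau_of_rows_def)
  next
    case (Suc k)
    then have k: "k < length ms" "k < length as" using len by auto
    have T: "take (Suc k) as = take k as @ [as ! k]" "take (Suc k) ms = take k ms @ [ms ! k]"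
      using k by (simp_all add: take_Suc_conv_app_nth)
    have ak: "\<forall>z\<in>set (take k as). z < as ! k"
      using k sorted_wrt_nth_less[OF a] by (auto simp: in_set_conv_nth)
    have mk: "\<forall>z\<in>set (take k ms). z < ms ! k"
      using k sorted_wrt_nth_less[OF m] by (auto simp: in_set_conv_nth)
    have amk: "as ! k < ms ! k" using am k by simp
    have r1: "row_insert (ms ! k) (take k as) = (take k as @ [ms ! k], None)"
      by (rule row_insert_append) (use ak amk in force)
    have r2: "row_insert (as ! k) (take k as @ [ms ! k]) = (take k as @ [as ! k], Some (ms ! k))"
      by (rule row_insert_last[OF ak amk])
    have r3: "row_insert (ms ! k) (take k ms) = (take k ms @ [ms ! k], None)"
      by (rule row_insert_append[OF mk])
    have ne: "take k as = [] \<longleftrightarrow> take k ms = []" using len k by auto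
    have i1: "tableau_insert (ms ! k) (tableau_of_rows (take k as) (take k ms) []) =
      tableau_of_rows (take k as @ [ms ! k]) (take k ms) []"
      using r1 ne by (cases "take k as = []") (simp_all add: tableau_of_rows_def)
    have i2: "tableau_insert (as ! k) (tableau_of_rows (take k as @ [ms ! k]) (take k ms) []) =
      tableau_of_rows (take k as @ [as ! k]) (take k ms @ [ms ! k]) []"
      using r2 r3 ne by (cases "take k ms = []") (simp_all add: tableau_of_rows_def)
    have "fold tableau_insert (concat (map (\<lambda>j. [ms ! j, as ! j]) [0..<Suc k])) [] =
      tableau_insert (as ! k) (tableau_insert (ms ! k) (tableau_of_rows (take k as) (take k ms) []))"
      using Suc by simp
    then show ?case unfolding i1 i2 T .
  qed
  from this[of "length ms"] show ?thesis
    using len by (simp add: insertion_tableau_def interleave_def)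
qed

lemma initial_state_columns:
  assumes "(A, M, {}, B) \<in> initial_states n"
  shows "length (sorted_list_of_set A) = length (sorted_list_of_set M)"
    "\<And>j. j < length (sorted_list_of_set M) \<Longrightarrow> sorted_list_of_set A ! j < sorted_list_of_set M ! j"
proof -
  have st: "(A, M, {}, B) \<in> states n" using assms by (simp add: initial_states_def)
  note fin = states_finite[OF st]
  have d: "dominates A M" "A \<inter> M = {}" "card A = card M" using st by (auto simp: states_def)
  then show "length (sorted_list_of_set A) = length (sorted_list_of_set M)" by simp
  show "sorted_list_of_set A ! j < sorted_list_of_set M ! j" if "j < length (sorted_list_of_set M)" for j
    using dominates_iff_columns[of "sorted_list_of_set A" "sorted_list_of_set M"] d fin that by simp
qed

lemma insertion_tableau_initial:
  assumes "(A, M, {}, B) \<in> initial_states n"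
  shows "insertion_tableau (interleave (sorted_list_of_set M) (sorted_list_of_set A) @ sorted_list_of_set B) =
    tab (final_filling (insertion_result n (A, M, {}, B)))"
proof -
  have "insertion_tableau (interleave (sorted_list_of_set M) (sorted_list_of_set A)) = tab (A, M, {})"
    using insertion_interleave[of "sorted_list_of_set M" "sorted_list_of_set A"]
      initial_state_columns[OF assms] by simp
  then show ?thesis
    using fold_insert_initial[OF assms] by (simp add: insertion_tableau_def del: tab.simps)
qed

section \<open>The moves on tableaux\<close>

lemma cells_tab:
  assumes "(S1, S2, S3) \<in> std n"
  shows "cells (tab (S1, S2, S3)) = n"
proof -
  have "concat (tab (S1, S2, S3)) \<in> permutations_of_set {1..n}"
    using tab_in_SYT3[OF assms] unfolding SYT3_def standard_tableaux_def by blast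
  then have "length (concat (tab (S1, S2, S3))) = card {1..n}"
    by (rule length_finite_permutations_of_set)
  then show ?thesis by (simp add: cells_def)
qed

text \<open>A row has the parity of the number of cells if and only if the other two rows together have an even
number of cells.\<close>

lemma defective_tab:
  assumes "(S1, S2, S3) \<in> std n"
  shows "defective (tab (S1, S2, S3)) 2 \<longleftrightarrow> S3 \<noteq> {} \<and> odd (card S1 + card S2)"
    "defective (tab (S1, S2, S3)) 1 \<longleftrightarrow> S2 \<noteq> {} \<and> odd (card S1 + card S3)"
proof -
  have par: "(x mod 2 \<noteq> (x + y) mod 2) = odd y" for x y :: nat by presburger
  have n: "n = card S3 + (card S1 + card S2)" "n = card S2 + (card S1 + card S3)"
    using std_card(3)[OF assms] by auto
  show "defective (tab (S1, S2, S3)) 2 \<longleftrightarrow> S3 \<noteq> {} \<and> odd (card S1 + card S2)"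
    unfolding defective_def cells_tab[OF assms] row_tab[OF assms]
    using std_finite[OF assms] par[of "card S3" "card S1 + card S2"] n(1) by simp
  show "defective (tab (S1, S2, S3)) 1 \<longleftrightarrow> S2 \<noteq> {} \<and> odd (card S1 + card S3)"
    unfolding defective_def cells_tab[OF assms] One_nat_def row_tab[OF assms]
    using std_finite[OF assms] par[of "card S2" "card S1 + card S3"] n(2) by simp
qed

lemma equal_parity_tab:
  assumes "(S1, S2, S3) \<in> std n"
  shows "equal_parity (tab (S1, S2, S3)) \<longleftrightarrow> even (card S1 + card S2) \<and> even (card S2 + card S3)"
proof -
  have par: "x mod 2 = y mod 2 \<longleftrightarrow> even (x + y)" for x y :: nat by presburger
  show ?thesis
    unfolding equal_parity_def One_nat_def row_tab[OF assms] by (simp add: par)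
qed

lemma sorted_list_of_set_greatest:
  assumes "finite S" "greatest S m"
  shows "sorted_list_of_set S = sorted_list_of_set (S - {m}) @ [m]"
proof -
  have "S = insert m (S - {m})" using assms by (auto simp: greatest_def)
  moreover have "sorted_list_of_set (insert m (S - {m})) = sorted_list_of_set (S - {m}) @ [m]"
    by (rule sorted_list_of_set_snoc) (use assms in \<open>auto simp: greatest_def le_less\<close>)
  ultimately show ?thesis by simp
qed

lemma sorted_list_of_set_replace:
  assumes "finite S" "x \<in> S" "gap S x y" "y \<notin> S"
  shows "map (\<lambda>z. if z = x then y else z) (sorted_list_of_set S) = sorted_list_of_set (insert y (S - {x}))"
proof -
  let ?f = "\<lambda>z. if z = x then y else z"
  have "sorted_wrt (\<lambda>u w. ?f u < ?f w) (sorted_list_of_set S)"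
  proof (rule sorted_wrt_mono_rel[of _ "(<)"])
    fix u w assume uw: "u \<in> set (sorted_list_of_set S)" "w \<in> set (sorted_list_of_set S)" "u < w"
    then have "u \<in> S" "w \<in> S" using assms(1) by auto
    then show "?f u < ?f w" using uw(3) assms(3,4) unfolding gap_def
      by (cases "w = y") (force)+
  qed simp
  then have "sorted_wrt (<) (map ?f (sorted_list_of_set S))" by (simp add: sorted_wrt_map)
  moreover have "set (map ?f (sorted_list_of_set S)) = insert y (S - {x})" using assms by auto
  ultimately show ?thesis using sorted_list_of_set_eqI by metis
qed

text \<open>Because of the gap between \<open>x\<close> and \<open>y\<close>, replacing \<open>x\<close> by \<open>y\<close> in place keeps row 2 sorted, and \<open>x\<close>
exceeds row 1, so that appending it is inserting it.\<close>

lemma M1_tab: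
  assumes std: "(S1, S2, S3) \<in> std n" and xy: "greatest S3 y" "x \<in> S2" "gap S2 x y" "\<forall>z\<in>S1. z < x"
  shows "M1 (tab (S1, S2, S3)) = tab (insert x S1, insert y (S2 - {x}), S3 - {y})"
proof -
  note fin = std_finite[OF std]
  have y: "y \<notin> S2" using xy(1) stdD(4)[OF std] by (auto simp: greatest_def)
  have Mx: "Max {z \<in> set (sorted_list_of_set S2). z < y} = x"
    using Max_gap[OF fin(2) xy(2,3)] fin by simp
  have r3: "sorted_list_of_set S3 = sorted_list_of_set (S3 - {y}) @ [y]"
    by (rule sorted_list_of_set_greatest[OF fin(3) xy(1)])
  have r1: "sorted_list_of_set S1 @ [x] = sorted_list_of_set (insert x S1)"
    using sorted_list_of_set_snoc[OF fin(1)] xy(4) by simp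
  have l3: "last (sorted_list_of_set S3) = y" "butlast (sorted_list_of_set S3) = sorted_list_of_set (S3 - {y})"
    unfolding r3 by simp_all
  show ?thesis
    unfolding M1_def One_nat_def row_tab[OF std] l3 Let_def Mx r1 sorted_list_of_set_replace[OF fin(2) xy(2,3) y]
    by simp
qed

lemma M2_tab:
  assumes std: "(S1, S2, S3) \<in> std n" and m: "greatest S2 m" "\<forall>z\<in>S1. z < m"
  shows "M2 (tab (S1, S2, S3)) = tab (insert m S1, S2 - {m}, S3)"
proof -
  note fin = std_finite[OF std]
  have r2: "sorted_list_of_set S2 = sorted_list_of_set (S2 - {m}) @ [m]"
    by (rule sorted_list_of_set_greatest[OF fin(2) m(1)])
  have r1: "sorted_list_of_set S1 @ [m] = sorted_list_of_set (insert m S1)"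
    using sorted_list_of_set_snoc[OF fin(1)] m(2) by simp
  have l2: "last (sorted_list_of_set S2) = m" "butlast (sorted_list_of_set S2) = sorted_list_of_set (S2 - {m})"
    unfolding r2 by simp_all
  show ?thesis
    unfolding M2_def One_nat_def row_tab[OF std] l2 r1 by simp
qed

lemma Psi_tab:
  assumes F: "F \<in> bumped_fillings n"
  shows "Psi (tab F) = tab (fix_row2 (fix_row3 F))"
proof -
  obtain S1 S2 S3 where F': "F = (S1, S2, S3)" by (rule prod_cases3)
  note F = F[unfolded F']
  have std: "(S1, S2, S3) \<in> std n" using F by (simp add: bumped_fillings_def)
  have first: "(if defective (tab (S1, S2, S3)) 2 then M1 (tab (S1, S2, S3)) else tab (S1, S2, S3)) =
      tab (fix_row3 (S1, S2, S3))"
  proof (cases "odd (card S1 + card S2)")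
    case True
    obtain x y where xy: "greatest S3 y" "x \<in> S2" "gap S2 x y" "\<forall>z\<in>S1. z < x"
      and eq: "fix_row3 (S1, S2, S3) = (insert x S1, insert y (S2 - {x}), S3 - {y})"
      by (rule odd_bumped_filling[OF F True])
    have "defective (tab (S1, S2, S3)) 2"
      unfolding defective_tab(1)[OF std] using True xy(1) by (auto simp: greatest_def)
    then show ?thesis using M1_tab[OF std xy] unfolding eq by presburger
  next
    case False
    then have "\<not> defective (tab (S1, S2, S3)) 2" unfolding defective_tab(1)[OF std] by blast
    moreover have "fix_row3 (S1, S2, S3) = (S1, S2, S3)" using False by (simp del: raise3.simps)
    ultimately show ?thesis by presburger
  qed
  obtain T1 T2 T3 where T: "fix_row3 (S1, S2, S3) = (T1, T2, T3)" by (rule prod_cases3)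
  have Y: "(T1, T2, T3) \<in> semi_even_fillings n" using fix_row3_in[OF F] unfolding T .
  then have stdT: "(T1, T2, T3) \<in> std n" and ev: "even (card T1 + card T2)" by (auto simp: semi_even_fillings_def)
  have second: "(if defective (tab (T1, T2, T3)) 1 then M2 (tab (T1, T2, T3)) else tab (T1, T2, T3)) =
      tab (fix_row2 (T1, T2, T3))"
  proof (cases "odd (card T2 + card T3)")
    case True
    obtain m where m: "greatest T2 m" "\<forall>z\<in>T1. z < m" and eq: "fix_row2 (T1, T2, T3) = (insert m T1, T2 - {m}, T3)"
      by (rule odd_semi_even_filling[OF Y True])
    have "odd (card T1 + card T3)" using True ev by presburger
    then have "defective (tab (T1, T2, T3)) 1"
      unfolding defective_tab(2)[OF stdT] using m(1) by (auto simp: greatest_def)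
    then show ?thesis using M2_tab[OF stdT m] unfolding eq by presburger
  next
    case False
    then have "even (card T1 + card T3)" using ev by presburger
    then have "\<not> defective (tab (T1, T2, T3)) 1" unfolding defective_tab(2)[OF stdT] by blast
    moreover have "fix_row2 (T1, T2, T3) = (T1, T2, T3)" using False by simp
    ultimately show ?thesis by presburger
  qed
  show ?thesis
    unfolding F' Psi_def Let_def first T second ..
qed

text \<open>If the parities agree, then neither move applies.\<close>

lemma equalize_tab:
  assumes F: "F \<in> bumped_fillings n"
  shows "(if equal_parity (tab F) then tab F else Psi (tab F)) = tab (fix_row2 (fix_row3 F))"
proof -
  obtain S1 S2 S3 where F': "F = (S1, S2, S3)" by (rule prod_cases3)
  have std: "(S1, S2, S3) \<in> std n" using F by (simp add: bumped_fillings_def F')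
  have "tab F = tab (fix_row2 (fix_row3 F))" if "equal_parity (tab F)"
    using that unfolding F' equal_parity_tab[OF std] by (simp del: tab.simps raise3.simps)
  then show ?thesis using Psi_tab[OF F] by (simp del: tab.simps)
qed

lemma bij_betw_even_tab: "bij_betw tab (even_fillings n) (SYT3_eq n)"
proof (rule bij_betw_subset[OF bij_betw_tab])
  show "even_fillings n \<subseteq> std n" by (auto simp: even_fillings_def)
  show "tab ` even_fillings n = SYT3_eq n"
  proof (intro equalityI subsetI)
    fix T assume "T \<in> tab ` even_fillings n"
    then obtain F where "T = tab F" "F \<in> even_fillings n" by blast
    moreover obtain S1 S2 S3 where "F = (S1, S2, S3)" by (rule prod_cases3)
    ultimately show "T \<in> SYT3_eq n"
      using tab_in_SYT3[of S1 S2 S3 n] equal_parity_tab[of S1 S2 S3 n]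
      by (simp add: SYT3_eq_def even_fillings_def del: tab.simps)
  next
    fix T assume T: "T \<in> SYT3_eq n"
    then have "T \<in> tab ` std n" using bij_betw_tab[of n] by (auto simp: SYT3_eq_def bij_betw_def)
    then obtain F where F: "T = tab F" "F \<in> std n" by blast
    obtain S1 S2 S3 where "F = (S1, S2, S3)" by (rule prod_cases3)
    then have "F \<in> even_fillings n"
      using F T equal_parity_tab[of S1 S2 S3 n]
      by (simp add: SYT3_eq_def even_fillings_def del: tab.simps)
    then show "T \<in> tab ` even_fillings n" using F(1) by blast
  qed
qed

definition equalized_insertion :: "state \<Rightarrow> nat list list" where
  "equalized_insertion = (\<lambda>(A, M, _, B).
     let T = insertion_tableau (interleave (sorted_list_of_set M) (sorted_list_of_set A) @ sorted_list_of_set B)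
     in if equal_parity T then T else Psi T)"

lemma bij_betw_equalized_insertion:
  "bij_betw equalized_insertion (initial_states n) (SYT3_eq n)"
proof -
  let ?g = "tab \<circ> ((fix_row2 \<circ> fix_row3) \<circ> (final_filling \<circ> insertion_result n))"
  have "bij_betw ?g (initial_states n) (SYT3_eq n)"
    by (rule bij_betw_trans[OF bij_betw_trans[OF bij_betw_bumping bij_betw_fix_rows] bij_betw_even_tab])
  moreover have "equalized_insertion s = ?g s" if s: "s \<in> initial_states n" for s
  proof -
    obtain A M C B where e: "s = (A, M, C, B)" by (rule prod_cases4)
    have C: "C = {}" using s by (simp add: e initial_states_def)
    let ?F = "final_filling (insertion_result n (A, M, {}, B))"
    have "?F \<in> bumped_fillings n"
      using bij_betw_apply[OF bij_betw_bumping s] by (simp add: e C)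
    then have "(if equal_parity (tab ?F) then tab ?F else Psi (tab ?F)) = tab (fix_row2 (fix_row3 ?F))"
      by (rule equalize_tab)
    then show ?thesis
      unfolding e C equalized_insertion_def prod.case insertion_tableau_initial[OF s[unfolded e C]] Let_def comp_apply .
  qed
  ultimately show ?thesis using bij_betw_cong by blast
qed

section \<open>Permutations given by descent tops and bottoms\<close>

text \<open>The tops in \<open>T\<close> and the bottoms in \<open>L\<close> occur only as adjacent pairs, each top right before
a smaller bottom.\<close>

fun linked :: "nat set \<Rightarrow> nat set \<Rightarrow> nat list \<Rightarrow> bool" where
  "linked L T [] \<longleftrightarrow> True"
| "linked L T [x] \<longleftrightarrow> x \<notin> T \<and> x \<notin> L"
| "linked L T (x # y # ys) \<longleftrightarrow>
     (if x \<in> T then y \<in> L \<and> y < x \<and> linked L T ys else x \<notin> L \<and> linked L T (y # ys))"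

text \<open>The shape of the permutations in \<open>Motzkin_perms n\<close>: \<open>T\<close> and \<open>L\<close> will turn out to be \<open>D_set p\<close> and
\<open>U_set p\<close>.\<close>

definition codes :: "nat \<Rightarrow> nat set \<Rightarrow> nat set \<Rightarrow> nat list \<Rightarrow> bool" where
  "codes n L T p \<longleftrightarrow> p \<in> permutations_of_set {1..n} \<and> L \<subseteq> {1..n} \<and> T \<subseteq> {1..n} \<and> L \<inter> T = {} \<and>
     sorted_wrt (<) (filter (\<lambda>v. v \<in> T) p) \<and> sorted_wrt (<) (filter (\<lambda>v. v \<notin> T) p) \<and> linked L T p"

lemma linked_of_nth:
  assumes "L \<inter> T = {}"
    and "\<And>i. i < length p \<Longrightarrow> p ! i \<in> T \<Longrightarrow> Suc i < length p \<and> p ! Suc i \<in> L \<and> p ! Suc i < p ! i"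
    and "\<And>i. i < length p \<Longrightarrow> p ! i \<in> L \<Longrightarrow> \<exists>j. i = Suc j \<and> p ! j \<in> T"
  shows "linked L T p"
  using assms
proof (induction L T p rule: linked.induct)
  case (2 L T x)
  from "2.prems"(2)[of 0] "2.prems"(3)[of 0] show ?case by auto
next
  case (3 L T x y ys)
  show ?case
  proof (cases "x \<in> T")
    case True
    then have y: "y \<in> L" "y < x" using "3.prems"(2)[of 0] by auto
    have "linked L T ys"
    proof (rule "3.IH"(1)[OF True "3.prems"(1)])
      fix i assume i: "i < length ys"
      show "Suc i < length ys \<and> ys ! Suc i \<in> L \<and> ys ! Suc i < ys ! i" if "ys ! i \<in> T"
        using "3.prems"(2)[of "Suc (Suc i)"] i that by simp
      show "\<exists>j. i = Suc j \<and> ys ! j \<in> T" if "ys ! i \<in> L"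
      proof -
        obtain j where j: "Suc (Suc i) = Suc j" "(x # y # ys) ! j \<in> T"
          using "3.prems"(3)[of "Suc (Suc i)"] i \<open>ys ! i \<in> L\<close> by auto
        have "i \<noteq> 0"
        proof
          assume "i = 0"
          then have "y \<in> T" using j by simp
          then show False using y(1) "3.prems"(1) by blast
        qed
        then show ?thesis using j by (cases i) auto
      qed
    qed
    then show ?thesis using True y by simp
  next
    case False
    have "x \<notin> L" using "3.prems"(3)[of 0] by auto
    moreover have "linked L T (y # ys)"
    proof (rule "3.IH"(2)[OF False "3.prems"(1)])
      fix i assume i: "i < length (y # ys)"
      show "Suc i < length (y # ys) \<and> (y # ys) ! Suc i \<in> L \<and> (y # ys) ! Suc i < (y # ys) ! i" if "(y # ys) ! i \<in> T"
        using "3.prems"(2)[of "Suc i"] i that by simp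
      show "\<exists>j. i = Suc j \<and> (y # ys) ! j \<in> T" if inL: "(y # ys) ! i \<in> L"
      proof -
        obtain j where j: "Suc i = Suc j" "(x # y # ys) ! j \<in> T"
          using "3.prems"(3)[of "Suc i"] i inL by auto
        then show ?thesis using False by (cases i) auto
      qed
    qed
    ultimately show ?thesis using False by simp
  qed
qed simp

text \<open>The word is recovered by writing the entries outside \<open>T\<close> in their order and putting the next top
before each of them that is in \<open>L\<close>.\<close>

lemma linked_unique:
  assumes "L \<inter> T = {}" "linked L T p" "linked L T q"
    "filter (\<lambda>v. v \<in> T) p = filter (\<lambda>v. v \<in> T) q" "filter (\<lambda>v. v \<notin> T) p = filter (\<lambda>v. v \<notin> T) q"
  shows "p = q"
  using assms
proof (induction L T p arbitrary: q rule: linked.induct)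
  case (1 L T)
  have "set q \<subseteq> {}"
  proof
    fix v assume "v \<in> set q"
    then have "v \<in> set (filter (\<lambda>v. v \<in> T) q) \<or> v \<in> set (filter (\<lambda>v. v \<notin> T) q)" by simp
    then show "v \<in> {}" using "1.prems"(4,5)[symmetric] by simp
  qed
  then show ?case by simp
next
  case (2 L T x)
  then have q: "filter (\<lambda>v. v \<in> T) q = []" "filter (\<lambda>v. v \<notin> T) q = [x]" by auto
  then have "\<forall>v\<in>set q. v \<notin> T" by (simp add: filter_empty_conv)
  then have "filter (\<lambda>v. v \<notin> T) q = q" by simp
  then show ?case using q by simp
next
  case (3 L T x y ys)
  note disj = "3.prems"(1)
  show ?case
  proof (cases "x \<in> T")
    case True
    then have y: "y \<in> L" "y \<notin> T" "linked L T ys" using "3.prems"(2) disj by auto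
    have fq: "filter (\<lambda>v. v \<in> T) q = x # filter (\<lambda>v. v \<in> T) ys" "filter (\<lambda>v. v \<notin> T) q = y # filter (\<lambda>v. v \<notin> T) ys"
      using "3.prems"(4,5) True y by auto
    then obtain x' q1 where q1: "q = x' # q1" by (cases q) auto
    have "x' \<in> T"
    proof (rule ccontr)
      assume x': "x' \<notin> T"
      then have "x' = y" using fq(2) q1 by simp
      moreover have "x' \<notin> L" using "3.prems"(3) x' q1 by (cases q1) auto
      ultimately show False using y by simp
    qed
    then have x'x: "x' = x" using fq(1) q1 by simp
    obtain y' q2 where q2: "q1 = y' # q2" "y' \<in> L" "linked L T q2"
      using "3.prems"(3) q1 \<open>x' \<in> T\<close> by (cases q1) auto
    then have "y' \<notin> T" using disj by auto
    then have "y' = y" using fq(2) q1 q2 \<open>x' \<in> T\<close> by simp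
    moreover have "ys = q2"
      by (rule "3.IH"(1)[OF True disj y(3) q2(3)])
        (use fq q1 q2 \<open>x' \<in> T\<close> \<open>y' \<notin> T\<close> in auto)
    ultimately show ?thesis using q1 q2 x'x by simp
  next
    case False
    then have x: "x \<notin> L" "linked L T (y # ys)" using "3.prems"(2) by auto
    have fq: "filter (\<lambda>v. v \<in> T) q = filter (\<lambda>v. v \<in> T) (y # ys)" "filter (\<lambda>v. v \<notin> T) q = x # filter (\<lambda>v. v \<notin> T) (y # ys)"
      using "3.prems"(4,5) False by auto
    then obtain x' q1 where q1: "q = x' # q1" by (cases q) auto
    have x': "x' \<notin> T"
    proof
      assume "x' \<in> T"
      then obtain y' q2 where q2: "q1 = y' # q2" "y' \<in> L"
        using "3.prems"(3) q1 by (cases q1) auto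
      then have "y' \<notin> T" using disj by auto
      then have "y' = x" using fq(2) q1 q2 \<open>x' \<in> T\<close> by simp
      then show False using q2 x by simp
    qed
    then have "x' = x" using fq(2) q1 by simp
    moreover have "linked L T q1" using "3.prems"(3) q1 x' by (cases q1) auto
    then have "y # ys = q1"
      by (rule "3.IH"(2)[OF False disj x(2)]) (use fq q1 x' in auto)
    ultimately show ?thesis using q1 by simp
  qed
qed

lemma linked_top:
  assumes "L \<inter> T = {}" "linked L T (pre @ v # post)" "v \<in> T"
  shows "\<exists>y post'. post = y # post' \<and> y \<in> L \<and> y < v"
  using assms
proof (induction "length pre" arbitrary: pre rule: less_induct)
  case less
  consider "pre = []" | x where "pre = [x]" | x y zs where "pre = x # y # zs"
    by (meson remdups_adj.cases)
  then show ?case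
  proof cases
    case 1
    then show ?thesis using less.prems by (cases post) auto
  next
    case 2
    then show ?thesis using less.prems by (cases post) (auto split: if_splits)
  next
    case 3
    show ?thesis
    proof (cases "x \<in> T")
      case True
      then show ?thesis using less.hyps[of zs] less.prems 3 by auto
    next
      case False
      then show ?thesis using less.hyps[of "y # zs"] less.prems 3 by auto
    qed
  qed
qed

text \<open>Before an entry outside \<open>T\<close> every top has already met its bottom, except that the bottom may be this
entry itself.\<close>

lemma linked_count:
  assumes "L \<inter> T = {}" "linked L T (pre @ v # post)" "v \<notin> T"
  shows "length (filter (\<lambda>u. u \<in> T) pre) = length (filter (\<lambda>u. u \<in> L) pre) + (if v \<in> L then 1 else 0)
    \<and> (v \<in> L \<longrightarrow> pre \<noteq> [] \<and> last pre \<in> T \<and> v < last pre)"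
  using assms
proof (induction "length pre" arbitrary: pre rule: less_induct)
  case less
  consider "pre = []" | x where "pre = [x]" | x y zs where "pre = x # y # zs"
    by (meson remdups_adj.cases)
  then show ?case
  proof cases
    case 1
    then show ?thesis using less.prems by (cases post) auto
  next
    case 2
    then show ?thesis using less.prems by (cases post) (auto split: if_splits)
  next
    case 3
    show ?thesis
    proof (cases "x \<in> T")
      case True
      then have y: "y \<in> L" "x \<notin> L" "y \<notin> T" "linked L T (zs @ v # post)" using less.prems 3 by auto
      then have IH: "length (filter (\<lambda>u. u \<in> T) zs) = length (filter (\<lambda>u. u \<in> L) zs) + (if v \<in> L then 1 else 0)
        \<and> (v \<in> L \<longrightarrow> zs \<noteq> [] \<and> last zs \<in> T \<and> v < last zs)"
        using less.hyps[of zs] less.prems 3 by simp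
      then show ?thesis using 3 y True by auto
    next
      case False
      then have y: "x \<notin> L" "linked L T ((y # zs) @ v # post)" using less.prems 3 by auto
      then have IH: "length (filter (\<lambda>u. u \<in> T) (y # zs)) = length (filter (\<lambda>u. u \<in> L) (y # zs)) + (if v \<in> L then 1 else 0)
        \<and> (v \<in> L \<longrightarrow> y # zs \<noteq> [] \<and> last (y # zs) \<in> T \<and> v < last (y # zs))"
        using less.hyps[of "y # zs"] less.prems 3 by simp
      then show ?thesis using 3 y(1) False by auto
    qed
  qed
qed

lemma linked_counts_le:
  assumes "L \<inter> T = {}" "linked L T p"
  shows "length (filter (\<lambda>u. u \<in> T) p) = length (filter (\<lambda>u. u \<in> L) p) \<and>
    length (filter (\<lambda>u. u \<in> T \<and> u < v) p) \<le> length (filter (\<lambda>u. u \<in> L \<and> u < v) p)"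
  using assms
proof (induction L T p rule: linked.induct)
  case (3 L T x y ys)
  show ?case
  proof (cases "x \<in> T")
    case True
    then have "y \<in> L" "x \<notin> L" "y \<notin> T" "y < x" using "3.prems" by auto
    then show ?thesis using "3.IH"(1)[OF True] "3.prems" True by auto
  next
    case False
    then have "x \<notin> L" "linked L T (y # ys)" using "3.prems" by auto
    then show ?thesis using "3.IH"(2)[OF False "3.prems"(1)] False by simp
  qed
qed auto

lemma length_filter_distinct: "distinct p \<Longrightarrow> length (filter P p) = card {v \<in> set p. P v}"
  using distinct_card[of "filter P p"] by simp

lemma codesD:
  assumes "codes n L T p"
  shows "set p = {1..n}" "distinct p" "length p = n" "L \<subseteq> {1..n}" "T \<subseteq> {1..n}" "L \<inter> T = {}" "finite L" "finite T"
    "sorted_wrt (<) (filter (\<lambda>v. v \<in> T) p)" "sorted_wrt (<) (filter (\<lambda>v. v \<notin> T) p)" "linked L T p"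
proof -
  have p: "p \<in> permutations_of_set {1..n}" and LT: "L \<subseteq> {1..n}" "T \<subseteq> {1..n}" using assms by (auto simp: codes_def)
  show "set p = {1..n}" "distinct p" using p by (auto simp: permutations_of_set_def)
  then show "length p = n" using distinct_card[of p] by simp
  show "finite L" "finite T" using LT finite_subset by blast+
  show "L \<subseteq> {1..n}" "T \<subseteq> {1..n}" "L \<inter> T = {}"
    "sorted_wrt (<) (filter (\<lambda>v. v \<in> T) p)" "sorted_wrt (<) (filter (\<lambda>v. v \<notin> T) p)" "linked L T p"
    using assms unfolding codes_def by blast+
qed

text \<open>Each top is paired with a smaller bottom.\<close>

lemma codes_card_dominates:
  assumes "codes n L T p"
  shows "card L = card T" "dominates L T"
proof -
  note C = codesD[OF assms]
  have sub: "{v \<in> set p. v \<in> T} = T" "{v \<in> set p. v \<in> L} = L" using C(1,4,5) by auto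
  show "card L = card T"
    using linked_counts_le[OF C(6,11)] by (simp add: length_filter_distinct[OF C(2)] sub)
  have "{u \<in> set p. u \<in> T \<and> u < v} = {z \<in> T. z < v}" "{u \<in> set p. u \<in> L \<and> u < v} = {z \<in> L. z < v}" for v
    using C(1,4,5) by auto
  then show "dominates L T"
    using linked_counts_le[OF C(6,11)]
    by (simp add: dominates_def below_def length_filter_distinct[OF C(2)])
qed

lemma codes_unique:
  assumes "codes n L T p" "codes n L T q"
  shows "p = q"
proof (rule linked_unique[OF codesD(6)[OF assms(1)] codesD(11)[OF assms(1)] codesD(11)[OF assms(2)]])
  note P = codesD[OF assms(1)] and Q = codesD[OF assms(2)]
  have "filter R p = filter R q" if "sorted_wrt (<) (filter R p)" "sorted_wrt (<) (filter R q)" for R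
    using sorted_list_of_set_eqI[OF that(1) refl] sorted_list_of_set_eqI[OF that(2) refl] P(1) Q(1) by simp
  then show "filter (\<lambda>v. v \<in> T) p = filter (\<lambda>v. v \<in> T) q" "filter (\<lambda>v. v \<notin> T) p = filter (\<lambda>v. v \<notin> T) q"
    using P(9,10) Q(9,10) by auto
qed

text \<open>An entry outside \<open>T\<close> is preceded by exactly the smaller entries outside \<open>T\<close> and by an initial segment
of \<open>T\<close> of known size.\<close>

lemma codes_prefix:
  assumes c: "codes n L T p" and p: "p = pre @ v # post" and v: "v \<notin> T"
  shows "set pre - T = {u \<in> {1..n} - T. u < v}"
    "card (set pre \<inter> T) = below L v + (if v \<in> L then 1 else 0)"
    "\<And>x y. x \<in> set pre \<inter> T \<Longrightarrow> y \<in> T \<Longrightarrow> y \<notin> set pre \<Longrightarrow> x < y"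
proof -
  note C = codesD[OF c]
  have s2: "sorted_wrt (<) (filter (\<lambda>v. v \<notin> T) pre @ v # filter (\<lambda>v. v \<notin> T) post)"
    using C(10) p v by simp
  have setp: "{1..n} = insert v (set pre \<union> set post)" using C(1) p by auto
  have dist: "distinct pre" "v \<notin> set pre" "set pre \<inter> set post = {}" using C(2) p by auto
  show pre: "set pre - T = {u \<in> {1..n} - T. u < v}"
  proof (intro equalityI subsetI)
    fix u assume "u \<in> set pre - T"
    then show "u \<in> {u \<in> {1..n} - T. u < v}" using s2 setp by (auto simp: sorted_wrt_append)
  next
    fix u assume u: "u \<in> {u \<in> {1..n} - T. u < v}"
    then have "u \<in> set pre \<or> u \<in> set post" using setp by auto
    moreover have "\<not> u < v" if "u \<in> set post"
      using s2 that u by (auto simp: sorted_wrt_append)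
    ultimately show "u \<in> set pre - T" using u by auto
  qed
  have L: "set pre \<inter> L = {z \<in> L. z < v}"
  proof -
    have "u \<in> set pre \<longleftrightarrow> u < v" if "u \<in> L" for u using pre that C(4,6) by blast
    then show ?thesis by auto
  qed
  have "length (filter (\<lambda>u. u \<in> T) pre) = length (filter (\<lambda>u. u \<in> L) pre) + (if v \<in> L then 1 else 0)"
    using linked_count[of L T pre v post] C(6,11) p v by simp
  moreover have "length (filter (\<lambda>u. u \<in> T) pre) = card (set pre \<inter> T)"
    "length (filter (\<lambda>u. u \<in> L) pre) = card (set pre \<inter> L)"
    using dist by (simp_all add: length_filter_distinct Int_def)
  ultimately show "card (set pre \<inter> T) = below L v + (if v \<in> L then 1 else 0)"
    unfolding L below_def by simp
  have s1: "sorted_wrt (<) (filter (\<lambda>v. v \<in> T) pre @ filter (\<lambda>v. v \<in> T) post)"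
    using C(9) p v by simp
  show "x < y" if "x \<in> set pre \<inter> T" "y \<in> T" "y \<notin> set pre" for x y
  proof -
    have "y \<in> set post" using that setp C(5) v by auto
    then show ?thesis using s1 that by (auto simp: sorted_wrt_append)
  qed
qed

lemma card_interval_split:
  assumes "v \<in> {1..n}" "T \<subseteq> {1..n}"
  shows "card {u \<in> {1..n} - T. u < v} + below T v = v - 1"
proof -
  have "{u \<in> {1..n} - T. u < v} \<union> {z \<in> T. z < v} = {1..<v}" using assms by auto
  moreover have "{u \<in> {1..n} - T. u < v} \<inter> {z \<in> T. z < v} = {}" by auto
  moreover have "finite {u \<in> {1..n} - T. u < v}" "finite {z \<in> T. z < v}" by auto
  ultimately have "card {1..<v} = card {u \<in> {1..n} - T. u < v} + card {z \<in> T. z < v}"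
    by (metis card_Un_disjoint)
  then show ?thesis by (simp add: below_def)
qed

lemma codes_position:
  assumes c: "codes n L T p" and p: "p = pre @ v # post" and v: "v \<notin> T"
  shows "length pre + below T v = v - 1 + below L v + (if v \<in> L then 1 else 0)"
proof -
  note C = codesD[OF c]
  have v1: "v \<in> {1..n}" unfolding C(1)[symmetric] p by simp
  have "length pre = card (set pre)" using C(2) p by (simp add: distinct_card)
  also have "set pre = (set pre - T) \<union> (set pre \<inter> T)" by auto
  also have "card \<dots> = card (set pre - T) + card (set pre \<inter> T)"
    by (rule card_Un_disjoint) auto
  finally show ?thesis
    using codes_prefix(1,2)[OF c p v] card_interval_split[OF v1 C(5)] by simp
qed

text \<open>By the position formula, an entry \<open>v\<close> outside \<open>T\<close> and \<open>L\<close> is displaced from position \<open>v\<close> by the height of the path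
before step \<open>v\<close>.\<close>

lemma codes_fixed_iff:
  assumes c: "codes n L T p" and p: "p = pre @ v # post" and v: "v \<notin> T"
  shows "v = Suc (length pre) \<longleftrightarrow> v \<notin> L \<and> below L v = below T v"
proof -
  have "v \<ge> 1" using codesD(1)[OF c] p by auto
  moreover have "below T v \<le> below L v" using codes_card_dominates(2)[OF c] by (simp add: dominates_def)
  ultimately show ?thesis using codes_position[OF c p v] by (cases "v \<in> L") auto
qed

text \<open>The tops before \<open>v\<close> form an initial segment of \<open>T\<close>, and there are at least as many of them as tops
smaller than \<open>v\<close>.  So they are all smaller than \<open>v\<close> only if the two numbers agree.\<close>

lemma codes_max_iff:
  assumes c: "codes n L T p" and p: "p = pre @ v # post" and v: "v \<notin> T"
  shows "(\<forall>u\<in>set pre. u < v) \<longleftrightarrow> v \<notin> L \<and> below L v = below T v"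
proof -
  note C = codesD[OF c]
  have dom: "below T v \<le> below L v" using codes_card_dominates(2)[OF c] by (simp add: dominates_def)
  have fin: "finite {z \<in> T. z < v}" using C(8) by simp
  have seg: "set pre \<inter> T \<subseteq> {z \<in> T. z < v} \<or> {z \<in> T. z < v} \<subseteq> set pre \<inter> T"
    using codes_prefix(3)[OF c p v] by fastforce
  show ?thesis
  proof
    assume lt: "\<forall>u\<in>set pre. u < v"
    then have "set pre \<inter> T \<subseteq> {z \<in> T. z < v}" by auto
    then have "card (set pre \<inter> T) \<le> below T v" unfolding below_def by (rule card_mono[OF fin])
    then show "v \<notin> L \<and> below L v = below T v"
      using codes_prefix(2)[OF c p v] dom by (auto split: if_splits)
  next
    assume A: "v \<notin> L \<and> below L v = below T v"
    then have "card (set pre \<inter> T) = card {z \<in> T. z < v}"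
      using codes_prefix(2)[OF c p v] by (simp add: below_def)
    then have "set pre \<inter> T = {z \<in> T. z < v}"
      using seg card_subset_eq[OF fin] card_subset_eq[of "set pre \<inter> T"] by auto
    then show "\<forall>u\<in>set pre. u < v" using codes_prefix(1)[OF c p v] by blast
  qed
qed

lemma codes_top:
  assumes c: "codes n L T p" and p: "p = pre @ v # post" and v: "v \<in> T"
  shows "\<forall>u\<in>set pre. u < v" "v \<noteq> Suc (length pre)" "\<exists>y post'. post = y # post' \<and> y \<in> L \<and> y < v"
proof -
  note C = codesD[OF c]
  show ex: "\<exists>y post'. post = y # post' \<and> y \<in> L \<and> y < v"
    using linked_top[of L T pre v post] C(6,11) p v by simp
  then obtain y post' where y: "post = y # post'" "y \<in> L" "y < v" by blast
  have yT: "y \<notin> T" using y(2) C(6) by auto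
  have py: "p = (pre @ [v]) @ y # post'" using p y by simp
  have s1: "sorted_wrt (<) (filter (\<lambda>v. v \<in> T) pre @ v # filter (\<lambda>v. v \<in> T) post)"
    using C(9) p v by simp
  show lt: "\<forall>u\<in>set pre. u < v"
  proof
    fix u assume u: "u \<in> set pre"
    show "u < v"
    proof (cases "u \<in> T")
      case True
      then show ?thesis using s1 u by (auto simp: sorted_wrt_append)
    next
      case False
      then have "u \<in> set (pre @ [v]) - T" using u by simp
      then have "u < y" unfolding codes_prefix(1)[OF c py yT] by simp
      then show ?thesis using y by simp
    qed
  qed
  show "v \<noteq> Suc (length pre)"
  proof
    assume eq: "v = Suc (length pre)"
    have d: "distinct pre" "y \<notin> set pre" using C(2) py by auto
    have "insert y (set pre) \<subseteq> {1..<v}" using lt y C(1) p by auto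
    then have "card (insert y (set pre)) \<le> card {1..<v}" by (rule card_mono[rotated]) simp
    then show False using d eq by (simp add: distinct_card)
  qed
qed

lemma nth_split: "i < length p \<Longrightarrow> p = take i p @ p ! i # drop (Suc i) p"
  by (rule id_take_nth_drop)

lemma LR_max_at_iff: "LR_max_at p i \<longleftrightarrow> i < length p \<and> (\<forall>u\<in>set (take i p). u < p ! i)"
proof (cases "i < length p")
  case True
  then have "set (take i p) = (!) p ` {0..<i}" by (simp add: nth_image)
  then show ?thesis by (auto simp: LR_max_at_def)
qed (simp add: LR_max_at_def)

lemma codes_LR_max_iff:
  assumes c: "codes n L T p" and i: "i < length p"
  shows "LR_max_at p i \<longleftrightarrow> p ! i \<in> T \<or> fixed_point_at p i"
    "p ! i \<in> T \<Longrightarrow> \<not> fixed_point_at p i"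
    "fixed_point_at p i \<longleftrightarrow> p ! i \<notin> T \<and> p ! i \<notin> L \<and> below L (p ! i) = below T (p ! i)"
proof -
  note split = nth_split[OF i]
  have len: "length (take i p) = i" using i by simp
  show T: "p ! i \<in> T \<Longrightarrow> \<not> fixed_point_at p i"
    using codes_top(2)[OF c split] len by (simp add: fixed_point_at_def)
  show "fixed_point_at p i \<longleftrightarrow> p ! i \<notin> T \<and> p ! i \<notin> L \<and> below L (p ! i) = below T (p ! i)"
    using T codes_fixed_iff[OF c split] len i unfolding fixed_point_at_def by auto
  then show "LR_max_at p i \<longleftrightarrow> p ! i \<in> T \<or> fixed_point_at p i"
    using codes_max_iff[OF c split] codes_top(1)[OF c split] i unfolding LR_max_at_iff by auto
qed

lemma codes_next:
  assumes c: "codes n L T p" and i: "i < length p" "p ! i \<in> T"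
  shows "Suc i < length p" "p ! Suc i \<in> L" "p ! Suc i < p ! i"
proof -
  obtain y post' where y: "drop (Suc i) p = y # post'" "y \<in> L" "y < p ! i"
    using codes_top(3)[OF c nth_split[OF i(1)] i(2)] by blast
  then show "Suc i < length p" by (metis drop_all list.distinct(1) not_le)
  then have "p ! Suc i = y" using y(1) by (metis nth_Cons_0 Cons_nth_drop_Suc list.inject)
  then show "p ! Suc i \<in> L" "p ! Suc i < p ! i" using y by simp_all
qed

lemma codes_prev:
  assumes c: "codes n L T p" and i: "i < length p" "p ! i \<in> L"
  obtains j where "i = Suc j" "p ! j \<in> T"
proof -
  note C = codesD[OF c]
  have "p ! i \<notin> T" using i(2) C(6) by auto
  then have l: "take i p \<noteq> [] \<and> last (take i p) \<in> T"
    using linked_count[of L T "take i p" "p ! i" "drop (Suc i) p"] C(6,11) i nth_split[OF i(1)] by simp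
  then obtain j where j: "i = Suc j" by (cases i) auto
  then have "last (take i p) = p ! j" using i(1) by (simp add: take_Suc_conv_app_nth)
  then show thesis using that j l by simp
qed

lemma codes_sets:
  assumes c: "codes n L T p"
  shows "D_set p = T" "U_set p = L"
proof -
  note C = codesD[OF c]
  show D: "D_set p = T"
  proof (intro equalityI subsetI)
    fix v assume "v \<in> D_set p"
    then obtain i where "v = p ! i" "LR_max_at p i" "\<not> fixed_point_at p i" by (auto simp: D_set_def)
    then show "v \<in> T" using codes_LR_max_iff(1)[OF c, of i] by (auto simp: LR_max_at_def)
  next
    fix v assume v: "v \<in> T"
    then have "v \<in> set p" using C by auto
    then obtain i where "i < length p" "p ! i = v" by (auto simp: in_set_conv_nth)
    then show "v \<in> D_set p" using codes_LR_max_iff[OF c, of i] v unfolding D_set_def by blast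
  qed
  show "U_set p = L"
  proof (intro equalityI subsetI)
    fix v assume "v \<in> U_set p"
    then obtain i where "v = p ! Suc i" "Suc i < length p" "p ! i \<in> T" by (auto simp: U_set_def D)
    then show "v \<in> L" using codes_next[OF c, of i] by simp
  next
    fix v assume v: "v \<in> L"
    then have "v \<in> set p" using C by auto
    then obtain i where i: "i < length p" "p ! i = v" by (auto simp: in_set_conv_nth)
    then obtain j where "i = Suc j" "p ! j \<in> T" using codes_prev[OF c i(1)] v by auto
    then show "v \<in> U_set p" using i unfolding U_set_def D by blast
  qed
qed

lemma codes_sorted_classes:
  assumes c: "codes n L T p" and ij: "i < j" "j < length p" "(p ! i \<in> T) = (p ! j \<in> T)"
  shows "p ! i < p ! j"
proof -
  have j': "j - Suc i < length (drop (Suc i) p)" using ij by simp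
  have "drop (Suc i) p ! (j - Suc i) = p ! j" using ij by simp
  then have "p ! j \<in> set (drop (Suc i) p)" using j' by (metis nth_mem)
  moreover have "sorted_wrt (<) (filter P (take i p) @ filter P (p ! i # drop (Suc i) p))"
    if "sorted_wrt (<) (filter P p)" for P
    using that nth_split[of i p] ij by (metis filter_append less_trans)
  ultimately show ?thesis
    using codesD(9,10)[OF c] ij(3) by (cases "p ! i \<in> T") (force simp: sorted_wrt_append)+
qed

lemma codes_Motzkin:
  assumes c: "codes n L T p"
  shows "p \<in> Motzkin_perms n"
proof -
  have "avoids_321 p"
    unfolding avoids_321_def
  proof
    assume "\<exists>i j k. i < j \<and> j < k \<and> k < length p \<and> p ! i > p ! j \<and> p ! j > p ! k"
    then obtain i j k where ijk: "i < j" "j < k" "k < length p" "p ! i > p ! j" "p ! j > p ! k" by blast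
    have "(p ! i \<in> T) \<noteq> (p ! j \<in> T)" using codes_sorted_classes[OF c, of i j] ijk by auto
    moreover have "(p ! j \<in> T) \<noteq> (p ! k \<in> T)" using codes_sorted_classes[OF c, of j k] ijk by auto
    moreover have "(p ! i \<in> T) \<noteq> (p ! k \<in> T)" using codes_sorted_classes[OF c, of i k] ijk by auto
    ultimately show False by blast
  qed
  moreover have "descent_at p i \<or> fixed_point_at p i" if "LR_max_at p i" for i
  proof -
    have i: "i < length p" using that by (simp add: LR_max_at_def)
    then have "p ! i \<in> T \<or> fixed_point_at p i" using codes_LR_max_iff(1)[OF c i] that by simp
    then show ?thesis using codes_next[OF c i] by (auto simp: descent_at_def)
  qed
  ultimately show ?thesis using c by (simp add: Motzkin_perms_def codes_def)
qed

text \<open>Avoiding 321 makes the entries that are not left-to-right maxima increase, and a left-to-right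
maximum that is a fixed point separates smaller from larger entries.  So all entries outside \<open>D_set p\<close>
increase.\<close>

lemma Motzkin_codes:
  assumes "p \<in> Motzkin_perms n"
  shows "codes n (U_set p) (D_set p) p"
proof -
  have perm: "p \<in> permutations_of_set {1..n}" and av: "avoids_321 p"
    and mx: "\<And>i. LR_max_at p i \<Longrightarrow> descent_at p i \<or> fixed_point_at p i"
    using assms by (auto simp: Motzkin_perms_def)
  have set_p: "set p = {1..n}" and dist: "distinct p" using perm by (auto simp: permutations_of_set_def)
  have Dnth: "p ! i \<in> D_set p \<longleftrightarrow> LR_max_at p i \<and> \<not> fixed_point_at p i" if "i < length p" for i
    using that dist unfolding D_set_def LR_max_at_def fixed_point_at_def by (auto simp: nth_eq_iff_index_eq)
  have Dnext: "Suc i < length p \<and> p ! Suc i \<in> U_set p \<and> p ! Suc i < p ! i" if "i < length p" "p ! i \<in> D_set p" for i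
    using Dnth that mx[of i] unfolding U_set_def descent_at_def by blast
  have Uprev: "\<exists>j. i = Suc j \<and> p ! j \<in> D_set p" if i: "i < length p" "p ! i \<in> U_set p" for i
  proof -
    obtain j where j: "p ! i = p ! Suc j" "Suc j < length p" "p ! j \<in> D_set p"
      using i(2) unfolding U_set_def by blast
    then have "i = Suc j" using dist i(1) by (simp add: nth_eq_iff_index_eq)
    then show ?thesis using j by blast
  qed
  have sub: "D_set p \<subseteq> {1..n}" "U_set p \<subseteq> {1..n}"
    unfolding set_p[symmetric] D_set_def U_set_def LR_max_at_def by auto
  have disj: "U_set p \<inter> D_set p = {}"
  proof (rule ccontr)
    assume "\<not> ?thesis"
    then obtain v where v: "v \<in> U_set p" "v \<in> D_set p" by blast
    then have "v \<in> set p" using sub set_p by auto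
    then obtain i where i: "i < length p" "p ! i = v" by (auto simp: in_set_conv_nth)
    obtain j where j: "i = Suc j" "p ! j \<in> D_set p" using Uprev[OF i(1)] i v by auto
    then have "p ! i < p ! j" using Dnext[of j] i by auto
    moreover have "LR_max_at p i" using Dnth[OF i(1)] i v by simp
    ultimately show False using j by (auto simp: LR_max_at_def dest: spec[of _ j])
  qed
  have lr_less: "p ! i < p ! j" if "i < j" "LR_max_at p j" for i j
    using that by (simp add: LR_max_at_def)
  have fixed_less: "p ! i < p ! j" if ij: "i < j" "j < length p" and f: "LR_max_at p i" "fixed_point_at p i" for i j
  proof -
    have eq: "p ! i = Suc i" using f by (simp add: fixed_point_at_def)
    have "set (take (Suc i) p) \<subseteq> {1..Suc i}"
    proof
      fix u assume "u \<in> set (take (Suc i) p)"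
      then obtain h where "h < Suc i" and h: "u = p ! h" "h < length p" by (auto simp: in_set_conv_nth)
      then have "h \<le> i" by simp
      then have "u \<le> Suc i" using lr_less[of h i] f(1) eq h(1) by (cases "h = i") auto
      moreover have "u \<in> {1..n}" using h set_p nth_mem by blast
      ultimately show "u \<in> {1..Suc i}" by auto
    qed
    moreover have "card (set (take (Suc i) p)) = Suc i"
      using ij dist by (subst distinct_card) auto
    ultimately have full: "set (take (Suc i) p) = {1..Suc i}" by (intro card_subset_eq) auto
    have "p ! j \<notin> set (take (Suc i) p)"
      using ij dist by (auto simp: in_set_conv_nth nth_eq_iff_index_eq)
    moreover have "p ! j \<in> {1..n}" using ij set_p nth_mem by blast
    ultimately show ?thesis using full eq by auto
  qed
  have nonD: "p ! i < p ! j" if ij: "i < j" "j < length p" and nD: "p ! i \<notin> D_set p" "p ! j \<notin> D_set p" for i j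
  proof (cases "LR_max_at p j")
    case True
    then show ?thesis using lr_less ij by blast
  next
    case False
    show ?thesis
    proof (cases "LR_max_at p i")
      case True
      then have "fixed_point_at p i" using Dnth[of i] nD ij by auto
      then show ?thesis using fixed_less ij True by blast
    next
      case False
      then obtain h where h: "h < i" "\<not> p ! h < p ! i" using ij by (auto simp: LR_max_at_def)
      have "p ! h \<noteq> p ! i" "p ! i \<noteq> p ! j" using h ij dist by (auto simp: nth_eq_iff_index_eq)
      moreover have "\<not> (p ! h > p ! i \<and> p ! i > p ! j)" using av h ij unfolding avoids_321_def by blast
      ultimately show ?thesis using h by auto
    qed
  qed
  have "sorted_wrt (\<lambda>u w. (u \<in> D_set p) = (w \<in> D_set p) \<longrightarrow> u < w) p"
    unfolding sorted_wrt_iff_nth_less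
  proof (intro allI impI)
    fix i j assume ij: "i < j" "j < length p" "(p ! i \<in> D_set p) = (p ! j \<in> D_set p)"
    show "p ! i < p ! j"
    proof (cases "p ! j \<in> D_set p")
      case True
      then show ?thesis using Dnth lr_less ij by blast
    next
      case False
      then show ?thesis using nonD ij by blast
    qed
  qed
  then have s: "sorted_wrt (\<lambda>u w. (u \<in> D_set p) = (w \<in> D_set p) \<longrightarrow> u < w) (filter P p)" for P
    by (rule sorted_wrt_filter)
  have "sorted_wrt (<) (filter (\<lambda>v. v \<in> D_set p) p)" "sorted_wrt (<) (filter (\<lambda>v. v \<notin> D_set p) p)"
    by (rule sorted_wrt_mono_rel[OF _ s]; simp)+
  moreover have "linked (U_set p) (D_set p) p"
    by (rule linked_of_nth[OF disj Dnext Uprev])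
  ultimately show ?thesis using perm sub disj unfolding codes_def by blast
qed

fun merge_tops :: "nat set \<Rightarrow> nat list \<Rightarrow> nat list \<Rightarrow> nat list" where
  "merge_tops L ds [] = []"
| "merge_tops L ds (r # rs) =
     (if r \<in> L then hd ds # r # merge_tops L (tl ds) rs else r # merge_tops L ds rs)"

lemma merge_tops:
  assumes "list_all2 (<) (filter (\<lambda>v. v \<in> L) rs) ds" "set ds \<subseteq> T" "set rs \<inter> T = {}"
  shows "filter (\<lambda>v. v \<in> T) (merge_tops L ds rs) = ds \<and> filter (\<lambda>v. v \<notin> T) (merge_tops L ds rs) = rs \<and>
    linked L T (merge_tops L ds rs)"
  using assms
proof (induction rs arbitrary: ds)
  case (Cons r rs)
  show ?case
  proof (cases "r \<in> L")
    case True
    then obtain d ds' where ds: "ds = d # ds'" "r < d" "list_all2 (<) (filter (\<lambda>v. v \<in> L) rs) ds'"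
      using Cons.prems(1) by (auto simp: list_all2_Cons1)
    then show ?thesis using Cons.IH[of ds'] Cons.prems True by auto
  next
    case False
    then have IH: "filter (\<lambda>v. v \<in> T) (merge_tops L ds rs) = ds" "filter (\<lambda>v. v \<notin> T) (merge_tops L ds rs) = rs"
      "linked L T (merge_tops L ds rs)"
      using Cons.IH[of ds] Cons.prems by auto
    moreover have "linked L T (r # merge_tops L ds rs)"
      using IH(3) False Cons.prems(3) by (cases "merge_tops L ds rs") auto
    ultimately show ?thesis using False Cons.prems(3) by simp
  qed
qed simp

text \<open>Dominance and equal size say that the \<open>j\<close>-th top exceeds the \<open>j\<close>-th bottom, so placing the tops in
increasing order before the bottoms creates descents.\<close>

lemma codes_exists:
  assumes L: "L \<subseteq> {1..n}" and T: "T \<subseteq> {1..n}" and disj: "L \<inter> T = {}" and dom: "dominates L T" and card: "card L = card T"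
  shows "\<exists>p. codes n L T p"
proof -
  let ?rs = "sorted_list_of_set ({1..n} - T)" and ?ds = "sorted_list_of_set T"
  let ?p = "merge_tops L ?ds ?rs"
  have fin: "finite L" "finite T" using L T finite_subset by blast+
  have fl: "filter (\<lambda>v. v \<in> L) ?rs = sorted_list_of_set L"
    by (rule sorted_list_of_set_eqI[symmetric]) (use L disj in \<open>auto intro: sorted_wrt_filter\<close>)
  have "list_all2 (<) (sorted_list_of_set L) ?ds"
    using dominates_iff_columns[of "sorted_list_of_set L" ?ds] fin dom disj card
    by (simp add: list_all2_conv_all_nth)
  then have M: "filter (\<lambda>v. v \<in> T) ?p = ?ds" "filter (\<lambda>v. v \<notin> T) ?p = ?rs" "linked L T ?p"
    using merge_tops[of L ?rs ?ds T] fl fin by auto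
  have "set ?p = set (filter (\<lambda>v. v \<in> T) ?p) \<union> set (filter (\<lambda>v. v \<notin> T) ?p)" by auto
  then have set_p: "set ?p = {1..n}" unfolding M(1,2) using fin T by auto
  have "length ?p = length (filter (\<lambda>v. v \<in> T) ?p) + length (filter (\<lambda>v. \<not> v \<in> T) ?p)"
    by (simp only: sum_length_filter_compl)
  also have "\<dots> = card T + card ({1..n} - T)" using M by simp
  also have "\<dots> = n" using T fin card_mono[OF _ T] by (simp add: card_Diff_subset)
  finally have "distinct ?p" using set_p by (intro card_distinct) simp
  then have "?p \<in> permutations_of_set {1..n}" using set_p by (simp add: permutations_of_set_def)
  then have "codes n L T ?p"
    unfolding codes_def M(1,2) using M(3) L T disj by simp
  then show ?thesis by blast
qed

section \<open>Motzkin paths\<close>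

text \<open>The path whose up steps and down steps are at the places in \<open>L\<close> and \<open>T\<close>.\<close>

definition word :: "nat \<Rightarrow> nat set \<Rightarrow> nat set \<Rightarrow> step list" where
  "word n L T = map (\<lambda>v. if v \<in> T then D else if v \<in> L then U else H) [1..<Suc n]"

lemma length_word [simp]: "length (word n L T) = n"
  by (simp add: word_def)

lemma word_nth: "i < n \<Longrightarrow> word n L T ! i = (if Suc i \<in> T then D else if Suc i \<in> L then U else H)"
  by (simp add: word_def del: upt_Suc)

lemma height_append: "height (u @ w) = height u + height w"
  by (simp add: height_def)

lemma height_take_word:
  assumes LT: "L \<subseteq> {1..n}" "T \<subseteq> {1..n}" "L \<inter> T = {}" and "k \<le> n"
  shows "height (take k (word n L T)) = int (below L (Suc k)) - int (below T (Suc k))"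
  using assms(4)
proof (induction k)
  case 0
  have "finite L" "finite T" using LT finite_subset by blast+
  moreover have "0 \<notin> L" "0 \<notin> T" using LT by auto
  ultimately show ?case by (simp add: height_def below_Suc) (simp add: below_def)
next
  case (Suc k)
  have fin: "finite L" "finite T" using LT finite_subset by blast+
  have "take (Suc k) (word n L T) = take k (word n L T) @ [word n L T ! k]"
    using Suc.prems by (simp add: take_Suc_conv_app_nth)
  then have "height (take (Suc k) (word n L T)) = height (take k (word n L T)) + rise (word n L T ! k)"
    by (simp add: height_append) (simp add: height_def)
  then show ?case
    using Suc LT(3) by (auto simp: word_nth below_Suc[OF fin(1), of "Suc k"] below_Suc[OF fin(2), of "Suc k"])
qed

lemma word_Motzkin_iff:
  assumes LT: "L \<subseteq> {1..n}" "T \<subseteq> {1..n}" "L \<inter> T = {}"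
  shows "word n L T \<in> Motzkin_paths n \<longleftrightarrow> dominates L T \<and> card L = card T"
proof -
  have fin: "finite L" "finite T" using LT finite_subset by blast+
  have full: "below L v = card L" "below T v = card T" if "n < v" for v
    using LT that by (auto intro!: below_eq_card)
  \<comment> \<open>The path only sees the bounds \<open>1, \<dots>, n + 1\<close>; all others are trivial.\<close>
  have zero: "below L 0 = 0" "below T 0 = 0" by (simp_all add: below_def)
  have "height (word n L T) = int (card L) - int (card T)"
    using height_take_word[OF LT, of n] full[of "Suc n"] by simp
  moreover have "(\<forall>k\<le>n. height (take k (word n L T)) \<ge> 0) \<longleftrightarrow> (\<forall>k\<le>n. below T (Suc k) \<le> below L (Suc k))"
    using height_take_word[OF LT] by auto
  moreover have "dominates L T" if A: "\<forall>k\<le>n. below T (Suc k) \<le> below L (Suc k)" "card L = card T"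
    unfolding dominates_def
  proof
    fix v
    show "below T v \<le> below L v"
    proof (cases v)
      case (Suc k)
      then show ?thesis using A full[of v] by (cases "k \<le> n") auto
    qed (simp add: zero)
  qed
  ultimately show ?thesis by (auto simp: Motzkin_paths_def dominates_def)
qed

lemma word_inject:
  assumes "L \<subseteq> {1..n}" "T \<subseteq> {1..n}" "L \<inter> T = {}" "L' \<subseteq> {1..n}" "T' \<subseteq> {1..n}" "L' \<inter> T' = {}"
    and eq: "word n L T = word n L' T'"
  shows "L = L' \<and> T = T'"
proof -
  have "v \<in> L \<longleftrightarrow> v \<in> L'" "v \<in> T \<longleftrightarrow> v \<in> T'" if v: "v \<in> {1..n}" for v
  proof -
    obtain i where i: "v = Suc i" "i < n" using v by (cases v) auto
    have "word n L T ! i = word n L' T' ! i" using eq by simp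
    then have "(if v \<in> T then D else if v \<in> L then U else H) = (if v \<in> T' then D else if v \<in> L' then U else H)"
      using i by (simp only: word_nth)
    then show "v \<in> L \<longleftrightarrow> v \<in> L'" "v \<in> T \<longleftrightarrow> v \<in> T'"
      using assms(3,6) by (auto split: if_splits)
  qed
  then show ?thesis using assms by blast
qed

lemma word_surj:
  assumes "length w = n"
  obtains L T where "L \<subseteq> {1..n}" "T \<subseteq> {1..n}" "L \<inter> T = {}" "w = word n L T"
proof -
  let ?L = "{v \<in> {1..n}. w ! (v - 1) = U}" and ?T = "{v \<in> {1..n}. w ! (v - 1) = D}"
  have "w = word n ?L ?T"
  proof (rule nth_equalityI)
    fix i assume "i < length w"
    then show "w ! i = word n ?L ?T ! i" using assms by (cases "w ! i") (auto simp: word_nth)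
  qed (simp add: assms)
  moreover have "?L \<inter> ?T = {}" by auto
  ultimately show thesis using that[of ?L ?T] by blast
qed

lemma codes_alpha:
  assumes "codes n L T p"
  shows "alpha p = word n L T"
  unfolding alpha_def word_def codes_sets[OF assms] codesD(3)[OF assms] ..

lemma bij_betw_alpha: "bij_betw alpha (Motzkin_perms n) (Motzkin_paths n)"
  unfolding bij_betw_def
proof (intro conjI equalityI subsetI)
  show "inj_on alpha (Motzkin_perms n)"
  proof (rule inj_onI)
    fix p q assume pq: "p \<in> Motzkin_perms n" "q \<in> Motzkin_perms n" and eq: "alpha p = alpha q"
    note P = Motzkin_codes[OF pq(1)] and Q = Motzkin_codes[OF pq(2)]
    have "U_set p = U_set q \<and> D_set p = D_set q"
      by (rule word_inject[OF codesD(4-6)[OF P] codesD(4-6)[OF Q]])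
        (use eq codes_alpha[OF P] codes_alpha[OF Q] in simp)
    then have "codes n (U_set p) (D_set p) q" using Q by simp
    with P show "p = q" by (rule codes_unique)
  qed
next
  fix w assume "w \<in> alpha ` Motzkin_perms n"
  then obtain p where p: "p \<in> Motzkin_perms n" "w = alpha p" by blast
  note P = Motzkin_codes[OF p(1)]
  show "w \<in> Motzkin_paths n"
    unfolding p(2) codes_alpha[OF P] word_Motzkin_iff[OF codesD(4-6)[OF P]]
    using codes_card_dominates[OF P] by simp
next
  fix w assume w: "w \<in> Motzkin_paths n"
  then have "length w = n" by (simp add: Motzkin_paths_def)
  then obtain L T where LT: "L \<subseteq> {1..n}" "T \<subseteq> {1..n}" "L \<inter> T = {}" "w = word n L T"
    by (rule word_surj)
  then obtain p where p: "codes n L T p"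
    using codes_exists[OF LT(1-3)] w word_Motzkin_iff[OF LT(1-3)] by auto
  then show "w \<in> alpha ` Motzkin_perms n"
    using codes_alpha[OF p] codes_Motzkin[OF p] LT(4) by (metis image_eqI)
qed

lemma alpha_Riordan_iff:
  assumes "p \<in> Motzkin_perms n"
  shows "alpha p \<in> Riordan_paths n \<longleftrightarrow> p \<in> Riordan_perms n"
proof -
  note P = Motzkin_codes[OF assms]
  let ?L = "U_set p" and ?T = "D_set p"
  note C = codesD[OF P]
  have flat: "flat_on_axis_at (alpha p) i \<longleftrightarrow> i < n \<and> Suc i \<notin> ?T \<and> Suc i \<notin> ?L \<and> below ?L (Suc i) = below ?T (Suc i)" for i
  proof (cases "i < n")
    case True
    then show ?thesis
      unfolding flat_on_axis_at_def codes_alpha[OF P]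
      using height_take_word[OF C(4-6), of i] by (auto simp: word_nth)
  qed (simp add: flat_on_axis_at_def codes_alpha[OF P])
  have "(\<exists>i. flat_on_axis_at (alpha p) i) \<longleftrightarrow> (\<exists>i. fixed_point_at p i)"
  proof
    assume "\<exists>i. flat_on_axis_at (alpha p) i"
    then obtain i where i: "i < n" "Suc i \<notin> ?T" "Suc i \<notin> ?L" "below ?L (Suc i) = below ?T (Suc i)"
      using flat by blast
    then have "Suc i \<in> set p" using C(1) by auto
    then obtain j where "j < length p" "p ! j = Suc i" by (auto simp: in_set_conv_nth)
    then show "\<exists>i. fixed_point_at p i" using codes_LR_max_iff(3)[OF P, of j] i by auto
  next
    assume "\<exists>i. fixed_point_at p i"
    then obtain i where f: "fixed_point_at p i" by blast
    then have i: "i < length p" "p ! i = Suc i" by (auto simp: fixed_point_at_def)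
    then show "\<exists>i. flat_on_axis_at (alpha p) i" using flat[of i] codes_LR_max_iff(3)[OF P i(1)] f C(3) by auto
  qed
  moreover have "alpha p \<in> Motzkin_paths n" using bij_betw_apply[OF bij_betw_alpha assms] .
  ultimately show ?thesis using assms by (auto simp: Riordan_paths_def Riordan_perms_def)
qed

section \<open>Block starts and block ends\<close>

text \<open>Let the sorted list of \<open>R\<close> be cut into blocks whose first elements form \<open>L\<close>.  An element
ends its block if it is the last one of \<open>R\<close> or its successor in \<open>R\<close> begins the next block.\<close>

definition block_ends :: "nat set \<Rightarrow> nat set \<Rightarrow> nat set" where
  "block_ends R L = {u \<in> R. (\<forall>w\<in>R. w \<le> u) \<or> (\<exists>v\<in>L. gap R u v)}"

definition block_starts :: "nat set \<Rightarrow> nat set \<Rightarrow> nat set" where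
  "block_starts R A = {v \<in> R. (\<forall>w\<in>R. v \<le> w) \<or> (\<exists>u\<in>A. gap R u v)}"

lemma block_starts_ends:
  assumes fin: "finite R" and L: "L \<subseteq> R" and mn: "\<And>v. v \<in> R \<Longrightarrow> \<forall>w\<in>R. v \<le> w \<Longrightarrow> v \<in> L"
  shows "block_starts R (block_ends R L) = L"
proof (intro equalityI subsetI)
  fix v assume v: "v \<in> block_starts R (block_ends R L)"
  then have vR: "v \<in> R" by (simp add: block_starts_def)
  show "v \<in> L"
  proof (cases "\<forall>w\<in>R. v \<le> w")
    case True
    then show ?thesis using mn vR by blast
  next
    case False
    then obtain u where u: "u \<in> block_ends R L" "gap R u v" using v by (auto simp: block_starts_def)
    then have "u < v" by (simp add: gap_def)
    then have "\<not> (\<forall>w\<in>R. w \<le> u)" using vR by (metis not_le)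
    then obtain v' where "v' \<in> L" "gap R u v'" using u(1) by (auto simp: block_ends_def)
    then show ?thesis using gap_unique_up[OF u(2)] vR L by blast
  qed
next
  fix v assume v: "v \<in> L"
  then have vR: "v \<in> R" using L by blast
  show "v \<in> block_starts R (block_ends R L)"
  proof (cases "\<forall>w\<in>R. v \<le> w")
    case False
    then obtain w where "w \<in> R" "w < v" by force
    then obtain u where u: "u \<in> R" "gap R u v" using ex_gap_down fin by blast
    then have "u \<in> block_ends R L" using v by (auto simp: block_ends_def)
    then show ?thesis using u vR by (auto simp: block_starts_def)
  qed (simp add: block_starts_def vR)
qed

lemma block_ends_starts:
  assumes A: "A \<subseteq> R" and mx: "\<And>v. v \<in> R \<Longrightarrow> \<forall>w\<in>R. w \<le> v \<Longrightarrow> v \<in> A"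
  shows "block_ends R (block_starts R A) = A"
proof (intro equalityI subsetI)
  fix u assume u: "u \<in> block_ends R (block_starts R A)"
  then have uR: "u \<in> R" by (simp add: block_ends_def)
  show "u \<in> A"
  proof (cases "\<forall>w\<in>R. w \<le> u")
    case True
    then show ?thesis using mx uR by blast
  next
    case False
    then obtain v where v: "v \<in> block_starts R A" "gap R u v" using u by (auto simp: block_ends_def)
    then have "u < v" by (simp add: gap_def)
    then have "\<not> (\<forall>w\<in>R. v \<le> w)" using uR by (metis not_le)
    then obtain u' where "u' \<in> A" "gap R u' v" using v(1) by (auto simp: block_starts_def)
    then show ?thesis using gap_unique_down[OF v(2)] uR A by blast
  qed
next
  fix u assume u: "u \<in> A"
  then have uR: "u \<in> R" using A by blast
  show "u \<in> block_ends R (block_starts R A)"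
  proof (cases "\<forall>w\<in>R. w \<le> u")
    case False
    then obtain w where "w \<in> R" "u < w" by force
    then obtain v where v: "v \<in> R" "gap R u v" using ex_gap_up by blast
    then have "v \<in> block_starts R A" using u by (auto simp: block_starts_def)
    then show ?thesis using v uR by (auto simp: block_ends_def)
  qed (simp add: block_ends_def uR)
qed

text \<open>The block starts up to \<open>v\<close> are one more than the block ends before \<open>v\<close>, since \<open>v\<close> lies in a block that
has begun and all earlier blocks have ended.\<close>

lemma below_block_starts:
  assumes fin: "finite R" and A: "A \<subseteq> R" and v: "v \<in> R"
  shows "below (block_starts R A) v + (if v \<in> block_starts R A then 1 else 0) = 1 + below A v"
  using v
proof (induction v rule: less_induct)
  case (less v)
  let ?L = "block_starts R A"
  have LR: "?L \<subseteq> R" by (auto simp: block_starts_def)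
  have fins: "finite ?L" "finite A" using LR A fin finite_subset by blast+
  show ?case
  proof (cases "\<forall>w\<in>R. v \<le> w")
    case True
    have "{z \<in> S. z < v} = {}" if "S \<subseteq> R" for S using that True by force
    then have "below ?L v = 0" "below A v = 0" using LR A by (simp_all add: below_def)
    then show ?thesis using True less.prems by (simp add: block_starts_def)
  next
    case False
    then obtain w where "w \<in> R" "w < v" by force
    then obtain q where q: "q \<in> R" "gap R q v" using ex_gap_down fin by blast
    have gaps: "gap ?L q v" "gap A q v" using q(2) LR A by (auto simp: gap_def)
    have qv: "q < v" using q(2) by (simp add: gap_def)
    have B: "below S v = below S q + (if q \<in> S then 1 else 0)" if "gap S q v" "finite S" for S
    proof -
      have "below S (Suc q) = below S v" by (rule below_gap[OF that(1)]) (use qv in auto)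
      then show ?thesis using below_Suc[OF that(2), of q] by simp
    qed
    have vL: "v \<in> ?L \<longleftrightarrow> q \<in> A"
    proof
      assume "v \<in> ?L"
      then obtain u where u: "u \<in> A" "gap R u v" using False unfolding block_starts_def by blast
      then have "u = q" using gap_unique_down[OF u(2) q(2)] q(1) A by blast
      then show "q \<in> A" using u by simp
    next
      assume "q \<in> A"
      then show "v \<in> ?L" using q(2) less.prems unfolding block_starts_def by blast
    qed
    show ?thesis using less.IH[OF qv q(1)] B[OF gaps(1) fins(1)] B[OF gaps(2) fins(2)] vL by auto
  qed
qed

text \<open>For the block starts \<open>L\<close>, the counting identity turns dominance of \<open>T\<close> by \<open>A\<close> into dominance of \<open>T\<close>
by \<open>L\<close> that is strict at every element of \<open>R\<close> outside \<open>L\<close>.  This strictness says that the path has no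
flat step on the axis.\<close>

lemma block_starts_properties:
  assumes fin: "finite R" "finite T" and A: "A \<subseteq> R" and mx: "\<And>v. v \<in> R \<Longrightarrow> \<forall>w\<in>R. w \<le> v \<Longrightarrow> v \<in> A"
    and dom: "dominates A T" and card: "card A = card T"
  shows "card (block_starts R A) = card T" "dominates (block_starts R A) T"
    "\<And>v. v \<in> R \<Longrightarrow> v \<notin> block_starts R A \<Longrightarrow> below T v < below (block_starts R A) v"
proof -
  let ?L = "block_starts R A"
  have LR: "?L \<subseteq> R" by (auto simp: block_starts_def)
  have fins: "finite ?L" "finite A" using LR A fin finite_subset by blast+
  note key = below_block_starts[OF fin(1) A]
  have d: "below T v \<le> below A v" for v using dom by (simp add: dominates_def)
  show cL: "card ?L = card T"
  proof (cases "R = {}")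
    case True
    then show ?thesis using LR A card by auto
  next
    case False
    then obtain r where r: "greatest R r" using ex_greatest fin by blast
    then have rR: "r \<in> R" and rA: "r \<in> A" using mx by (auto simp: greatest_def)
    have full: "below S (Suc r) = card S" if "S \<subseteq> R" for S
      using r that by (intro below_eq_card) (auto simp: greatest_def less_Suc_eq_le)
    show ?thesis
      using key[OF rR] below_Suc[OF fins(1), of r] below_Suc[OF fins(2), of r] full[OF LR] full[OF A] rA card
      by simp
  qed
  show "below T v < below ?L v" if "v \<in> R" "v \<notin> ?L" for v
    using key[OF that(1)] that(2) d[of v] by simp
  have R: "below T v \<le> below ?L v" if "v \<in> R" for v
    using key[OF that] d[of v] by (auto split: if_splits)
  show "dominates ?L T"
    unfolding dominates_def
  proof
    fix v
    show "below T v \<le> below ?L v"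
    proof (cases "\<exists>z\<in>R. v \<le> z")
      case True
      \<comment> \<open>From \<open>v\<close> to the next element of \<open>R\<close> the count of block starts does not change.\<close>
      define r where "r = (LEAST z. z \<in> R \<and> v \<le> z)"
      have r: "r \<in> R" "v \<le> r"
        using LeastI_ex[of "\<lambda>z. z \<in> R \<and> v \<le> z"] True unfolding r_def by blast+
      have lst: "r \<le> z" if "z \<in> R" "v \<le> z" for z
        unfolding r_def using that by (intro Least_le) simp
      have "{z \<in> ?L. z < v} = {z \<in> ?L. z < r}" using lst LR r by force
      then have "below ?L v = below ?L r" by (simp add: below_def)
      moreover have "below T v \<le> below T r" by (rule below_mono[OF fin(2) r(2)])
      ultimately show ?thesis using R[OF r(1)] by simp
    next
      case False
      then have "below ?L v = card ?L" using LR by (intro below_eq_card) force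
      then show ?thesis using below_le_card[OF fin(2), of v] cL by simp
    qed
  qed
qed

section \<open>The reading word of a Riordan permutation\<close>

text \<open>The last entries of the blocks between consecutive tops, including the last entry of the whole permutation.\<close>

definition ends_set :: "nat list \<Rightarrow> nat set" where
  "ends_set p = {p ! i | i. i < length p \<and> p ! i \<notin> D_set p \<and> (Suc i < length p \<longrightarrow> p ! Suc i \<in> D_set p)}"

definition riordan_state :: "nat list \<Rightarrow> state" where
  "riordan_state p = (ends_set p, D_set p, {}, {1..length p} - D_set p - ends_set p)"

lemma codes_gap:
  assumes c: "codes n L T p" and ij: "i < j" "j < length p" "p ! i \<notin> T" "p ! j \<notin> T"
    and between: "\<And>h. i < h \<Longrightarrow> h < j \<Longrightarrow> p ! h \<in> T"
  shows "gap ({1..n} - T) (p ! i) (p ! j)"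
  unfolding gap_def
proof (intro conjI ballI)
  show "p ! i < p ! j" using codes_sorted_classes[OF c ij(1,2)] ij by simp
  fix z assume z: "z \<in> {1..n} - T"
  then have "z \<in> set p" using codesD(1)[OF c] by simp
  then obtain h where h: "h < length p" "p ! h = z" by (auto simp: in_set_conv_nth)
  have "h \<le> i \<or> j \<le> h" using between[of h] h z by (metis DiffD2 not_le)
  then show "z \<le> p ! i \<or> p ! j \<le> z"
    using codes_sorted_classes[OF c, of h i] codes_sorted_classes[OF c, of j h] h z ij
    by (cases "h = i"; cases "h = j") auto
qed

lemma ends_set_eq:
  assumes c: "codes n L T p"
  shows "ends_set p = block_ends ({1..n} - T) L"
proof -
  note C = codesD[OF c]
  let ?R = "{1..n} - T"
  have D: "D_set p = T" by (rule codes_sets(1)[OF c])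
  have key: "(Suc i < length p \<longrightarrow> p ! Suc i \<in> T) \<longleftrightarrow> p ! i \<in> block_ends ?R L"
    if i: "i < length p" "p ! i \<notin> T" for i
  proof -
    have iR: "p ! i \<in> ?R" using i C(1) nth_mem by blast
    consider "Suc i = length p" | "Suc i < length p" "p ! Suc i \<in> T" | "Suc i < length p" "p ! Suc i \<notin> T"
      using i by linarith
    then show ?thesis
    proof cases
      case 1
      have "w \<le> p ! i" if w: "w \<in> ?R" for w
      proof -
        obtain h where h: "h < length p" "p ! h = w" using w C(1) by (metis DiffD1 in_set_conv_nth)
        then have "h \<le> i" using 1 by simp
        then show ?thesis using codes_sorted_classes[OF c, of h i] h w i by (cases "h = i") auto
      qed
      then show ?thesis using 1 iR by (auto simp: block_ends_def)
    next
      case 2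
      then have nx: "Suc (Suc i) < length p" "p ! Suc (Suc i) \<in> L" using codes_next[OF c 2] by auto
      then have "p ! Suc (Suc i) \<notin> T" using C(6) by auto
      then have "gap ?R (p ! i) (p ! Suc (Suc i))"
        using 2 i nx by (intro codes_gap[OF c]) (auto simp: less_Suc_eq)
      then show ?thesis using 2 nx iR by (auto simp: block_ends_def)
    next
      case 3
      have g: "gap ?R (p ! i) (p ! Suc i)" using 3 i by (intro codes_gap[OF c]) auto
      have sR: "p ! Suc i \<in> ?R" using 3 C(1) nth_mem by blast
      have "p ! Suc i \<notin> L"
      proof
        assume "p ! Suc i \<in> L"
        then obtain j where "Suc i = Suc j" "p ! j \<in> T" using codes_prev[OF c 3(1)] by blast
        then show False using i by simp
      qed
      moreover have "L \<subseteq> ?R" using C(4,6) by blast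
      ultimately have "\<not> (\<exists>v\<in>L. gap ?R (p ! i) v)" using gap_unique_up[OF g _ sR] by blast
      moreover have "\<not> (\<forall>w\<in>?R. w \<le> p ! i)" using g sR by (metis gap_def not_le)
      ultimately show ?thesis using 3 by (auto simp: block_ends_def)
    qed
  qed
  show ?thesis
  proof (intro equalityI subsetI)
    fix u assume "u \<in> ends_set p"
    then show "u \<in> block_ends ?R L" using key unfolding ends_set_def D by auto
  next
    fix u assume u: "u \<in> block_ends ?R L"
    then have uR: "u \<in> ?R" by (simp add: block_ends_def)
    then obtain i where "i < length p" "p ! i = u" using C(1) by (metis DiffD1 in_set_conv_nth)
    then show "u \<in> ends_set p" using key[of i] u uR unfolding ends_set_def D by blast
  qed
qed

text \<open>The least entry outside \<open>T\<close> has no bottom below it, so it would be a fixed point if it were not a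
bottom itself.\<close>

lemma Riordan_codes_min:
  assumes c: "codes n L T p" and p: "p \<in> Riordan_perms n" and v: "v \<in> {1..n} - T" "\<forall>w\<in>{1..n} - T. v \<le> w"
  shows "v \<in> L"
proof (rule ccontr)
  assume vL: "v \<notin> L"
  note C = codesD[OF c]
  obtain i where i: "i < length p" "p ! i = v" using v(1) C(1) by (metis DiffD1 in_set_conv_nth)
  have "\<not> fixed_point_at p i" using p by (simp add: Riordan_perms_def)
  then have "below L v \<noteq> below T v" using codes_LR_max_iff(3)[OF c i(1)] i v vL by auto
  moreover have "below T v \<le> below L v" using codes_card_dominates(2)[OF c] by (simp add: dominates_def)
  moreover have "v \<le> z" if "z \<in> L" for z using that v(2) C(4,6) by blast
  then have "{z \<in> L. z < v} = {}" by (auto dest: leD)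
  then have "below L v = 0" by (simp add: below_def)
  ultimately show False by simp
qed

lemma map_LR_positions:
  assumes c: "codes n L T p" and p: "p \<in> Riordan_perms n"
  shows "map ((!) p) (LR_positions p) = sorted_list_of_set T"
    "sorted_wrt (<) (LR_positions p)" "set (LR_positions p) = {i. i < length p \<and> p ! i \<in> T}"
proof -
  note C = codesD[OF c]
  have nf: "\<not> fixed_point_at p i" for i using p by (simp add: Riordan_perms_def)
  have LR: "LR_max_at p i \<longleftrightarrow> p ! i \<in> T" if "i < length p" for i
    using codes_LR_max_iff(1)[OF c that] nf by simp
  then have eq: "LR_positions p = filter (\<lambda>i. p ! i \<in> T) [0..<length p]"
    unfolding LR_positions_def by (intro filter_cong) auto
  show "sorted_wrt (<) (LR_positions p)" unfolding eq by (rule sorted_wrt_filter) simp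
  show "set (LR_positions p) = {i. i < length p \<and> p ! i \<in> T}" unfolding eq by auto
  have "map ((!) p) (LR_positions p) = filter (\<lambda>v. v \<in> T) (map ((!) p) [0..<length p])"
    unfolding eq filter_map comp_def ..
  also have "\<dots> = filter (\<lambda>v. v \<in> T) p" by (simp add: map_nth)
  also have "\<dots> = sorted_list_of_set T"
  proof -
    have "set (filter (\<lambda>v. v \<in> T) p) = T" using C(1,5) by auto
    then show ?thesis using sorted_list_of_set_eqI[OF C(9)] by simp
  qed
  finally show "map ((!) p) (LR_positions p) = sorted_list_of_set T" .
qed

text \<open>The position right before the next top, and for the last top the last position.\<close>

definition block_end :: "nat list \<Rightarrow> nat \<Rightarrow> nat" where
  "block_end p j = (let ps = LR_positions p in if Suc j < length ps then ps ! Suc j - 1 else length p - 1)"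

text \<open>Entries between two consecutive tops increase, so the largest of them is the last one.\<close>

lemma between_max_eq:
  fixes p :: "nat list"
  defines "ps \<equiv> LR_positions p"
  defines "e \<equiv> block_end p"
  assumes c: "codes n L T p" and p: "p \<in> Riordan_perms n" and j: "j < length ps"
  shows "between_max p j = p ! e j" "ps ! j < e j" "e j < length p" "\<And>h. ps ! j < h \<Longrightarrow> h \<le> e j \<Longrightarrow> p ! h \<notin> T"
    "Suc (e j) < length p \<Longrightarrow> p ! Suc (e j) \<in> T"
proof -
  have e_def': "e j = (if Suc j < length ps then ps ! Suc j - 1 else length p - 1)" for j
    by (simp add: e_def block_end_def ps_def Let_def)
  note C = codesD[OF c]
  note P = map_LR_positions[OF c p, folded ps_def]
  have pos: "ps ! i < length p \<and> p ! (ps ! i) \<in> T" if "i < length ps" for i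
    using nth_mem[OF that] P(3) by auto
  have nx: "Suc (ps ! j) < length p" "p ! Suc (ps ! j) \<notin> T"
    using codes_next[OF c, of "ps ! j"] pos[OF j] C(6) by auto
  have gt: "ps ! j < ps ! Suc j \<and> ps ! Suc j \<noteq> Suc (ps ! j)" if "Suc j < length ps"
  proof
    show "ps ! j < ps ! Suc j" using sorted_wrt_nth_less[OF P(2), of j "Suc j"] that by simp
    show "ps ! Suc j \<noteq> Suc (ps ! j)" using pos[OF that] nx(2) by metis
  qed
  show e1: "ps ! j < e j" "e j < length p"
    using gt pos[of "Suc j"] nx unfolding e_def' by (auto split: if_splits)
  have no: "p ! h \<notin> T" if h: "ps ! j < h" "h < length p" "Suc j < length ps \<Longrightarrow> h < ps ! Suc j" for h
  proof
    assume "p ! h \<in> T"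
    then have "h \<in> set ps" using P(3) h by simp
    then obtain i where i: "i < length ps" "ps ! i = h" by (auto simp: in_set_conv_nth)
    have "j < i"
      using sorted_wrt_nth_less[OF P(2), of i j] i h j by (cases i j rule: linorder_cases) auto
    then have "Suc j < length ps" using i by simp
    moreover have "\<not> Suc j < i"
      using sorted_wrt_nth_less[OF P(2), of "Suc j" i] i h(3) calculation by auto
    ultimately have "Suc j = i" using \<open>j < i\<close> by simp
    then show False using h(3) i \<open>Suc j < length ps\<close> by simp
  qed
  show between: "p ! h \<notin> T" if "ps ! j < h" "h \<le> e j" for h
    using no[of h] that e1 gt unfolding e_def' by (auto split: if_splits)
  show "p ! Suc (e j) \<in> T" if "Suc (e j) < length p"
    using that gt pos[of "Suc j"] unfolding e_def' by (auto split: if_splits)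
  show "between_max p j = p ! e j"
  proof (cases "Suc j < length ps")
    case True
    then have ej: "Suc (e j) = ps ! Suc j" using gt by (simp add: e_def')
    have "Max ((!) p ` {ps ! j<..<ps ! Suc j}) = p ! e j"
    proof (rule Max_eqI)
      show "p ! e j \<in> (!) p ` {ps ! j<..<ps ! Suc j}" using e1 ej by auto
      fix y assume "y \<in> (!) p ` {ps ! j<..<ps ! Suc j}"
      then obtain h where h: "y = p ! h" "ps ! j < h" "h \<le> e j" using ej by auto
      then show "y \<le> p ! e j"
        using codes_sorted_classes[OF c, of h "e j"] between[of h] between[of "e j"] e1 by (cases "h = e j") auto
    qed simp
    then show ?thesis using True by (simp add: between_max_def ps_def Let_def)
  next
    case False
    have "p \<noteq> []" using nx by auto
    then show ?thesis using False by (simp add: between_max_def ps_def Let_def e_def' last_conv_nth)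
  qed
qed

lemma map_between_max:
  assumes c: "codes n L T p" and p: "p \<in> Riordan_perms n"
  shows "map (between_max p) [0..<length (LR_positions p)] = sorted_list_of_set (ends_set p)"
proof -
  define ps where "ps = LR_positions p"
  define e where "e = block_end p"
  have e_def': "e j = (if Suc j < length ps then ps ! Suc j - 1 else length p - 1)" for j
    by (simp add: e_def block_end_def ps_def Let_def)
  note C = codesD[OF c]
  note P = map_LR_positions[OF c p, folded ps_def]
  note B = between_max_eq[OF c p, folded ps_def e_def]
  have D: "D_set p = T" by (rule codes_sets(1)[OF c])
  have mono: "e i < e j" if ij: "i < j" "j < length ps" for i j
  proof -
    have "Suc i < length ps" using ij by simp
    then have "e i < ps ! Suc i" using B(2)[of i] unfolding e_def' by simp
    also have "\<dots> \<le> ps ! j"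
      using sorted_wrt_nth_less[OF P(2), of "Suc i" j] ij by (cases "Suc i = j") auto
    also have "\<dots> < e j" using B(2)[of j] ij by simp
    finally show ?thesis .
  qed
  have nT: "p ! e j \<notin> T" if "j < length ps" for j using B(4)[of j "e j"] B(2)[of j] that by simp
  have eq: "map (between_max p) [0..<length ps] = map (\<lambda>j. p ! e j) [0..<length ps]"
    using B(1) by simp
  have "sorted_wrt (<) (map (\<lambda>j. p ! e j) [0..<length ps])"
    unfolding sorted_wrt_iff_nth_less
    using mono nT B(3) codes_sorted_classes[OF c] by simp
  moreover have "set (map (\<lambda>j. p ! e j) [0..<length ps]) = ends_set p"
  proof (intro equalityI subsetI)
    fix u assume "u \<in> set (map (\<lambda>j. p ! e j) [0..<length ps])"
    then obtain j where "j < length ps" "u = p ! e j" by auto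
    then show "u \<in> ends_set p" using nT B(3,5) unfolding ends_set_def D by blast
  next
    fix u assume "u \<in> ends_set p"
    then obtain i where i: "i < length p" "u = p ! i" "p ! i \<notin> T" "Suc i < length p \<longrightarrow> p ! Suc i \<in> T"
      unfolding ends_set_def D by blast
    have "LR_max_at p 0" using i by (auto simp: LR_max_at_def)
    moreover have "\<not> fixed_point_at p 0" using p by (simp add: Riordan_perms_def)
    moreover have p0: "0 < length p" using i(1) by linarith
    ultimately have "p ! 0 \<in> T" using codes_LR_max_iff(1)[OF c p0] by simp
    then have "0 \<in> set ps" using p0 unfolding P(3) by blast
    then obtain j0 where j0: "j0 < length ps" "ps ! j0 = 0" by (auto simp: in_set_conv_nth)
    have "\<exists>j<length ps. e j = i"
    proof (cases "Suc i < length p")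
      case True
      then have "Suc i \<in> set ps" using i(4) unfolding P(3) by blast
      then obtain j where j: "j < length ps" "ps ! j = Suc i" by (auto simp: in_set_conv_nth)
      have "j \<noteq> 0"
      proof
        assume "j = 0"
        then have "ps ! j \<le> ps ! j0" using sorted_wrt_nth_less[OF P(2), of 0 j0] j0 by (cases "j0 = 0") auto
        then show False using j j0 by simp
      qed
      then obtain j' where "j = Suc j'" by (cases j) auto
      then have "j' < length ps \<and> e j' = i" using j by (simp add: e_def')
      then show ?thesis by blast
    next
      case False
      then have "length p - 1 = i" using i(1) by linarith
      moreover have "\<not> Suc (length ps - 1) < length ps" by linarith
      ultimately have "e (length ps - 1) = i" unfolding e_def' by simp
      then show ?thesis using j0 by (intro exI[of _ "length ps - 1"]) auto
    qed
    then show "u \<in> set (map (\<lambda>j. p ! e j) [0..<length ps])" using i by auto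
  qed
  ultimately show ?thesis using sorted_list_of_set_eqI eq unfolding ps_def by metis
qed

lemma theta_eq:
  assumes c: "codes n L T p" and p: "p \<in> Riordan_perms n"
  shows "theta p = interleave (sorted_list_of_set T) (sorted_list_of_set (ends_set p)) @
    sorted_list_of_set ({1..n} - T - ends_set p)"
proof -
  note C = codesD[OF c]
  let ?ps = "LR_positions p"
  note P = map_LR_positions[OF c p]
  have len: "length ?ps = length (sorted_list_of_set T)" using P(1) by (metis length_map)
  have a: "between_max p j = sorted_list_of_set (ends_set p) ! j" if "j < length ?ps" for j
    using that unfolding map_between_max[OF c p, symmetric] by simp
  have m: "p ! (?ps ! j) = sorted_list_of_set T ! j" if "j < length ?ps" for j
    using that unfolding P(1)[symmetric] by simp
  have ma: "concat (map (\<lambda>j. [p ! (?ps ! j), between_max p j]) [0..<length ?ps]) =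
      interleave (sorted_list_of_set T) (sorted_list_of_set (ends_set p))"
    unfolding interleave_def len[symmetric]
    by (rule arg_cong[of _ _ concat], rule map_cong) (simp_all add: a m)
  have "set (concat (map (\<lambda>j. [p ! (?ps ! j), between_max p j]) [0..<length ?ps])) =
      set (map ((!) p) ?ps) \<union> set (map (between_max p) [0..<length ?ps])"
  proof -
    have "set ?ps = (!) ?ps ` {0..<length ?ps}" by (simp add: nth_image)
    then show ?thesis by auto
  qed
  also have "\<dots> = T \<union> ends_set p"
  proof -
    have "finite (ends_set p)" unfolding ends_set_eq[OF c] block_ends_def by simp
    then show ?thesis unfolding P(1) map_between_max[OF c p] using C(8) by simp
  qed
  finally have "set (interleave (sorted_list_of_set T) (sorted_list_of_set (ends_set p))) = T \<union> ends_set p"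
    unfolding ma .
  then show ?thesis
    unfolding theta_def Let_def ma C(3) by (simp add: Diff_eq Int_assoc)
qed

lemma Phi_eq:
  assumes p: "p \<in> Riordan_perms n"
  shows "Phi p = equalized_insertion (riordan_state p)"
proof -
  have c: "codes n (U_set p) (D_set p) p" using p by (intro Motzkin_codes) (simp add: Riordan_perms_def)
  show ?thesis
    unfolding Phi_def theta_eq[OF c p] riordan_state_def equalized_insertion_def prod.case codesD(3)[OF c] ..
qed

text \<open>The last entry of a block is not a left-to-right maximum, and the largest entry before it is the top
that precedes the block.  So \<open>a\<^sub>j < m\<^sub>j\<close>.\<close>

lemma riordan_state_initial:
  assumes p: "p \<in> Riordan_perms n"
  shows "riordan_state p \<in> initial_states n"
proof -
  let ?T = "D_set p" and ?L = "U_set p" and ?A = "ends_set p"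
  have c: "codes n ?L ?T p" using p by (intro Motzkin_codes) (simp add: Riordan_perms_def)
  note C = codesD[OF c]
  let ?R = "{1..n} - ?T"
  define ps where "ps = LR_positions p"
  define e where "e = block_end p"
  have e_def': "e j = (if Suc j < length ps then ps ! Suc j - 1 else length p - 1)" for j
    by (simp add: e_def block_end_def ps_def Let_def)
  note P = map_LR_positions[OF c p, folded ps_def]
  note B = between_max_eq[OF c p, folded ps_def e_def]
  have AR: "?A \<subseteq> ?R" unfolding ends_set_eq[OF c] by (auto simp: block_ends_def)
  then have finA: "finite ?A" by (rule finite_subset) simp
  have mA: "sorted_list_of_set ?A = map (between_max p) [0..<length ps]"
    using map_between_max[OF c p] by (simp add: ps_def)
  have lenT: "length ps = card ?T"
    using arg_cong[OF P(1), of length] C(8) by simp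
  have cardA: "card ?A = card ?T"
    using arg_cong[OF mA, of length] finA lenT by simp
  have col: "between_max p j < sorted_list_of_set ?T ! j" if j: "j < length ps" for j
  proof -
    have T: "sorted_list_of_set ?T ! j = p ! (ps ! j)" unfolding P(1)[symmetric] using j by simp
    have ej: "e j < length p" "p ! e j \<notin> ?T" "ps ! j < e j" using B(2,3,4)[OF j] by auto
    have pj: "ps ! j < length p" "p ! (ps ! j) \<in> ?T" using nth_mem[OF j] P(3) by auto
    have "\<not> fixed_point_at p (e j)" using p by (simp add: Riordan_perms_def)
    then have "\<not> LR_max_at p (e j)" using codes_LR_max_iff(1)[OF c ej(1)] ej(2) by simp
    then obtain h where h: "h < e j" "\<not> p ! h < p ! e j" using ej(1) by (auto simp: LR_max_at_def)
    have hT: "p ! h \<in> ?T" using codes_sorted_classes[OF c, of h "e j"] h ej by auto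
    have "h \<le> ps ! j" using B(4)[OF j, of h] hT h by force
    then have "p ! h \<le> p ! (ps ! j)"
      using codes_sorted_classes[OF c, of h "ps ! j"] hT pj by (cases "h = ps ! j") auto
    moreover have "p ! e j \<noteq> p ! (ps ! j)" using ej pj by auto
    ultimately show ?thesis unfolding T B(1)[OF j] using h by simp
  qed
  have dom: "dominates ?A ?T"
  proof -
    have "sorted_list_of_set ?A ! j < sorted_list_of_set ?T ! j" if "j < card ?T" for j
      using col[of j] that lenT by (simp add: mA)
    moreover have "?A \<inter> ?T = {}" using AR by blast
    ultimately show ?thesis
      using dominates_iff_columns[of "sorted_list_of_set ?A" "sorted_list_of_set ?T"] finA C(8) cardA
      by simp
  qed
  have emp: "dominates ?T {}" by (simp add: dominates_def)
  have cover: "\<exists>a\<in>?A. b < a" if b: "b \<in> {1..length p} - ?T - ?A" for b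
  proof -
    have "b \<in> ?R" using b C(3) by simp
    then have "?R \<noteq> {}" by blast
    then obtain r where r: "greatest ?R r" using ex_greatest[of ?R] by blast
    then have "r \<in> ?A" unfolding ends_set_eq[OF c] block_ends_def greatest_def by blast
    moreover have "b \<le> r" using r \<open>b \<in> ?R\<close> unfolding greatest_def by blast
    moreover have "b \<notin> ?A" using b by blast
    ultimately have "r \<in> ?A" "b < r" by (auto simp: le_less)
    then show ?thesis by blast
  qed
  have part: "?A \<union> ?T \<union> {} \<union> ({1..length p} - ?T - ?A) = {1..n}" using AR C(3,5) by auto
  have "(?A, ?T, {}, {1..length p} - ?T - ?A) \<in> states n"
    by (rule statesI[OF part _ _ _ _ cardA dom emp]) (use AR in \<open>auto simp: last_bumps_def greatest_def\<close>)
  then show ?thesis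
    unfolding riordan_state_def initial_states_def mem_Collect_eq prod.case using cover by blast
qed

text \<open>Block starts and block ends determine each other, and the block starts are the bottoms of the
permutation.\<close>

lemma bij_betw_riordan_state: "bij_betw riordan_state (Riordan_perms n) (initial_states n)"
  unfolding bij_betw_def
proof (intro conjI equalityI subsetI)
  show "inj_on riordan_state (Riordan_perms n)"
  proof (rule inj_onI)
    fix p q assume p: "p \<in> Riordan_perms n" and q: "q \<in> Riordan_perms n" and eq: "riordan_state p = riordan_state q"
    have cp: "codes n (U_set p) (D_set p) p" and cq: "codes n (U_set q) (D_set q) q"
      using p q by (auto intro!: Motzkin_codes simp: Riordan_perms_def)
    have T: "D_set p = D_set q" "ends_set p = ends_set q" using eq by (auto simp: riordan_state_def)
    have L: "U_set r = block_starts ({1..n} - D_set r) (ends_set r)"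
      if r: "r \<in> Riordan_perms n" and c: "codes n (U_set r) (D_set r) r" for r
      unfolding ends_set_eq[OF c]
      using block_starts_ends[of "{1..n} - D_set r" "U_set r"] Riordan_codes_min[OF c r] codesD(4,6)[OF c] by blast
    have "U_set p = U_set q" using L[OF p cp] L[OF q cq] T by simp
    then have "codes n (U_set p) (D_set p) q" using cq T by simp
    with cp show "p = q" by (rule codes_unique)
  qed
next
  fix s assume "s \<in> riordan_state ` Riordan_perms n"
  then show "s \<in> initial_states n" using riordan_state_initial by blast
next
  fix s assume s: "s \<in> initial_states n"
  obtain A T C B where e: "s = (A, T, C, B)" by (rule prod_cases4)
  have C: "C = {}" and st: "(A, T, {}, B) \<in> states n" and cov: "\<forall>b\<in>B. \<exists>a\<in>A. b < a"
    using s by (auto simp: e initial_states_def)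
  have S: "A \<union> T \<union> B = {1..n}" "A \<inter> T = {}" "(A \<union> T) \<inter> B = {}" "card A = card T" "dominates A T"
    using st by (auto simp: states_def)
  let ?R = "{1..n} - T"
  have AR: "A \<subseteq> ?R" using S by blast
  have finT: "finite T" "finite ?R" using states_finite[OF st] by auto
  have mx: "v \<in> A" if "v \<in> ?R" "\<forall>w\<in>?R. w \<le> v" for v
  proof (rule ccontr)
    assume "v \<notin> A"
    then have "v \<in> B" using that S(1) by blast
    then obtain a where "a \<in> A" "v < a" using cov by blast
    then show False using that(2) AR by force
  qed
  define L where "L = block_starts ?R A"
  note bs = block_starts_properties[OF finT(2,1) AR mx S(5,4), folded L_def]
  have LR: "L \<subseteq> ?R" by (auto simp: L_def block_starts_def)
  obtain p where c: "codes n L T p"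
    using codes_exists[of L n T] LR S(1) bs(1,2) by blast
  note P = codesD[OF c]
  have "\<not> fixed_point_at p i" for i
  proof
    assume f: "fixed_point_at p i"
    then have i: "i < length p" by (simp add: fixed_point_at_def)
    then have "p ! i \<notin> T" "p ! i \<notin> L" "below L (p ! i) = below T (p ! i)"
      using f unfolding codes_LR_max_iff(3)[OF c i] by blast+
    moreover have "p ! i \<in> {1..n}" unfolding P(1)[symmetric] using i by (rule nth_mem)
    ultimately have "below T (p ! i) < below L (p ! i)" by (intro bs(3)) auto
    then show False using \<open>below L (p ! i) = below T (p ! i)\<close> by simp
  qed
  then have p: "p \<in> Riordan_perms n" using codes_Motzkin[OF c] by (simp add: Riordan_perms_def)
  have "ends_set p = A"
    unfolding ends_set_eq[OF c] L_def by (rule block_ends_starts[OF AR mx])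
  then have "riordan_state p = s"
    unfolding riordan_state_def codes_sets(1)[OF c] P(3) e C using S by auto
  then show "s \<in> riordan_state ` Riordan_perms n" using p by blast
qed

lemma bij_betw_Phi: "bij_betw Phi (Riordan_perms n) (SYT3_eq n)"
proof -
  have "bij_betw (equalized_insertion \<circ> riordan_state) (Riordan_perms n) (SYT3_eq n)"
    by (rule bij_betw_trans[OF bij_betw_riordan_state bij_betw_equalized_insertion])
  moreover have "Phi p = (equalized_insertion \<circ> riordan_state) p" if "p \<in> Riordan_perms n" for p
    using Phi_eq[OF that] by simp
  ultimately show ?thesis using bij_betw_cong by blast
qed

section \<open>Lifting a flat step\<close>

lemma height_simps [simp]:
  "height [] = 0" "height (s # w) = rise s + height w"
  by (simp_all add: height_def)

definition stays_up :: "step list \<Rightarrow> bool" where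
  "stays_up w \<longleftrightarrow> (\<forall>k. 0 \<le> height (take k w))"

lemma Motzkin_paths_iff: "w \<in> Motzkin_paths n \<longleftrightarrow> length w = n \<and> height w = 0 \<and> stays_up w"
proof -
  have "(\<forall>k. 0 \<le> height (take k w)) \<longleftrightarrow> (\<forall>k\<le>length w. 0 \<le> height (take k w))"
  proof (intro iffI allI)
    fix k assume A: "\<forall>k\<le>length w. 0 \<le> height (take k w)"
    show "0 \<le> height (take k w)"
    proof (cases "k \<le> length w")
      case False
      then have "take k w = take (length w) w" by simp
      then show ?thesis using A by (metis order_refl)
    qed (use A in simp)
  qed simp
  then show ?thesis by (auto simp: Motzkin_paths_def stays_up_def)
qed

lemma stays_up_append:
  "stays_up (u @ w) \<longleftrightarrow> stays_up u \<and> (\<forall>k. 0 \<le> height u + height (take k w))"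
proof
  assume A: "stays_up (u @ w)"
  have "0 \<le> height (take k u)" for k
  proof (cases "k \<le> length u")
    case True
    then show ?thesis using A[unfolded stays_up_def, rule_format, of k] by simp
  next
    case False
    then show ?thesis using A[unfolded stays_up_def, rule_format, of "length u"] by simp
  qed
  moreover have "0 \<le> height u + height (take k w)" for k
    using A[unfolded stays_up_def, rule_format, of "length u + k"] by (simp add: height_append)
  ultimately show "stays_up u \<and> (\<forall>k. 0 \<le> height u + height (take k w))" by (simp add: stays_up_def)
next
  assume A: "stays_up u \<and> (\<forall>k. 0 \<le> height u + height (take k w))"
  show "stays_up (u @ w)"
    unfolding stays_up_def
  proof
    fix k
    show "0 \<le> height (take k (u @ w))"
    proof (cases "k \<le> length u")
      case True
      then show ?thesis using A by (simp add: stays_up_def)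
    next
      case False
      then show ?thesis using A by (simp add: height_append)
    qed
  qed
qed

definition axis_free :: "step list \<Rightarrow> bool" where
  "axis_free w \<longleftrightarrow> (\<forall>i. \<not> flat_on_axis_at w i)"

lemma flat_on_axis_at_append:
  "flat_on_axis_at (u @ w) i \<longleftrightarrow>
     (if i < length u then flat_on_axis_at u i
      else i < length u + length w \<and> w ! (i - length u) = H \<and> height u + height (take (i - length u) w) = 0)"
  by (auto simp: flat_on_axis_at_def nth_append height_append)

text \<open>The first flat step of \<open>w\<close> on the axis comes between \<open>u\<close> and \<open>v\<close>.\<close>

definition flat_decomp :: "step list \<Rightarrow> step list \<Rightarrow> step list \<Rightarrow> bool" where
  "flat_decomp w u v \<longleftrightarrow> w = u @ H # v \<and> height u = 0 \<and> stays_up u \<and> axis_free u \<and> height v = 0 \<and> stays_up v"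

lemma flat_decomp_in:
  assumes "flat_decomp w u v"
  shows "w \<in> Motzkin_paths (length w) - Riordan_paths (length w)" "gamma w = u @ U # v @ [D]"
    "u @ U # v @ [D] \<in> Riordan_paths (Suc (length w))"
proof -
  have d: "w = u @ H # v" "height u = 0" "stays_up u" "axis_free u" "height v = 0" "stays_up v"
    using assms by (auto simp: flat_decomp_def)
  have up: "0 \<le> height (take k (H # v))" for k using d(6) by (cases k) (auto simp: stays_up_def)
  have M: "w \<in> Motzkin_paths (length w)"
    using d up by (simp add: Motzkin_paths_iff stays_up_append height_append)
  have flat: "flat_on_axis_at w (length u)" using d by (simp add: flat_on_axis_at_def)
  then show "w \<in> Motzkin_paths (length w) - Riordan_paths (length w)" using M by (auto simp: Riordan_paths_def)
  have "(LEAST i. flat_on_axis_at w i) = length u"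
  proof (rule Least_equality)
    show "flat_on_axis_at w (length u)" by (rule flat)
    fix i assume "flat_on_axis_at w i"
    then show "length u \<le> i" using d(1,4) by (auto simp: flat_on_axis_at_append axis_free_def split: if_splits)
  qed
  then show "gamma w = u @ U # v @ [D]" using d(1) by (simp add: gamma_def)
  have up': "0 \<le> height (take k (U # v @ [D]))" for k
  proof (cases k)
    case (Suc j)
    have "0 \<le> height (take j v)" using d(6) by (simp add: stays_up_def)
    then show ?thesis using Suc d(5) by (cases "j - length v") (auto simp: height_append)
  qed simp
  have "u @ U # v @ [D] \<in> Motzkin_paths (Suc (length w))"
    using d up' by (simp add: Motzkin_paths_iff stays_up_append height_append)
  moreover have "\<not> flat_on_axis_at (u @ U # v @ [D]) i" for i
  proof
    assume f: "flat_on_axis_at (u @ U # v @ [D]) i"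
    then have nl: "\<not> i < length u" using d(4) by (auto simp: flat_on_axis_at_append axis_free_def)
    define j where "j = i - length u"
    have j: "j < length (U # v @ [D])" "(U # v @ [D]) ! j = H" "height (take j (U # v @ [D])) = 0"
      using f nl d(2) unfolding flat_on_axis_at_append j_def by auto
    then obtain k where k: "j = Suc k" by (cases j) auto
    then have "k < length v" using j by (auto simp: nth_append less_Suc_eq)
    then have "height (take k v) = - 1" using j(3) k by simp
    moreover have "0 \<le> height (take k v)" using d(6) by (simp add: stays_up_def)
    ultimately show False by simp
  qed
  ultimately show "u @ U # v @ [D] \<in> Riordan_paths (Suc (length w))" by (simp add: Riordan_paths_def)
qed

lemma ex_flat_decomp:
  assumes "w \<in> Motzkin_paths n - Riordan_paths n"
  shows "\<exists>u v. flat_decomp w u v"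
proof -
  have M: "length w = n" "height w = 0" "stays_up w" using assms by (auto simp: Motzkin_paths_iff)
  define i where "i = (LEAST i. flat_on_axis_at w i)"
  have "\<exists>i. flat_on_axis_at w i" using assms by (auto simp: Riordan_paths_def)
  then have f: "flat_on_axis_at w i" unfolding i_def by (rule LeastI_ex)
  have first: "\<not> flat_on_axis_at w j" if "j < i" for j using that not_less_Least unfolding i_def by blast
  define u v where "u = take i w" and "v = drop (Suc i) w"
  have i: "i < length w" "w ! i = H" "height u = 0" using f by (auto simp: flat_on_axis_at_def u_def)
  have w: "w = u @ H # v" using id_take_nth_drop[OF i(1)] i(2) by (simp add: u_def v_def)
  have lu: "length u = i" using i by (simp add: u_def)
  have su: "stays_up u" "\<And>k. 0 \<le> height u + height (take k (H # v))"
    using M(3) unfolding w stays_up_append by auto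
  have "0 \<le> height (take k v)" for k using su(2)[of "Suc k"] i(3) by simp
  moreover have "axis_free u"
    unfolding axis_free_def
  proof
    fix j
    show "\<not> flat_on_axis_at u j"
      using first[of j] lu unfolding w flat_on_axis_at_append by (auto simp: flat_on_axis_at_def)
  qed
  moreover have "height v = 0" using M(2) i(3) w by (simp add: height_append)
  ultimately show ?thesis using w i(3) su(1) unfolding flat_decomp_def stays_up_def by blast
qed

text \<open>The part \<open>v\<close> is lifted by 1 in \<open>u @ U # v @ [D]\<close>, so \<open>u\<close> leads to the last point on the axis before the
end.\<close>

lemma axis_return_unique:
  assumes eq: "u @ U # v @ [D] = u' @ U # v' @ [D]"
    and "height u = 0" "height u' = 0" "stays_up v" "stays_up v'"
  shows "u = u'"
proof -
  have no: "\<not> length u < length u'"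
    if eq: "u @ U # v @ [D] = u' @ U # v' @ [D]" and h: "height u = 0" "height u' = 0" "stays_up v"
    for u v u' v' :: "step list"
  proof
    assume lt: "length u < length u'"
    obtain k where k: "length u' = length u + Suc k" using lt by (metis less_natE add_Suc_right)
    have len: "length v + length u = length v' + length u'" using arg_cong[OF eq, of length] by simp
    have "take (length u') (u @ U # v @ [D]) = u'" unfolding eq by simp
    then have "u' = u @ U # take k v" using k len by simp
    then have "height (take k v) = - 1" using h by (simp add: height_append)
    then show False using h(3) unfolding stays_up_def by (metis neg_0_le_iff_le not_one_le_zero)
  qed
  have "length u = length u'"
    using no[OF eq] no[OF eq[symmetric]] assms by (metis linorder_neqE_nat)
  then show ?thesis using eq by simp
qed

text \<open>A Riordan path of positive length ends with a down step.  After its last point on the axis before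
the end it stays at height at least 1.\<close>

lemma Riordan_decomp:
  assumes x: "x \<in> Riordan_paths (Suc n)"
  shows "\<exists>u v. x = u @ U # v @ [D] \<and> flat_decomp (u @ H # v) u v"
proof -
  have M: "length x = Suc n" "height x = 0" "stays_up x" and free: "\<And>i. \<not> flat_on_axis_at x i"
    using x by (auto simp: Riordan_paths_def Motzkin_paths_iff)
  \<comment> \<open>The final down step is split off; what remains ends at height 1.\<close>
  define y where "y = butlast x"
  have x': "x = y @ [last x]" using M(1) by (cases x) (auto simp: y_def)
  have ly: "length y = n" using M(1) by (simp add: y_def)
  have hy: "height y + rise (last x) = 0" using M(2) x' by (metis height_append height_simps add.right_neutral)
  have sy: "stays_up y" using M(3) x' stays_up_append by metis
  have "0 \<le> height y" using sy[unfolded stays_up_def, rule_format, of "length y"] by simp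
  moreover have "last x \<noteq> H"
  proof
    assume l: "last x = H"
    then have "height y = 0" using hy by simp
    then have "flat_on_axis_at x n" using l ly x' M(1)
      by (metis flat_on_axis_at_def append_eq_conv_conj lessI nth_append_length)
    then show False using free by blast
  qed
  ultimately have lD: "last x = D" using hy by (cases "last x") auto
  then have hy1: "height y = 1" using hy by simp
  \<comment> \<open>The cut is made at the last return to the axis, the final point excepted.\<close>
  define P where "P k \<longleftrightarrow> k \<le> n \<and> height (take k y) = 0" for k
  define i where "i = (GREATEST k. P k)"
  have "P 0" by (simp add: P_def)
  then have Pi: "P i" unfolding i_def by (rule GreatestI_nat[where b = n]) (simp add: P_def)
  have gr: "k \<le> i" if "P k" for k
    unfolding i_def using that by (rule Greatest_le_nat[where b = n]) (simp add: P_def)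
  have "i \<noteq> n"
  proof
    assume "i = n"
    then show False using Pi hy1 ly by (simp add: P_def)
  qed
  then have i: "i < n" "height (take i y) = 0" using Pi by (auto simp: P_def)
  define u v where "u = take i y" and "v = drop (Suc i) y"
  have y: "y = u @ y ! i # v" using id_take_nth_drop[of i y] i ly by (simp add: u_def v_def)
  have lu: "length u = i" using i ly by (simp add: u_def)
  have hu: "height u = 0" using i by (simp add: u_def)
  have pos: "0 < height (take k (y ! i # v))" if "0 < k" "i + k \<le> n" for k
  proof -
    have t: "height (take (i + k) y) = height (take k (y ! i # v))"
      using lu hu by (subst y) (simp add: height_append)
    have "height (take (i + k) y) \<noteq> 0" using gr[of "i + k"] that by (auto simp: P_def)
    moreover have "0 \<le> height (take (i + k) y)" using sy by (simp add: stays_up_def)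
    ultimately show ?thesis using t by simp
  qed
  have yU: "y ! i = U" using pos[of 1] i by (cases "y ! i") auto
  have lv: "length v = n - Suc i" using ly by (simp add: v_def)
  have sv: "stays_up v"
    unfolding stays_up_def
  proof
    fix k
    show "0 \<le> height (take k v)"
    proof (cases "i + Suc k \<le> n")
      case True
      then show ?thesis using pos[of "Suc k"] yU by simp
    next
      case False
      then have "take k v = take (n - Suc i) v" using lv by simp
      then show ?thesis using pos[of "Suc (n - Suc i)"] yU i by simp
    qed
  qed
  have hv: "height v = 0" using hy1 hu yU y by (metis height_append height_simps(2) rise.simps(1) add_0 add_cancel_right_right)
  have xx: "x = u @ U # v @ [D]"
  proof -
    have "x = (u @ U # v) @ [D]" using x' y yU lD by metis
    then show ?thesis by simp
  qed
  have "axis_free u"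
    unfolding axis_free_def
  proof
    fix j
    show "\<not> flat_on_axis_at u j"
      using free[of j] unfolding xx flat_on_axis_at_append by (auto simp: flat_on_axis_at_def)
  qed
  moreover have "stays_up u" using sy y stays_up_append by metis
  ultimately show ?thesis using xx hu hv sv unfolding flat_decomp_def by blast
qed

lemma bij_betw_gamma: "bij_betw gamma (Motzkin_paths n - Riordan_paths n) (Riordan_paths (Suc n))"
  unfolding bij_betw_def
proof (intro conjI equalityI subsetI)
  show "inj_on gamma (Motzkin_paths n - Riordan_paths n)"
  proof (rule inj_onI)
    fix w w' assume w: "w \<in> Motzkin_paths n - Riordan_paths n" "w' \<in> Motzkin_paths n - Riordan_paths n"
      and eq: "gamma w = gamma w'"
    obtain u v where d: "flat_decomp w u v" using ex_flat_decomp[OF w(1)] by blast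
    obtain u' v' where d': "flat_decomp w' u' v'" using ex_flat_decomp[OF w(2)] by blast
    have e: "u @ U # v @ [D] = u' @ U # v' @ [D]"
      using eq flat_decomp_in(2)[OF d] flat_decomp_in(2)[OF d'] by simp
    have "u = u'" by (rule axis_return_unique[OF e]) (use d d' in \<open>auto simp: flat_decomp_def\<close>)
    then show "w = w'" using e d d' by (simp add: flat_decomp_def)
  qed
next
  fix x assume "x \<in> gamma ` (Motzkin_paths n - Riordan_paths n)"
  then obtain w where w: "w \<in> Motzkin_paths n - Riordan_paths n" "x = gamma w" by blast
  then obtain u v where "flat_decomp w u v" using ex_flat_decomp by blast
  moreover have "length w = n" using w by (auto simp: Motzkin_paths_def)
  ultimately show "x \<in> Riordan_paths (Suc n)" using flat_decomp_in w(2) by metis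
next
  fix x assume x: "x \<in> Riordan_paths (Suc n)"
  then obtain u v where uv: "x = u @ U # v @ [D]" "flat_decomp (u @ H # v) u v" using Riordan_decomp by blast
  have "length x = Suc n" using x by (simp add: Riordan_paths_def Motzkin_paths_def)
  then have "length (u @ H # v) = n" using uv(1) by simp
  then show "x \<in> gamma ` (Motzkin_paths n - Riordan_paths n)"
    using flat_decomp_in(1,2)[OF uv(2)] uv(1) by (metis image_eqI)
qed

lemma Riordan_subset: "Riordan_perms n \<subseteq> Motzkin_perms n" "Riordan_paths n \<subseteq> Motzkin_paths n"
  by (auto simp: Riordan_perms_def Riordan_paths_def)

lemma alpha_image_Riordan: "alpha ` Riordan_perms n = Riordan_paths n"
proof (intro equalityI subsetI)
  fix w assume "w \<in> alpha ` Riordan_perms n"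
  then obtain p where p: "p \<in> Riordan_perms n" "w = alpha p" by blast
  then have "p \<in> Motzkin_perms n" using Riordan_subset(1) by blast
  then show "w \<in> Riordan_paths n" using alpha_Riordan_iff p by simp
next
  fix w assume w: "w \<in> Riordan_paths n"
  then have "w \<in> Motzkin_paths n" using Riordan_subset(2) by blast
  then have "w \<in> alpha ` Motzkin_perms n" unfolding bij_betw_imp_surj_on[OF bij_betw_alpha] .
  then obtain p where p: "p \<in> Motzkin_perms n" "w = alpha p" by blast
  then have "p \<in> Riordan_perms n" using alpha_Riordan_iff w by simp
  then show "w \<in> alpha ` Riordan_perms n" using p(2) by simp
qed

lemma bij_betw_gamma_hat: "bij_betw (gamma_hat n) (Motzkin_perms n - Riordan_perms n) (Riordan_perms (Suc n))"
proof -
  have a1: "bij_betw alpha (Motzkin_perms n - Riordan_perms n) (Motzkin_paths n - Riordan_paths n)"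
  proof (rule bij_betw_subset[OF bij_betw_alpha])
    have "alpha ` (Motzkin_perms n - Riordan_perms n) = alpha ` Motzkin_perms n - alpha ` Riordan_perms n"
      by (rule inj_on_image_set_diff[OF bij_betw_imp_inj_on[OF bij_betw_alpha]]) (use Riordan_subset(1) in auto)
    then show "alpha ` (Motzkin_perms n - Riordan_perms n) = Motzkin_paths n - Riordan_paths n"
      unfolding alpha_image_Riordan bij_betw_imp_surj_on[OF bij_betw_alpha] .
  qed (rule Diff_subset)
  have a3: "bij_betw (inv_into (Motzkin_perms (Suc n)) alpha) (Riordan_paths (Suc n)) (Riordan_perms (Suc n))"
    using bij_betw_inv_into_subset[OF bij_betw_alpha Riordan_subset(1) alpha_image_Riordan] .
  have "bij_betw (inv_into (Motzkin_perms (Suc n)) alpha \<circ> (gamma \<circ> alpha))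
      (Motzkin_perms n - Riordan_perms n) (Riordan_perms (Suc n))"
    by (rule bij_betw_trans[OF bij_betw_trans[OF a1 bij_betw_gamma] a3])
  moreover have "gamma_hat n = inv_into (Motzkin_perms (Suc n)) alpha \<circ> (gamma \<circ> alpha)"
    by (rule ext) (simp add: gamma_hat_def)
  ultimately show ?thesis by simp
qed

section \<open>Removing the largest entry\<close>

fun strip :: "nat \<Rightarrow> filling \<Rightarrow> filling" where
  "strip m (S1, S2, S3) = (S1 - {m}, S2 - {m}, S3 - {m})"

lemma rho_tab:
  assumes "finite S1" "finite S2" "finite S3"
  shows "rho n (tab (S1, S2, S3)) = tab (strip (Suc n) (S1, S2, S3))"
proof -
  have "removeAll (Suc n) (sorted_list_of_set S) = sorted_list_of_set (S - {Suc n})" if "finite S" for S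
    using that by (intro sorted_list_of_set_eqI[symmetric])
      (auto simp: removeAll_filter_not_eq intro: sorted_wrt_filter)
  then have e: "sorted_list_of_set (S - {Suc n}) = removeAll (Suc n) (sorted_list_of_set S)" if "finite S" for S
    using that by simp
  have "filter (\<lambda>r. r \<noteq> []) (map (removeAll x) (filter (\<lambda>r. r \<noteq> []) rs)) = filter (\<lambda>r. r \<noteq> []) (map (removeAll x) rs)"
    for x :: nat and rs
    by (induction rs) auto
  then show ?thesis
    by (simp add: rho_def tableau_of_rows_def e[OF assms(1)] e[OF assms(2)] e[OF assms(3)] del: filter.simps)
qed

lemma below_strip:
  assumes "finite S" "S \<subseteq> {1..Suc n}"
  shows "below (S - {Suc n}) v = below S (min v (Suc n))"
proof -
  have "{z \<in> S - {Suc n}. z < v} = {z \<in> S. z < min v (Suc n)}" using assms(2) by force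
  then show ?thesis by (simp add: below_def)
qed

text \<open>Removing \<open>m\<close> flips the parity of exactly the row that contains it.  This is why equal parity is lost,
and why the row that contained \<open>m\<close> is known.\<close>

lemma parity_strip:
  assumes "finite S"
  shows "even (card S + card (S - {m})) \<longleftrightarrow> m \<notin> S"
proof (cases "m \<in> S")
  case True
  then have "card S = Suc (card (S - {m}))" using card_Suc_Diff1[OF assms] by simp
  then show ?thesis using True by presburger
qed simp

lemma strip_in:
  assumes "(S1, S2, S3) \<in> even_fillings (Suc n)"
  shows "strip (Suc n) (S1, S2, S3) \<in> std n - even_fillings n"
proof -
  have std: "(S1, S2, S3) \<in> std (Suc n)" and ev: "even (card S1 + card S2)" "even (card S2 + card S3)"
    using assms by (auto simp: even_fillings_def)
  note fin = std_finite[OF std] and D = stdD[OF std]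
  have sub: "S1 \<subseteq> {1..Suc n}" "S2 \<subseteq> {1..Suc n}" "S3 \<subseteq> {1..Suc n}" using D(1) by auto
  have dom: "dominates (S1 - {Suc n}) (S2 - {Suc n})" "dominates (S2 - {Suc n}) (S3 - {Suc n})"
    using D(5,6) sub fin unfolding dominates_def by (simp_all add: below_strip)
  have part: "(S1 - {Suc n}) \<union> (S2 - {Suc n}) \<union> (S3 - {Suc n}) = {1..n}"
  proof -
    have "(S1 - {Suc n}) \<union> (S2 - {Suc n}) \<union> (S3 - {Suc n}) = {1..Suc n} - {Suc n}" unfolding D(1)[symmetric] by blast
    also have "\<dots> = {1..n}" by auto
    finally show ?thesis .
  qed
  have "(S1 - {Suc n}, S2 - {Suc n}, S3 - {Suc n}) \<in> std n"
    by (rule stdI[OF part _ _ _ dom]) (use D in auto)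
  moreover have "(S1 - {Suc n}, S2 - {Suc n}, S3 - {Suc n}) \<notin> even_fillings n"
  proof
    assume "(S1 - {Suc n}, S2 - {Suc n}, S3 - {Suc n}) \<in> even_fillings n"
    then have ev': "even (card (S1 - {Suc n}) + card (S2 - {Suc n}))" "even (card (S2 - {Suc n}) + card (S3 - {Suc n}))"
      by (auto simp: even_fillings_def)
    have "even (card S1 + card (S1 - {Suc n})) \<longleftrightarrow> even (card S2 + card (S2 - {Suc n}))"
      "even (card S2 + card (S2 - {Suc n})) \<longleftrightarrow> even (card S3 + card (S3 - {Suc n}))"
      using ev ev' by presburger+
    then have "(Suc n \<notin> S1) = (Suc n \<notin> S2)" "(Suc n \<notin> S2) = (Suc n \<notin> S3)"
      unfolding parity_strip[OF fin(1)] parity_strip[OF fin(2)] parity_strip[OF fin(3)] .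
    moreover have "Suc n \<in> S1 \<union> S2 \<union> S3" using D(1) by simp
    ultimately show False using D(2) by blast
  qed
  ultimately show ?thesis by simp
qed

lemma inj_on_strip: "inj_on (strip (Suc n)) (even_fillings (Suc n))"
proof (rule inj_onI)
  fix s t assume s: "s \<in> even_fillings (Suc n)" and t: "t \<in> even_fillings (Suc n)"
    and eq: "strip (Suc n) s = strip (Suc n) t"
  obtain S1 S2 S3 where S: "s = (S1, S2, S3)" by (rule prod_cases3)
  obtain T1 T2 T3 where T: "t = (T1, T2, T3)" by (rule prod_cases3)
  have std: "(S1, S2, S3) \<in> std (Suc n)" "(T1, T2, T3) \<in> std (Suc n)"
    and ev: "even (card S1 + card S2)" "even (card S2 + card S3)" "even (card T1 + card T2)" "even (card T2 + card T3)"
    using s t by (auto simp: even_fillings_def S T)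
  note D = stdD[OF std(1)] stdD[OF std(2)]
  note fin = std_finite[OF std(1)] std_finite[OF std(2)]
  have E: "S1 - {Suc n} = T1 - {Suc n}" "S2 - {Suc n} = T2 - {Suc n}" "S3 - {Suc n} = T3 - {Suc n}"
    using eq by (auto simp: S T)
  have in1: "Suc n \<in> S1 \<union> S2 \<union> S3" "Suc n \<in> T1 \<union> T2 \<union> T3" unfolding D(1) D(7) by simp_all
  have par: "even (card A + card B) \<longleftrightarrow> (Suc n \<in> A \<longleftrightarrow> Suc n \<in> B)"
    if "finite A" "finite B" "A - {Suc n} = B - {Suc n}" for A B
    using parity_strip[OF that(1), of "Suc n"] parity_strip[OF that(2), of "Suc n"] unfolding that(3) even_add by blast
  note par = par[OF fin(1,4) E(1)] par[OF fin(2,5) E(2)] par[OF fin(3,6) E(3)]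
  have "even (card S1 + card T1) \<longleftrightarrow> even (card S2 + card T2)" "even (card S2 + card T2) \<longleftrightarrow> even (card S3 + card T3)"
    using ev by presburger+
  then have "(Suc n \<in> S1 \<longleftrightarrow> Suc n \<in> T1) \<and> (Suc n \<in> S2 \<longleftrightarrow> Suc n \<in> T2) \<and> (Suc n \<in> S3 \<longleftrightarrow> Suc n \<in> T3)"
    unfolding par using in1 D(2-4,8-10) by blast
  then show "s = t" using E unfolding S T by blast
qed

lemma dominates_insert_new:
  assumes "finite S" "finite T" "S \<subseteq> {1..n}" "T \<subseteq> {1..n}" "dominates S T" "card T < card S"
  shows "dominates S (insert (Suc n) T)"
  unfolding dominates_def
proof
  fix v
  have nin: "Suc n \<notin> T" using assms(4) by auto
  have le: "below T v \<le> below S v" using assms(5) by (simp add: dominates_def)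
  show "below (insert (Suc n) T) v \<le> below S v"
  proof (cases "Suc n < v")
    case True
    then have "below S v = card S" using assms(3) by (intro below_eq_card) force
    then show ?thesis
      using below_insert[OF assms(2) nin, of v] below_le_card[OF assms(2), of v] assms(6) True by simp
  next
    case False
    then show ?thesis using below_insert[OF assms(2) nin, of v] le by simp
  qed
qed

text \<open>The new largest entry goes to the row whose parity differs from the other two.  That row is shorter
than the one above it, because the lengths differ in parity.\<close>

lemma strip_surj:
  assumes G: "(T1, T2, T3) \<in> std n - even_fillings n"
  shows "(T1, T2, T3) \<in> strip (Suc n) ` even_fillings (Suc n)"
proof -
  have std: "(T1, T2, T3) \<in> std n" and ne: "\<not> (even (card T1 + card T2) \<and> even (card T2 + card T3))"
    using G by (auto simp: even_fillings_def)
  note fin = std_finite[OF std] and D = stdD[OF std] and C = std_card[OF std]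
  have sub: "T1 \<subseteq> {1..n}" "T2 \<subseteq> {1..n}" "T3 \<subseteq> {1..n}" using D(1) by auto
  then have nin: "Suc n \<notin> T1" "Suc n \<notin> T2" "Suc n \<notin> T3" by auto
  have n1: "{1..Suc n} = insert (Suc n) {1..n}" by auto
  have up: "dominates (insert (Suc n) A) B" if "finite A" "dominates A B" for A B
  proof -
    have "dominates (insert (Suc n) A) A" by (rule dominates_superset) (use that(1) in auto)
    then show ?thesis using that(2) by (rule dominates_trans)
  qed
  have strip: ?thesis if "(S1, S2, S3) \<in> even_fillings (Suc n)" "strip (Suc n) (S1, S2, S3) = (T1, T2, T3)" for S1 S2 S3
    using that by (metis image_eqI)
  consider "even (card T2 + card T3)" "odd (card T1 + card T2)" | "odd (card T2 + card T3)" "even (card T1 + card T2)"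
    | "odd (card T2 + card T3)" "odd (card T1 + card T2)" using ne by blast
  then show ?thesis
  proof cases
    case 1
    have "insert (Suc n) T1 \<union> T2 \<union> T3 = {1..Suc n}" unfolding n1 D(1)[symmetric] by blast
    then have "(insert (Suc n) T1, T2, T3) \<in> std (Suc n)"
      by (rule stdI) (use D(2-6) nin up[OF fin(1) D(5)] in auto)
    then have "(insert (Suc n) T1, T2, T3) \<in> even_fillings (Suc n)"
      using 1 fin nin by (simp add: even_fillings_def)
    then show ?thesis by (rule strip) (use nin in auto)
  next
    case 2
    then have lt: "card T3 < card T2" using C(2) by (auto simp: le_less)
    have "T1 \<union> T2 \<union> insert (Suc n) T3 = {1..Suc n}" unfolding n1 D(1)[symmetric] by blast
    then have "(T1, T2, insert (Suc n) T3) \<in> std (Suc n)"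
      by (rule stdI) (use D(2-6) nin dominates_insert_new[OF fin(2,3) sub(2,3) D(6) lt] in auto)
    then have "(T1, T2, insert (Suc n) T3) \<in> even_fillings (Suc n)"
      using 2 fin nin by (simp add: even_fillings_def)
    then show ?thesis by (rule strip) (use nin in auto)
  next
    case 3
    then have lt: "card T2 < card T1" using C(1) by (auto simp: le_less)
    have "T1 \<union> insert (Suc n) T2 \<union> T3 = {1..Suc n}" unfolding n1 D(1)[symmetric] by blast
    then have "(T1, insert (Suc n) T2, T3) \<in> std (Suc n)"
      by (rule stdI)
        (use D(2-6) nin dominates_insert_new[OF fin(1,2) sub(1,2) D(5) lt] up[OF fin(2) D(6)] in auto)
    then have "(T1, insert (Suc n) T2, T3) \<in> even_fillings (Suc n)"
      using 3 fin nin by (simp add: even_fillings_def)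
    then show ?thesis by (rule strip) (use nin in auto)
  qed
qed

lemma bij_betw_strip: "bij_betw (strip (Suc n)) (even_fillings (Suc n)) (std n - even_fillings n)"
proof (rule bij_betw_onto[OF inj_on_strip])
  fix s assume "s \<in> (even_fillings (Suc n))"
  then show "(strip (Suc n)) s \<in> (std n - even_fillings n)" using strip_in by (metis prod_cases3)
next
  fix t assume "t \<in> (std n - even_fillings n)"
  then show "t \<in> (strip (Suc n)) ` (even_fillings (Suc n))" using strip_surj by (metis prod_cases3)
qed

lemma bij_betw_rho: "bij_betw (rho n) (SYT3_eq (Suc n)) (SYT3 n - SYT3_eq n)"
proof -
  have sub: "even_fillings m \<subseteq> std m" for m by (auto simp: even_fillings_def)
  have t: "bij_betw tab (std n - even_fillings n) (SYT3 n - SYT3_eq n)"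
  proof (rule bij_betw_subset[OF bij_betw_tab])
    have "tab ` (std n - even_fillings n) = tab ` std n - tab ` even_fillings n"
      using bij_betw_tab[of n] sub by (intro inj_on_image_set_diff[of _ "std n"]) (auto simp: bij_betw_def)
    then show "tab ` (std n - even_fillings n) = SYT3 n - SYT3_eq n"
      using bij_betw_imp_surj_on[OF bij_betw_tab[of n]] bij_betw_imp_surj_on[OF bij_betw_even_tab[of n]] by simp
  qed blast
  let ?inv = "inv_into (even_fillings (Suc n)) tab"
  have "bij_betw (tab \<circ> (strip (Suc n) \<circ> ?inv)) (SYT3_eq (Suc n)) (SYT3 n - SYT3_eq n)"
    by (rule bij_betw_trans[OF bij_betw_trans[OF bij_betw_inv_into[OF bij_betw_even_tab] bij_betw_strip] t])
  moreover have "rho n T = (tab \<circ> (strip (Suc n) \<circ> ?inv)) T" if T: "T \<in> SYT3_eq (Suc n)" for T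
  proof -
    have F: "?inv T \<in> even_fillings (Suc n)" by (rule bij_betw_apply[OF bij_betw_inv_into[OF bij_betw_even_tab] T])
    have tT: "tab (?inv T) = T" by (rule bij_betw_inv_into_right[OF bij_betw_even_tab T])
    obtain S1 S2 S3 where e: "?inv T = (S1, S2, S3)" by (rule prod_cases3)
    have "(S1, S2, S3) \<in> std (Suc n)" using F sub unfolding e by blast
    from rho_tab[OF std_finite[OF this]] show ?thesis using tT unfolding e comp_apply by simp
  qed
  ultimately show ?thesis using bij_betw_cong by blast
qed

section \<open>The combined bijection\<close>

theorem theorem3p7:
  fixes n :: nat
  shows "bij_betw (Phi_tilde n) (Motzkin_perms n) (SYT3 n) \<and>
         bij_betw (Phi_tilde n) (Riordan_perms n) (SYT3_eq n)"
proof
  have sub: "Riordan_perms n \<subseteq> Motzkin_perms n" "SYT3_eq n \<subseteq> SYT3 n"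
    by (auto simp: Riordan_perms_def SYT3_eq_def)
  have "Phi_tilde n p = Phi p" if "p \<in> Riordan_perms n" for p using that by (simp add: Phi_tilde_def)
  then show R: "bij_betw (Phi_tilde n) (Riordan_perms n) (SYT3_eq n)"
    using bij_betw_Phi[of n] bij_betw_cong by blast
  have "bij_betw (rho n \<circ> (Phi \<circ> gamma_hat n)) (Motzkin_perms n - Riordan_perms n) (SYT3 n - SYT3_eq n)"
    by (rule bij_betw_trans[OF bij_betw_trans[OF bij_betw_gamma_hat bij_betw_Phi] bij_betw_rho])
  moreover have "Phi_tilde n p = (rho n \<circ> (Phi \<circ> gamma_hat n)) p" if "p \<in> Motzkin_perms n - Riordan_perms n" for p
    using that by (simp add: Phi_tilde_def)
  ultimately have "bij_betw (Phi_tilde n) (Motzkin_perms n - Riordan_perms n) (SYT3 n - SYT3_eq n)"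
    using bij_betw_cong by blast
  from bij_betw_combine[OF R this]
  show "bij_betw (Phi_tilde n) (Motzkin_perms n) (SYT3 n)" using sub by (simp add: Un_absorb1)
qed

end
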